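(* Let $(B,\Lambda,\underline v)$ be a bow diagram of affine type A that generates a non-empty bow variety, i.e. $\mathcal M_{\lambda,\theta}(B,\Lambda,\underline v)\ne\varnothing$ for some $(\lambda,\theta)\in\mathbb C^{\mathcal I}\times\mathbb Z^{\mathcal I}$. Then every bow diagram $(B,\Lambda,\underline v')$ obtained from $(B,\Lambda,\underline v)$ via supersymmetric increments generates a non-empty bow variety.
   Context: $\mathbb N=\{0,1,2,\dots\}$. **Bow diagrams.** Fix $n,w\ge 0$ with $n+w\ge1$. An affine type A bow diagram $(B,\Lambda,\underline v)$ consists of an anticlockwise oriented circle carrying $n$ arrows (set $\mathcal E$) and a set $\Lambda$ of $w$ x-points. Between the head of an arrow and the tail of the next arrow (anticlockwise) there is a wavy line; $\mathcal I$ is the set of wavy lines (if $n=1$ there is one wavy line, from the head to the tail of the unique arrow; if $n=0$ there is one closed wavy line). The x-points lie on the wavy lines and divide them into segments; $\mathcal I^s$ is the set of segments, i.e. of the $n+w$ arcs between consecutive elements of $\mathcal E\sqcup\Lambda$. The dimension vector is $\underline v=(v_\zeta)\in\mathbb Z^{\mathcal I^s}$ (negative entries allowed). For an arrow $e$, $v_{t(e)},v_{h(e)}$ are the dimensions of the segments at its tail and head. For an x-point $x$, $\zeta_x^-,\zeta_x^+$ are the segments just before and just after $x$ anticlockwise, with dimensions $v_x^\pm$. **Supersymmetric increments.** $(B,\Lambda,\underline v')$ is obtained from $(B,\Lambda,\underline v)$ via a supersymmetric increment between two arrows $e,e'$ (respectively two x-points $x,x'$) if $v'_\zeta-v_\zeta\ge0$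 for all $\zeta$ and $v'_\zeta-v_\zeta$ depends only on which of the arcs into which the circle is cut by $e,e'$ (respectively $x,x'$) contains $\zeta$; the two arrows or x-points may coincide, in which case there is a single arc. The term also refers to successive applications of these operations (between arrows or between x-points). **Bow varieties.** Let $\underline v\in\mathbb N^{\mathcal I^s}$. For $e\in\mathcal E$ let $\mathcal M^e$ be the space of pairs $(C_e,D_e)$, $C_e:\mathbb C^{v_{t(e)}}\to\mathbb C^{v_{h(e)}}$, $D_e:\mathbb C^{v_{h(e)}}\to\mathbb C^{v_{t(e)}}$ linear. For $x\in\Lambda$ let $\mathcal M^x$ be the space of tuples $(A_x,B_x^-,B_x^+,a_x,b_x)$ of linear maps $A_x:\mathbb C^{v_x^-}\to\mathbb C^{v_x^+}$, $B_x^\pm\in\mathrm{End}(\mathbb C^{v_x^\pm})$, $a_x:\mathbb C\to\mathbb C^{v_x^+}$, $b_x:\mathbb C^{v_x^-}\to\mathbb C$ with (i) $B_x^+A_x-A_xB_x^-+a_xb_x=0$; (ii) no nonzero $B_x^-$-invariant subspace is contained in $\ker A_x\cap\ker b_x$; (iii) no proper $B_x^+$-invariant subspace of $\mathbb C^{v_x^+}$ contains $\mathrm{Im}A_x+\mathrm{Im}\,a_x$. Put $\widetilde{\mathcal M}=\prod_x\mathcal M^x\times\bigoplus_e\mathcal M^e$, a symplectic affine variety with Hamiltonian base-change action of $\mathcal G=\prod_\zeta GL(v_\zeta)$. The moment map $\mu:\widetilde{\mathcal M}\to\bigoplus_\zeta\mathfrak{gl}(v_\zeta)$ has $\zeta$-component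 equal to the sum of the contributions of the two neighbours of $\zeta$: if the element just before $\zeta$ (anticlockwise) is an arrow $e$ it contributes $C_eD_e$, if it is an x-point $x$ it contributes $-B_x^+$; if the element just after $\zeta$ is an arrow $e$ it contributes $-D_eC_e$, if it is an x-point $x$ it contributes $B_x^-$. A deformation parameter $\lambda\in\mathbb C^{\mathcal I}$ is viewed in $\bigoplus_\zeta\mathfrak{gl}(v_\zeta)$ as $\lambda_\sigma\mathrm{Id}$ on the first segment $\zeta_\sigma$ of each wavy line $\sigma$ and $0$ on the other segments (if $n=0$, a fixed segment is designated as first). A stability parameter $\theta\in\mathbb Z^{\mathcal I}$ gives the character $\chi_\theta(g)=\prod_\sigma\det(g_{\zeta_\sigma})^{-\theta_\sigma}$. Then $\mathcal M_{\lambda,\theta}(B,\Lambda,\underline v)=\mu^{-1}(\lambda)/\!/_{\chi_\theta}\mathcal G$ (GIT quotient). If some $v_\zeta<0$, set $\mathcal M_{\lambda,\theta}=\varnothing$ for all $\lambda,\theta$. *)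

theory Defs
  imports
    "Jordan_Normal_Form.Gauss_Jordan_Elimination"
    "Jordan_Normal_Form.Matrix_Kernel"
    Complex_Main
begin

section \<open>Bow diagrams of affine type A\<close>

text \<open>
  The arrows and x-points on the circle are listed in anticlockwise order, starting
  anywhere; the list is read cyclically and its length is \<open>N = n + w\<close>. Segment \<open>i\<close> is the arc
  just after the \<open>i\<close>-th element, so the segments are the numbers below \<open>N\<close>. Functions
  on segments (dimension vectors) are only ever inspected on numbers below \<open>N\<close>. An arrow points
  anticlockwise: its tail is on the segment just before it and its head on the one just after it.
\<close>

datatype bow_elem = Arrow | XPoint

type_synonym bow = "bow_elem list"

definition seg_before :: "bow \<Rightarrow> nat \<Rightarrow> nat" where
  "seg_before B i = (i + length B - 1) mod length B"

definition seg_after :: "bow \<Rightarrow> nat \<Rightarrow> nat" where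
  "seg_after B i = i"

definition elem_before :: "bow \<Rightarrow> nat \<Rightarrow> nat" where
  "elem_before B \<zeta> = \<zeta>"

definition elem_after :: "bow \<Rightarrow> nat \<Rightarrow> nat" where
  "elem_after B \<zeta> = Suc \<zeta> mod length B"

text \<open>
  A wavy line is represented by its first segment, i.e. the one just after an arrow. If there are no
  arrows, the designated first segment of the closed wavy line is segment \<open>0\<close>; this is no
  restriction, since the listing of the elements may start anywhere.
\<close>

definition wavy_lines :: "bow \<Rightarrow> nat set" where
  "wavy_lines B =
     (if Arrow \<in> set B then {seg_after B i | i. i < length B \<and> B ! i = Arrow} else {0})"

section \<open>Supersymmetric increments\<close>

definition cut_arcs :: "bow \<Rightarrow> nat \<Rightarrow> nat \<Rightarrow> nat set set" where
  "cut_arcs B p q =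
     (if p = q then {{..<length B}}
      else {{min p q..<max p q}, {..<length B} - {min p q..<max p q}})"

definition susy_increment :: "bow \<Rightarrow> (nat \<Rightarrow> int) \<Rightarrow> (nat \<Rightarrow> int) \<Rightarrow> bool" where
  "susy_increment B v v' \<longleftrightarrow>
     (\<exists>p q. p < length B \<and> q < length B \<and> B ! p = B ! q \<and>
        (\<forall>\<zeta><length B. v' \<zeta> - v \<zeta> \<ge> 0) \<and>
        (\<forall>S\<in>cut_arcs B p q. \<forall>\<zeta>\<in>S. \<forall>\<eta>\<in>S. v' \<zeta> - v \<zeta> = v' \<eta> - v \<eta>))"

definition susy_increments :: "bow \<Rightarrow> (nat \<Rightarrow> int) \<Rightarrow> (nat \<Rightarrow> int) \<Rightarrow> bool" where
  "susy_increments B = (susy_increment B)\<^sup>*\<^sup>*"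

section \<open>The space of representations\<close>

datatype elem_data =
    ArrowData "complex mat" "complex mat" \<comment> \<open>\<open>C\<close>, \<open>D\<close>\<close>
  | XData "complex mat" "complex mat" "complex mat" "complex mat" "complex mat"
      \<comment> \<open>\<open>A\<close>, \<open>B\<^sup>-\<close>, \<open>B\<^sup>+\<close>, \<open>a\<close>, \<open>b\<close>\<close>

type_synonym bow_rep = "elem_data list"

definition arrow_space :: "nat \<Rightarrow> nat \<Rightarrow> elem_data set" where
  "arrow_space vt vh = {ArrowData C D | C D. C \<in> carrier_mat vh vt \<and> D \<in> carrier_mat vt vh}"

definition lin_subspace :: "nat \<Rightarrow> complex vec set \<Rightarrow> bool" where
  "lin_subspace n W \<longleftrightarrow> VectorSpace.subspace class_ring W (module_vec TYPE(complex) n)"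

definition invariant_under :: "complex mat \<Rightarrow> complex vec set \<Rightarrow> bool" where
  "invariant_under M W \<longleftrightarrow> (\<forall>x\<in>W. M *\<^sub>v x \<in> W)"

definition xpoint_space :: "nat \<Rightarrow> nat \<Rightarrow> elem_data set" where
  "xpoint_space vm vp = {XData A Bm Bp a b | A Bm Bp a b.
     A \<in> carrier_mat vp vm \<and> Bm \<in> carrier_mat vm vm \<and> Bp \<in> carrier_mat vp vp \<and>
     a \<in> carrier_mat vp 1 \<and> b \<in> carrier_mat 1 vm \<and>
     Bp * A - A * Bm + a * b = 0\<^sub>m vp vm \<and>
     (\<forall>W. lin_subspace vm W \<and> invariant_under Bm W \<and> W \<subseteq> mat_kernel A \<inter> mat_kernel b
        \<longrightarrow> W = {0\<^sub>v vm}) \<and>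
     (\<forall>W. lin_subspace vp W \<and> invariant_under Bp W \<and>
        {A *\<^sub>v x + a *\<^sub>v y | x y. x \<in> carrier_vec vm \<and> y \<in> carrier_vec 1} \<subseteq> W
        \<longrightarrow> W = carrier_vec vp)}"

definition elem_space :: "bow \<Rightarrow> (nat \<Rightarrow> nat) \<Rightarrow> nat \<Rightarrow> elem_data set" where
  "elem_space B v i =
     (case B ! i of
        Arrow \<Rightarrow> arrow_space (v (seg_before B i)) (v (seg_after B i))
      | XPoint \<Rightarrow> xpoint_space (v (seg_before B i)) (v (seg_after B i)))"

definition rep_space :: "bow \<Rightarrow> (nat \<Rightarrow> nat) \<Rightarrow> bow_rep set" where
  "rep_space B v = {m. length m = length B \<and> (\<forall>i<length B. m ! i \<in> elem_space B v i)}"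

section \<open>Gauge group, moment map and characters\<close>

definition gauge_group :: "bow \<Rightarrow> (nat \<Rightarrow> nat) \<Rightarrow> complex mat list set" where
  "gauge_group B v =
     {g. length g = length B \<and>
         (\<forall>\<zeta><length B. g ! \<zeta> \<in> carrier_mat (v \<zeta>) (v \<zeta>) \<and> invertible_mat (g ! \<zeta>))}"

fun elem_act :: "complex mat \<Rightarrow> complex mat \<Rightarrow> elem_data \<Rightarrow> elem_data" where
  "elem_act g h (ArrowData C D) =
     ArrowData (h * C * the (mat_inverse g)) (g * D * the (mat_inverse h))"
| "elem_act g h (XData A Bm Bp a b) =
     XData (h * A * the (mat_inverse g)) (g * Bm * the (mat_inverse g))
       (h * Bp * the (mat_inverse h)) (h * a) (b * the (mat_inverse g))"

definition gauge_act :: "bow \<Rightarrow> complex mat list \<Rightarrow> bow_rep \<Rightarrow> bow_rep" where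
  "gauge_act B g m =
     map (\<lambda>i. elem_act (g ! seg_before B i) (g ! seg_after B i) (m ! i)) [0..<length B]"

fun moment_from_before :: "elem_data \<Rightarrow> complex mat" where
  "moment_from_before (ArrowData C D) = C * D"
| "moment_from_before (XData A Bm Bp a b) = - Bp"

fun moment_from_after :: "elem_data \<Rightarrow> complex mat" where
  "moment_from_after (ArrowData C D) = - (D * C)"
| "moment_from_after (XData A Bm Bp a b) = Bm"

definition moment_map :: "bow \<Rightarrow> bow_rep \<Rightarrow> nat \<Rightarrow> complex mat" where
  "moment_map B m \<zeta> =
     moment_from_before (m ! elem_before B \<zeta>) + moment_from_after (m ! elem_after B \<zeta>)"

definition deformation :: "bow \<Rightarrow> (nat \<Rightarrow> nat) \<Rightarrow> (nat \<Rightarrow> complex) \<Rightarrow> nat \<Rightarrow> complex mat" where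
  "deformation B v lam \<zeta> =
     (if \<zeta> \<in> wavy_lines B then lam \<zeta> \<cdot>\<^sub>m 1\<^sub>m (v \<zeta>) else 0\<^sub>m (v \<zeta>) (v \<zeta>))"

definition moment_fibre :: "bow \<Rightarrow> (nat \<Rightarrow> nat) \<Rightarrow> (nat \<Rightarrow> complex) \<Rightarrow> bow_rep set" where
  "moment_fibre B v lam =
     {m \<in> rep_space B v. \<forall>\<zeta><length B. moment_map B m \<zeta> = deformation B v lam \<zeta>}"

definition gauge_char :: "bow \<Rightarrow> (nat \<Rightarrow> int) \<Rightarrow> complex mat list \<Rightarrow> complex" where
  "gauge_char B \<theta> g = (\<Prod>\<sigma>\<in>wavy_lines B. det (g ! \<sigma>) powi (- \<theta> \<sigma>))"

section \<open>Regular functions and the GIT quotient\<close>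

fun data_mats :: "elem_data \<Rightarrow> complex mat list" where
  "data_mats (ArrowData C D) = [C, D]"
| "data_mats (XData A Bm Bp a b) = [A, Bm, Bp, a, b]"

text \<open>
  The guards make \<open>coord\<close> total. On a representation space the sizes of all lists and
  matrices are constant, so there each \<open>coord\<close> is a matrix entry or identically \<open>0\<close>.
\<close>

definition coord :: "nat \<Rightarrow> nat \<Rightarrow> nat \<Rightarrow> nat \<Rightarrow> bow_rep \<Rightarrow> complex" where
  "coord i k r c m =
     (if i < length m \<and> k < length (data_mats (m ! i)) \<and>
         r < dim_row (data_mats (m ! i) ! k) \<and> c < dim_col (data_mats (m ! i) ! k)
      then data_mats (m ! i) ! k $$ (r, c) else 0)"

inductive_set poly_funs :: "(bow_rep \<Rightarrow> complex) set" where
  poly_const: "(\<lambda>_. z) \<in> poly_funs"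
| poly_coord: "coord i k r c \<in> poly_funs"
| poly_add: "f \<in> poly_funs \<Longrightarrow> g \<in> poly_funs \<Longrightarrow> (\<lambda>m. f m + g m) \<in> poly_funs"
| poly_mult: "f \<in> poly_funs \<Longrightarrow> g \<in> poly_funs \<Longrightarrow> (\<lambda>m. f m * g m) \<in> poly_funs"

text \<open>
  Conditions (ii) and (iii) on an x-point are open, so the representation space is only locally
  closed in the vector space of all matrix tuples and its regular functions are locally, but not
  necessarily globally, restrictions of quotients of polynomials. A function on \<open>X\<close> is
  extended by \<open>0\<close>.
\<close>

definition regular_funs :: "bow_rep set \<Rightarrow> (bow_rep \<Rightarrow> complex) set" where
  "regular_funs X =
     {f. (\<forall>m. m \<notin> X \<longrightarrow> f m = 0) \<and>
         (\<forall>x\<in>X. \<exists>p\<in>poly_funs. \<exists>q\<in>poly_funs. q x \<noteq> 0 \<and>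
            (\<forall>m\<in>X. q m \<noteq> 0 \<longrightarrow> f m = p m / q m))}"

definition semi_invariants ::
    "bow \<Rightarrow> (nat \<Rightarrow> nat) \<Rightarrow> (nat \<Rightarrow> complex) \<Rightarrow> (nat \<Rightarrow> int) \<Rightarrow> nat \<Rightarrow> (bow_rep \<Rightarrow> complex) set" where
  "semi_invariants B v lam \<theta> d =
     {f \<in> regular_funs (moment_fibre B v lam).
        \<forall>g\<in>gauge_group B v. \<forall>m\<in>moment_fibre B v lam.
          f (gauge_act B g m) = gauge_char B \<theta> g ^ d * f m}"

text \<open>
  \<open>Proj\<close> of the graded algebra of functions with homogeneous pieces \<open>S 0, S 1, \<dots>\<close>:
  the homogeneous prime ideals not containing the irrelevant ideal. A homogeneous ideal is given by
  the family \<open>P\<close> of its homogeneous pieces, and its primality may be tested on homogeneous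
  elements. Properness follows from the last condition.
\<close>

definition Proj :: "(nat \<Rightarrow> ('a \<Rightarrow> complex) set) \<Rightarrow> (nat \<Rightarrow> ('a \<Rightarrow> complex) set) set" where
  "Proj S =
     {P. (\<forall>d. P d \<subseteq> S d) \<and>
         (\<forall>d. (\<lambda>_. 0) \<in> P d) \<and>
         (\<forall>d. \<forall>f\<in>P d. \<forall>g\<in>P d. (\<lambda>m. f m + g m) \<in> P d) \<and>
         (\<forall>d e. \<forall>f\<in>S d. \<forall>g\<in>P e. (\<lambda>m. f m * g m) \<in> P (d + e)) \<and>
         (\<forall>d e. \<forall>f\<in>S d. \<forall>g\<in>S e. (\<lambda>m. f m * g m) \<in> P (d + e) \<longrightarrow> f \<in> P d \<or> g \<in> P e) \<and>
         \<not> (\<forall>d\<ge>1. S d \<subseteq> P d)}"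

definition bow_variety ::
    "bow \<Rightarrow> (nat \<Rightarrow> int) \<Rightarrow> (nat \<Rightarrow> complex) \<Rightarrow> (nat \<Rightarrow> int)
       \<Rightarrow> (nat \<Rightarrow> (bow_rep \<Rightarrow> complex) set) set" where
  "bow_variety B v lam \<theta> =
     (if \<exists>\<zeta><length B. v \<zeta> < 0 then {}
      else Proj (semi_invariants B (\<lambda>\<zeta>. nat (v \<zeta>)) lam \<theta>))"

end

theory Submission
  imports Defs
    "Jordan_Normal_Form.DL_Rank"
    "Jordan_Normal_Form.Jordan_Normal_Form_Existence"
    "Jordan_Normal_Form.Jordan_Normal_Form_Uniqueness"
begin

text \<open>
  If a moment fibre is empty, there are no nonzero semi-invariants, so \<open>Proj\<close> is empty. Conversely, if
  the fibre over \<open>0\<close> has a point, then for trivial stability the functions vanishing at that point form a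
  point of \<open>Proj\<close>. Hence the theorem is about the set of those dimension vectors for which some moment
  fibre is nonempty. This set has a combinatorial description, the predicate \<open>admissible\<close>: there are
  partitions \<open>p \<zeta>\<close> of the numbers \<open>v \<zeta>\<close> such that across an arrow corresponding parts differ by at most
  one, and such that across an x-point the partitions \<open>p\<close> (before) and \<open>q\<close> (after) satisfy
  \<open>p (i + 1) \<le> q i\<close> and \<open>q (i + 1) \<le> p i\<close>.

  \<^item> \<open>fibre_imp_admissible\<close>. By the moment map equation the contributions of the two neighbours of a
    segment are, up to sign, matrices that differ by a scalar matrix. Such matrices have the same
    \<open>profile\<close>, namely the partition by the degrees of the invariant factors, whose \<open>i\<close>-th part is the sum
    over all eigenvalues of the size of the \<open>i\<close>-th Jordan block. Across an arrow one compares \<open>C D\<close> with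
    \<open>D C\<close>: their Jordan blocks for nonzero eigenvalues agree, and those for \<open>0\<close> differ in size by at
    most one (\<open>profile_arrow\<close>). The data at an x-point amount to a \<open>\<complex>[x]\<close>-module that embeds into the
    spaces on both sides with cyclic cokernels, so the block sizes interlace (\<open>profile_xpoint\<close>).

  \<^item> \<open>admissible_imp_fibre\<close>. Conversely, partitions as above are realised over \<open>\<lambda> = 0\<close> by nilpotent
    matrices of these Jordan types. The maps at an arrow are written down row by row
    (\<open>arrow_exists\<close>). For an x-point one embeds the nilpotent module with parts \<open>min (p i) (q i)\<close>
    into both sides with cyclic cokernels (\<open>cyclic_ext_exists\<close>) and reconstructs the data from the two
    embeddings (\<open>xpoint_of_cyclic_ext\<close>).

  \<^item> \<open>susy_increments_admissible\<close>. An increment between x-points is realised by lengthening the first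
    rows of the partitions, an increment between arrows by appending rows of length one.

  The detour through partitions replaces an arbitrary \<open>\<lambda>\<close> by \<open>0\<close>. This matters for increments between
  arrows: over a given \<open>\<lambda>\<close>, a one-dimensional direct summand supported on an arc between two arrows can
  be added only if the sum of \<open>\<lambda>\<close> over the wavy lines in the arc vanishes.
\<close>

section \<open>Dimensions of subspaces and kernels\<close>

lemma lin_subspace_iff:
  "lin_subspace n W \<longleftrightarrow> W \<subseteq> carrier_vec n \<and> 0\<^sub>v n \<in> W \<and>
     (\<forall>x\<in>W. \<forall>y\<in>W. x + y \<in> W) \<and> (\<forall>c. \<forall>x\<in>W. c \<cdot>\<^sub>v x \<in> W)"
proof -
  interpret V: vec_space "TYPE(complex)" n .
  show ?thesis
    unfolding lin_subspace_def VectorSpace.subspace_def submodule_def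
    using V.vectorspace_axioms V.module_axioms by (auto simp: module_vec_simps)
qed

definition sdim :: "nat \<Rightarrow> complex vec set \<Rightarrow> nat" where
  "sdim n W = vectorspace.dim class_ring (module_vec TYPE(complex) n\<lparr>carrier := W\<rparr>)"

lemma lin_subspace_is_vs:
  assumes "lin_subspace n W"
  shows "vectorspace class_ring (module_vec TYPE(complex) n\<lparr>carrier := W\<rparr>)"
proof -
  interpret V: vec_space "TYPE(complex)" n .
  show ?thesis using V.subspace_is_vs assms unfolding lin_subspace_def by auto
qed

text \<open>
  A maximal linearly independent subset of a subspace spans it; it exists because the ambient dimension
  bounds the size of such subsets.
\<close>

lemma lin_subspace_eq_span:
  assumes W: "lin_subspace n W"
  obtains b where "finite b" "b \<subseteq> W" "LinearCombinations.module.span class_ring (module_vec TYPE(complex) n) b = W" "card b = sdim n W"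
proof -
  interpret V: vec_space "TYPE(complex)" n .
  define Q where "Q k \<longleftrightarrow> (\<exists>b\<subseteq>W. finite b \<and> V.lin_indpt b \<and> card b = k)" for k
  have Wc: "W \<subseteq> carrier_vec n" using W unfolding lin_subspace_iff by auto
  have bnd: "k \<le> n" if "Q k" for k
    using that V.li_le_dim(2)[OF V.fin_dim] Wc unfolding Q_def V.dim_is_n by (metis V.cV subset_trans)
  have "Q 0" unfolding Q_def by (rule exI[of _ "{}"]) (auto simp: V.lin_dep_def)
  then obtain k where k: "Q k" "\<And>j. Q j \<Longrightarrow> j \<le> k"
    using bnd Greatest_le_nat[of Q] GreatestI_nat[of Q] by metis
  then obtain b where b: "b \<subseteq> W" "finite b" "V.lin_indpt b" "card b = k" unfolding Q_def by auto
  have "W \<subseteq> V.span b"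
  proof
    fix v assume v: "v \<in> W"
    show "v \<in> V.span b"
    proof (rule ccontr)
      assume n: "v \<notin> V.span b"
      hence vb: "v \<notin> b" using V.span_mem[of b v] b Wc by auto
      have "V.lin_indpt (b \<union> {v})"
        using V.lin_dep_iff_in_span[OF _ b(3) _ vb] b Wc v n by auto
      hence "Q (Suc k)" unfolding Q_def using b v vb
        by (intro exI[of _ "b \<union> {v}"]) auto
      from k(2)[OF this] show False by simp
    qed
  qed
  moreover have "V.span b \<subseteq> W"
    using V.span_is_subset[OF b(1)] W unfolding lin_subspace_def VectorSpace.subspace_def by auto
  ultimately have sp: "V.span b = W" by auto
  have sub: "submodule class_ring W V.V"
    using W unfolding lin_subspace_def VectorSpace.subspace_def by auto
  interpret W: vectorspace class_ring "module_vec TYPE(complex) n\<lparr>carrier := W\<rparr>"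
    by (rule lin_subspace_is_vs[OF W])
  have "W.basis b" unfolding W.basis_def
    using V.span_li_not_depend[OF b(1) sub] sp b by auto
  hence "card b = sdim n W" unfolding sdim_def using W.dim_basis[OF b(2)] by simp
  with that b sp show ?thesis by auto
qed

lemma lin_subspace_fin_dim:
  assumes W: "lin_subspace n W"
  shows "vectorspace.fin_dim class_ring (module_vec TYPE(complex) n\<lparr>carrier := W\<rparr>)"
proof -
  interpret V: vec_space "TYPE(complex)" n .
  obtain b where b: "finite b" "b \<subseteq> W" "V.span b = W" "card b = sdim n W" by (rule lin_subspace_eq_span[OF W])
  have "b \<subseteq> carrier V.V" using b W unfolding lin_subspace_iff by auto
  from V.fin_dim_span[OF b(1) this] b(3) show ?thesis by simp
qed

lemma sdim_rank_nullity:
  assumes W: "lin_subspace n W" and M: "M \<in> carrier_mat m n"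
  shows "sdim m ((\<lambda>x. M *\<^sub>v x) ` W) + sdim n (W \<inter> mat_kernel M) = sdim n W"
proof -
  interpret V: vec_space "TYPE(complex)" n .
  interpret U: vec_space "TYPE(complex)" m .
  interpret W: vectorspace class_ring "module_vec TYPE(complex) n\<lparr>carrier := W\<rparr>"
    by (rule lin_subspace_is_vs[OF W])
  have Wc: "W \<subseteq> carrier_vec n" using W unfolding lin_subspace_iff by auto
  interpret T: linear_map class_ring "module_vec TYPE(complex) n\<lparr>carrier := W\<rparr>"
      "module_vec TYPE(complex) m" "\<lambda>x. M *\<^sub>v x"
  proof
    show "(*\<^sub>v) M \<in> LinearCombinations.module_hom class_ring (V.vs W) U.V"
      unfolding LinearCombinations.module_hom_def using M Wc W
      by (auto simp: lin_subspace_iff module_vec_simps mult_add_distrib_mat_vec[OF M] mult_mat_vec[OF M] subset_iff)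
  qed
  have im: "T.imT = (\<lambda>x. M *\<^sub>v x) ` W" unfolding T.im_def by auto
  have ker: "T.kerT = W \<inter> mat_kernel M" unfolding T.ker_def using Wc M
    by (auto simp: mat_kernel[OF M] module_vec_simps)
  show ?thesis
    using T.rank_nullity[OF lin_subspace_fin_dim[OF W]]
    unfolding sdim_def im ker by simp
qed

lemma sdim_mono:
  assumes W: "lin_subspace n W" and W': "lin_subspace n W'" and sub: "W \<subseteq> W'"
  shows "sdim n W \<le> sdim n W'"
proof -
  interpret V: vec_space "TYPE(complex)" n .
  interpret W': vectorspace class_ring "module_vec TYPE(complex) n\<lparr>carrier := W'\<rparr>"
    by (rule lin_subspace_is_vs[OF W'])
  have "VectorSpace.subspace class_ring W (module_vec TYPE(complex) n\<lparr>carrier := W'\<rparr>)"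
    unfolding VectorSpace.subspace_def submodule_def
    using W'.vectorspace_axioms W'.module_axioms W sub
    by (auto simp: lin_subspace_iff module_vec_simps)
  from W'.subspace_dim[OF this lin_subspace_fin_dim[OF W']] lin_subspace_fin_dim[OF W]
  show ?thesis unfolding sdim_def by simp
qed

lemma sdim_carrier: "sdim n (carrier_vec n) = n"
proof -
  interpret V: vec_space "TYPE(complex)" n .
  have e: "module_vec TYPE(complex) n\<lparr>carrier := carrier_vec n\<rparr> = module_vec TYPE(complex) n"
    by (simp add: module_vec_def)
  show ?thesis unfolding sdim_def e by (rule V.dim_is_n)
qed

lemma kernel_dim_sdim:
  assumes "M \<in> carrier_mat m n" shows "kernel_dim (M :: complex mat) = sdim n (mat_kernel M)"
proof -
  interpret kernel m n M by unfold_locales fact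
  show ?thesis using assms unfolding kernel_dim sdim_def by simp
qed

lemma lin_subspace_kernel:
  assumes M: "M \<in> carrier_mat m n" shows "lin_subspace n (mat_kernel M)"
  unfolding lin_subspace_iff mat_kernel[OF M]
  using mult_add_distrib_mat_vec[OF M] mult_mat_vec[OF M] M by auto

lemma lin_subspace_carrier: "lin_subspace n (carrier_vec n)"
  unfolding lin_subspace_iff by auto

lemma lin_subspace_Int:
  "lin_subspace n W \<Longrightarrow> lin_subspace n W' \<Longrightarrow> lin_subspace n (W \<inter> W')"
  unfolding lin_subspace_iff by auto

lemma lin_subspace_image:
  assumes M: "M \<in> carrier_mat m n" and W: "lin_subspace n W"
  shows "lin_subspace m ((\<lambda>x. M *\<^sub>v x) ` W)"
  unfolding lin_subspace_iff
proof (intro conjI ballI allI)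
  have Wc: "W \<subseteq> carrier_vec n" using W unfolding lin_subspace_iff by auto
  show "(*\<^sub>v) M ` W \<subseteq> carrier_vec m" using M Wc by auto
  show "0\<^sub>v m \<in> (*\<^sub>v) M ` W"
    using W M by (auto simp: lin_subspace_iff intro!: image_eqI[of _ _ "0\<^sub>v n"])
  fix x y assume "x \<in> (*\<^sub>v) M ` W" "y \<in> (*\<^sub>v) M ` W"
  then obtain u w where uw: "u \<in> W" "w \<in> W" "x = M *\<^sub>v u" "y = M *\<^sub>v w" by auto
  have "M *\<^sub>v (u + w) = x + y" using uw mult_add_distrib_mat_vec[OF M] Wc by auto
  moreover have "u + w \<in> W" using uw W by (auto simp: lin_subspace_iff)
  ultimately show "x + y \<in> (*\<^sub>v) M ` W" by (metis imageI)
next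
  have Wc: "W \<subseteq> carrier_vec n" using W unfolding lin_subspace_iff by auto
  fix c x assume "x \<in> (*\<^sub>v) M ` W"
  then obtain u where u: "u \<in> W" "x = M *\<^sub>v u" by auto
  have "M *\<^sub>v (c \<cdot>\<^sub>v u) = c \<cdot>\<^sub>v x" using u mult_mat_vec[OF M] Wc by auto
  moreover have "c \<cdot>\<^sub>v u \<in> W" using u W by (auto simp: lin_subspace_iff)
  ultimately show "c \<cdot>\<^sub>v x \<in> (*\<^sub>v) M ` W" by (metis imageI)
qed

lemma lin_subspace_minus:
  assumes W: "lin_subspace n W" and "x \<in> W" "y \<in> W" shows "x - y \<in> W"
proof -
  have "x - y = x + (-1) \<cdot>\<^sub>v y" using assms unfolding lin_subspace_iff by (intro eq_vecI) auto
  thus ?thesis using assms unfolding lin_subspace_iff by auto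
qed

lemma lin_subspace_eq_carrierI:
  assumes W: "lin_subspace n W" and u: "\<And>c. c < n \<Longrightarrow> unit_vec n c \<in> W"
  shows "W = carrier_vec n"
proof -
  interpret V: vec_space "TYPE(complex)" n .
  have "set (unit_vecs n) \<subseteq> W" using u unfolding unit_vecs_def by auto
  moreover have "submodule class_ring W V.V"
    using W unfolding lin_subspace_def VectorSpace.subspace_def by auto
  ultimately have "V.span (set (unit_vecs n)) \<subseteq> W" by (rule V.span_is_subset)
  thus ?thesis using V.span_unit_vecs_is_carrier W unfolding lin_subspace_iff by auto
qed

lemma mult_mat_zero_vec:
  fixes M :: "'a :: comm_ring_1 mat"
  shows "M \<in> carrier_mat m n \<Longrightarrow> M *\<^sub>v 0\<^sub>v n = 0\<^sub>v m"
  by (intro eq_vecI) auto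

lemma sdim_zero: "sdim n {0\<^sub>v n} = 0"
proof -
  have "mat_kernel (1\<^sub>m n :: complex mat) = {0\<^sub>v n}" unfolding mat_kernel[OF one_carrier_mat] by auto
  thus ?thesis using sdim_rank_nullity[OF lin_subspace_carrier, of "1\<^sub>m n" n n] by (simp add: image_def)
qed

lemma sdim_image_inj:
  assumes W: "lin_subspace n W" and M: "M \<in> carrier_mat m n" and "W \<inter> mat_kernel M \<subseteq> {0\<^sub>v n}"
  shows "sdim m ((\<lambda>x. M *\<^sub>v x) ` W) = sdim n W"
proof -
  have "0\<^sub>v n \<in> W \<inter> mat_kernel M" using lin_subspace_Int[OF W lin_subspace_kernel[OF M]]
    unfolding lin_subspace_iff by blast
  hence "W \<inter> mat_kernel M = {0\<^sub>v n}" using assms(3) by blast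
  with sdim_rank_nullity[OF W M] show ?thesis by (simp add: sdim_zero)
qed

lemma sdim_image_hyperplane:
  assumes W: "lin_subspace n W" and N: "N \<in> carrier_mat m n" and f: "f \<in> carrier_mat 1 n"
  shows "sdim m ((\<lambda>x. N *\<^sub>v x) ` W) \<le> sdim m ((\<lambda>x. N *\<^sub>v x) ` (W \<inter> mat_kernel f)) + 1"
proof -
  have Wc: "W \<subseteq> carrier_vec n" using W unfolding lin_subspace_iff by auto
  have Wf: "lin_subspace n (W \<inter> mat_kernel f)" by (rule lin_subspace_Int[OF W lin_subspace_kernel[OF f]])
  have "(\<lambda>x. f *\<^sub>v x) ` W \<subseteq> carrier_vec 1" using f Wc by auto
  from sdim_mono[OF lin_subspace_image[OF f W] lin_subspace_carrier this]
  have "sdim 1 ((\<lambda>x. f *\<^sub>v x) ` W) \<le> 1" unfolding sdim_carrier .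
  moreover have "sdim 1 ((\<lambda>x. f *\<^sub>v x) ` W) + sdim n (W \<inter> mat_kernel f) = sdim n W"
    by (rule sdim_rank_nullity[OF W f])
  moreover have "sdim m ((\<lambda>x. N *\<^sub>v x) ` W) + sdim n (W \<inter> mat_kernel N) = sdim n W"
    by (rule sdim_rank_nullity[OF W N])
  moreover have "sdim m ((\<lambda>x. N *\<^sub>v x) ` (W \<inter> mat_kernel f)) + sdim n (W \<inter> mat_kernel f \<inter> mat_kernel N)
     = sdim n (W \<inter> mat_kernel f)" by (rule sdim_rank_nullity[OF Wf N])
  moreover have "sdim n (W \<inter> mat_kernel f \<inter> mat_kernel N) \<le> sdim n (W \<inter> mat_kernel N)"
    by (rule sdim_mono) (auto intro: lin_subspace_Int W Wf lin_subspace_kernel[OF N])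
  ultimately show ?thesis by simp
qed

lemma kernel_dim_mult:
  fixes M N :: "complex mat"
  assumes M: "M \<in> carrier_mat l m" and N: "N \<in> carrier_mat m n"
  shows "kernel_dim (M * N) =
    kernel_dim N + sdim m ((\<lambda>x. N *\<^sub>v x) ` carrier_vec n \<inter> mat_kernel M)"
proof -
  have MN: "M * N \<in> carrier_mat l n" using M N by simp
  have k: "mat_kernel (M * N) \<inter> mat_kernel N = mat_kernel N"
    using mat_kernel_mult_subset[OF N M] by auto
  have i: "(\<lambda>x. N *\<^sub>v x) ` mat_kernel (M * N) = (\<lambda>x. N *\<^sub>v x) ` carrier_vec n \<inter> mat_kernel M"
  proof (intro Set.set_eqI iffI)
    fix y assume "y \<in> (\<lambda>x. N *\<^sub>v x) ` mat_kernel (M * N)"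
    thus "y \<in> (\<lambda>x. N *\<^sub>v x) ` carrier_vec n \<inter> mat_kernel M"
      unfolding mat_kernel[OF MN] mat_kernel[OF M] using M N by (auto simp: assoc_mult_mat_vec[OF M N])
  next
    fix y assume "y \<in> (\<lambda>x. N *\<^sub>v x) ` carrier_vec n \<inter> mat_kernel M"
    thus "y \<in> (\<lambda>x. N *\<^sub>v x) ` mat_kernel (M * N)"
      unfolding mat_kernel[OF MN] mat_kernel[OF M] using M N by (auto simp: assoc_mult_mat_vec[OF M N])
  qed
  show ?thesis
    using sdim_rank_nullity[OF lin_subspace_kernel[OF MN] N] unfolding i k
      kernel_dim_sdim[OF MN] kernel_dim_sdim[OF N] by simp
qed

lemma kernel_dim_le:
  fixes M :: "complex mat"
  assumes M: "M \<in> carrier_mat m n" shows "kernel_dim M \<le> n"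
  unfolding kernel_dim_sdim[OF M]
  using sdim_mono[OF lin_subspace_kernel[OF M] lin_subspace_carrier] mat_kernel_carrier[OF M] sdim_carrier
  by metis

text \<open>
  The Frobenius rank inequality, in terms of kernels: by \<open>kernel_dim_mult\<close> it compares the intersections
  of the kernel of \<open>X\<close> with the images of \<open>Y * Z\<close> and of \<open>Y\<close>.
\<close>

lemma kernel_dim_Frobenius:
  fixes X Y Z :: "complex mat"
  assumes X: "X \<in> carrier_mat k l" and Y: "Y \<in> carrier_mat l m" and Z: "Z \<in> carrier_mat m n"
  shows "kernel_dim (X * Y * Z) + kernel_dim Y \<le> kernel_dim (X * Y) + kernel_dim (Y * Z)"
proof -
  have YZ: "Y * Z \<in> carrier_mat l n" using Y Z by simp
  have "kernel_dim (X * Y * Z) = kernel_dim (Y * Z) +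
      sdim l ((\<lambda>x. Y * Z *\<^sub>v x) ` carrier_vec n \<inter> mat_kernel X)"
    using kernel_dim_mult[OF X YZ] assoc_mult_mat[OF X Y Z] by simp
  moreover have "kernel_dim (X * Y) = kernel_dim Y +
      sdim l ((\<lambda>x. Y *\<^sub>v x) ` carrier_vec m \<inter> mat_kernel X)"
    by (rule kernel_dim_mult[OF X Y])
  moreover have "sdim l ((\<lambda>x. Y * Z *\<^sub>v x) ` carrier_vec n \<inter> mat_kernel X) \<le>
      sdim l ((\<lambda>x. Y *\<^sub>v x) ` carrier_vec m \<inter> mat_kernel X)"
  proof (rule sdim_mono)
    show "(\<lambda>x. Y * Z *\<^sub>v x) ` carrier_vec n \<inter> mat_kernel X \<subseteq>
      (\<lambda>x. Y *\<^sub>v x) ` carrier_vec m \<inter> mat_kernel X"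
    proof
      fix y assume "y \<in> (\<lambda>x. Y * Z *\<^sub>v x) ` carrier_vec n \<inter> mat_kernel X"
      then obtain x where x: "x \<in> carrier_vec n" "y = Y * Z *\<^sub>v x" "y \<in> mat_kernel X" by auto
      hence "y = Y *\<^sub>v (Z *\<^sub>v x)" using assoc_mult_mat_vec[OF Y Z] by auto
      moreover have "Z *\<^sub>v x \<in> carrier_vec m" using Z x by auto
      ultimately show "y \<in> (\<lambda>x. Y *\<^sub>v x) ` carrier_vec m \<inter> mat_kernel X" using x by blast
    qed
  qed (intro lin_subspace_Int lin_subspace_kernel[OF X]
      lin_subspace_image[OF YZ lin_subspace_carrier] lin_subspace_image[OF Y lin_subspace_carrier])+
  ultimately show ?thesis by simp
qed

lemma kernel_dim_transpose_le:
  fixes M :: "complex mat"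
  assumes M: "M \<in> carrier_mat n n" shows "kernel_dim M \<le> kernel_dim (M\<^sup>T)"
proof -
  interpret V: vec_space "TYPE(complex)" n .
  let ?W = "(\<lambda>x. M *\<^sub>v x) ` carrier_vec n"
  have W: "lin_subspace n ?W" by (rule lin_subspace_image[OF M lin_subspace_carrier])
  obtain b where b: "finite b" "b \<subseteq> ?W" "V.span b = ?W" "card b = sdim n ?W"
    by (rule lin_subspace_eq_span[OF W])
  obtain bs where bs: "set bs = b" "length bs = card b" "distinct bs"
    using b(1) finite_distinct_list[of b] distinct_card by metis
  have bc: "b \<subseteq> carrier_vec n" using b(2) M by auto
  \<comment> \<open>The rows of \<open>R\<close> span the column space of \<open>M\<close>, so the kernel of \<open>R\<close> is annihilated by \<open>M\<^sup>T\<close>.\<close>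
  define R where "R = mat_of_rows n bs"
  have R: "R \<in> carrier_mat (card b) n" unfolding R_def using bs by auto
  have MT: "M\<^sup>T \<in> carrier_mat n n" using M by simp
  have dW: "sdim n ?W + kernel_dim M = n"
    using sdim_rank_nullity[OF lin_subspace_carrier M] mat_kernel_carrier[OF M]
    by (simp add: Int_absorb1 sdim_carrier kernel_dim_sdim[OF M])
  have "sdim (card b) ((\<lambda>x. R *\<^sub>v x) ` carrier_vec n) \<le> card b"
  proof -
    have "(\<lambda>x. R *\<^sub>v x) ` carrier_vec n \<subseteq> carrier_vec (card b)" using R by auto
    from sdim_mono[OF lin_subspace_image[OF R lin_subspace_carrier] lin_subspace_carrier this]
    show ?thesis unfolding sdim_carrier .
  qed
  moreover have "sdim (card b) ((\<lambda>x. R *\<^sub>v x) ` carrier_vec n) + sdim n (mat_kernel R) = n"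
    using sdim_rank_nullity[OF lin_subspace_carrier R] mat_kernel_carrier[OF R]
    by (simp add: Int_absorb1 sdim_carrier)
  moreover have "sdim n (mat_kernel R) \<le> sdim n (mat_kernel M\<^sup>T)"
  proof (rule sdim_mono[OF lin_subspace_kernel[OF R] lin_subspace_kernel[OF MT]])
    show "mat_kernel R \<subseteq> mat_kernel M\<^sup>T"
    proof
      fix x assume "x \<in> mat_kernel R"
      hence x: "x \<in> carrier_vec n" "R *\<^sub>v x = 0\<^sub>v (card b)" unfolding mat_kernel[OF R] by auto
      let ?S = "{u \<in> carrier_vec n. u \<bullet> x = 0}"
      have S: "submodule class_ring ?S V.V" unfolding submodule_def
        using V.module_axioms x(1) by (auto simp: module_vec_simps add_scalar_prod_distrib[of _ n])
      have "b \<subseteq> ?S"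
      proof
        fix u assume u: "u \<in> b"
        then obtain i where i: "i < length bs" "bs ! i = u" using bs(1) by (metis in_set_conv_nth)
        have "(R *\<^sub>v x) $ i = u \<bullet> x" using i bs bc u unfolding R_def by auto
        thus "u \<in> ?S" using x(2) i bs bc u by auto
      qed
      from V.span_is_subset[OF this S] have WS: "?W \<subseteq> ?S" using b(3) by simp
      have "M\<^sup>T *\<^sub>v x = 0\<^sub>v n"
      proof (rule eq_vecI)
        fix j assume j: "j < dim_vec (0\<^sub>v n :: complex vec)"
        have "col M j = M *\<^sub>v unit_vec n j" using M j by (intro eq_vecI) auto
        hence "col M j \<in> ?W" by auto
        thus "(M\<^sup>T *\<^sub>v x) $ j = 0\<^sub>v n $ j" using WS M j by auto
      qed (use M in auto)
      thus "x \<in> mat_kernel M\<^sup>T" unfolding mat_kernel[OF MT] using x by auto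
    qed
  qed
  ultimately show ?thesis using b(4) dW kernel_dim_sdim[OF MT] by simp
qed

lemma kernel_dim_transpose:
  fixes M :: "complex mat"
  assumes M: "M \<in> carrier_mat n n" shows "kernel_dim (M\<^sup>T) = kernel_dim M"
  using kernel_dim_transpose_le[OF M] kernel_dim_transpose_le[of "M\<^sup>T" n] M by auto

section \<open>Kernels of powers\<close>

lemma pow_mat_Suc_left:
  assumes P: "P \<in> carrier_mat n n"
  shows "P ^\<^sub>m Suc i = P * P ^\<^sub>m i"
proof (induction i)
  case 0
  show ?case using P by simp
next
  case (Suc i)
  have "P ^\<^sub>m Suc (Suc i) = (P * P ^\<^sub>m i) * P" using Suc by simp
  also have "\<dots> = P * P ^\<^sub>m Suc i" using P by (simp add: assoc_mult_mat[of _ n n _ n _ n])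
  finally show ?case .
qed

lemma pow_mat_add_vec:
  assumes P: "P \<in> carrier_mat n n" and w: "w \<in> carrier_vec n"
  shows "P ^\<^sub>m (i + k) *\<^sub>v w = P ^\<^sub>m i *\<^sub>v (P ^\<^sub>m k *\<^sub>v w)"
proof (induction i)
  case 0
  show ?case using P w by (simp add: mult_mat_vec_carrier[of _ n n])
next
  case (Suc i)
  have Pk: "P ^\<^sub>m k *\<^sub>v w \<in> carrier_vec n" using P w by (simp add: mult_mat_vec_carrier[of _ n n])
  have "P ^\<^sub>m (Suc i + k) *\<^sub>v w = P *\<^sub>v (P ^\<^sub>m (i + k) *\<^sub>v w)"
    unfolding add_Suc pow_mat_Suc_left[OF P] using P w by (simp add: assoc_mult_mat_vec[of _ n n _ n])
  also have "\<dots> = P *\<^sub>v (P ^\<^sub>m i *\<^sub>v (P ^\<^sub>m k *\<^sub>v w))" using Suc by simp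
  also have "\<dots> = P ^\<^sub>m Suc i *\<^sub>v (P ^\<^sub>m k *\<^sub>v w)"
    unfolding pow_mat_Suc_left[OF P] using P Pk by (simp add: assoc_mult_mat_vec[of _ n n _ n])
  finally show ?case .
qed

lemma pow_mat_swap:
  assumes C: "C \<in> carrier_mat m n" and D: "D \<in> carrier_mat n m"
  shows "C * (D * C) ^\<^sub>m j = (C * D) ^\<^sub>m j * C"
proof (induction j)
  case 0
  thus ?case using C D by simp
next
  case (Suc j)
  have DC: "D * C \<in> carrier_mat n n" and CD: "C * D \<in> carrier_mat m m" using C D by auto
  have "C * (D * C) ^\<^sub>m Suc j = (C * (D * C) ^\<^sub>m j) * (D * C)"
    using assoc_mult_mat[OF C pow_carrier_mat[OF DC] DC, of j] by simp
  also have "\<dots> = (C * D) ^\<^sub>m j * C * (D * C)" using Suc by simp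
  also have "\<dots> = (C * D) ^\<^sub>m j * (C * D * C)"
    using assoc_mult_mat[OF pow_carrier_mat[OF CD] C DC, of j] assoc_mult_mat[OF C D C] by simp
  also have "\<dots> = (C * D) ^\<^sub>m Suc j * C"
    using assoc_mult_mat[OF pow_carrier_mat[OF CD] CD C, of j] by simp
  finally show ?case .
qed

lemma intertwine_pow:
  assumes M: "M \<in> carrier_mat m n" and P: "P \<in> carrier_mat n n" and Q: "Q \<in> carrier_mat m m"
    and e: "M * P = Q * M"
  shows "M * P ^\<^sub>m j = Q ^\<^sub>m j * M"
proof (induction j)
  case 0
  thus ?case using M P Q by simp
next
  case (Suc j)
  have "M * P ^\<^sub>m Suc j = (M * P ^\<^sub>m j) * P"
    using assoc_mult_mat[OF M pow_carrier_mat[OF P] P, of j] by simp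
  also have "\<dots> = Q ^\<^sub>m j * (M * P)" unfolding Suc by (rule assoc_mult_mat[OF pow_carrier_mat[OF Q] M P])
  also have "\<dots> = Q ^\<^sub>m Suc j * M" unfolding e using assoc_mult_mat[OF pow_carrier_mat[OF Q] Q M, of j] by simp
  finally show ?case .
qed

lemma transpose_pow:
  fixes X :: "complex mat"
  assumes X: "X \<in> carrier_mat n n" shows "(X\<^sup>T) ^\<^sub>m k = (X ^\<^sub>m k)\<^sup>T"
proof (induction k)
  case 0 thus ?case using X by simp
next
  case (Suc k)
  have "(X ^\<^sub>m Suc k)\<^sup>T = (X * X ^\<^sub>m k)\<^sup>T" unfolding pow_mat_Suc_left[OF X] ..
  also have "\<dots> = (X ^\<^sub>m k)\<^sup>T * X\<^sup>T" by (rule transpose_mult[OF X pow_carrier_mat[OF X]])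
  finally show ?case using Suc by simp
qed

text \<open>
  The number of Jordan blocks of \<open>P\<close> for the eigenvalue \<open>0\<close> that have size greater than \<open>j\<close>.
\<close>

definition jump :: "complex mat \<Rightarrow> nat \<Rightarrow> nat" where
  "jump P j = kernel_dim (P ^\<^sub>m Suc j) - kernel_dim (P ^\<^sub>m j)"

lemma kernel_dim_pow_Suc:
  fixes P :: "complex mat"
  assumes P: "P \<in> carrier_mat n n"
  shows "kernel_dim (P ^\<^sub>m Suc j) = kernel_dim (P ^\<^sub>m j) + jump P j"
    and "jump P j = sdim n ((\<lambda>x. P ^\<^sub>m j *\<^sub>v x) ` carrier_vec n \<inter> mat_kernel P)"
  using kernel_dim_mult[OF P pow_carrier_mat[OF P, of j]]
  unfolding jump_def pow_mat_Suc_left[OF P] by simp_all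

lemma jump_eq_image:
  assumes P: "P \<in> carrier_mat n n"
  shows "jump P j = sdim n ((\<lambda>x. P ^\<^sub>m j *\<^sub>v x) ` mat_kernel (P ^\<^sub>m Suc j))"
proof -
  have Pj: "P ^\<^sub>m j \<in> carrier_mat n n" "P * P ^\<^sub>m j \<in> carrier_mat n n" using P by auto
  have "(\<lambda>x. P ^\<^sub>m j *\<^sub>v x) ` mat_kernel (P ^\<^sub>m Suc j) = (\<lambda>x. P ^\<^sub>m j *\<^sub>v x) ` carrier_vec n \<inter> mat_kernel P"
    unfolding pow_mat_Suc_left[OF P] mat_kernel[OF Pj(2)] mat_kernel[OF P]
    using Pj P by (auto simp: assoc_mult_mat_vec[OF P Pj(1)] mult_mat_vec_carrier[OF Pj(1)])
  thus ?thesis using kernel_dim_pow_Suc(2)[OF P] by simp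
qed

lemma jump_le:
  assumes X: "X \<in> carrier_mat n n" shows "jump X j \<le> n"
  using kernel_dim_le[OF pow_carrier_mat[OF X, of "Suc j"]] unfolding jump_def by linarith

lemma sum_jump:
  assumes X: "X \<in> carrier_mat n n"
  shows "(\<Sum>j<J. jump X j) + kernel_dim (1\<^sub>m n :: complex mat) = kernel_dim (X ^\<^sub>m J)"
proof (induction J)
  case 0 thus ?case using X by simp
next
  case (Suc J) thus ?case using kernel_dim_pow_Suc(1)[OF X, of J] by simp
qed

lemma char_matrix_eq:
  "A \<in> carrier_mat n n \<Longrightarrow> char_matrix A e = A + (-e) \<cdot>\<^sub>m 1\<^sub>m n"
  unfolding char_matrix_def by auto

lemma char_matrix_intertwine:
  assumes M: "M \<in> carrier_mat m n" and P: "P \<in> carrier_mat n n" and Q: "Q \<in> carrier_mat m m"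
  shows "Q * M - M * P = char_matrix Q \<mu> * M - M * char_matrix P \<mu>"
proof -
  have 1: "char_matrix Q \<mu> * M = Q * M + (-\<mu>) \<cdot>\<^sub>m M"
    unfolding char_matrix_eq[OF Q] using M Q
    by (simp add: add_mult_distrib_mat[of _ m m] mult_smult_assoc_mat[of _ m m])
  have 2: "M * char_matrix P \<mu> = M * P + (-\<mu>) \<cdot>\<^sub>m M"
    unfolding char_matrix_eq[OF P] using M P
    using mult_smult_distrib[OF M one_carrier_mat, of "-\<mu>"]
    by (simp add: mult_add_distrib_mat[of _ m n])
  show ?thesis unfolding 1 2 using M P Q by (intro eq_matI) auto
qed

lemma minus_mat_eq_zeroD:
  fixes X Y :: "'a :: ab_group_add mat"
  assumes X: "X \<in> carrier_mat m n" and Y: "Y \<in> carrier_mat m n" and e: "X - Y = 0\<^sub>m m n"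
  shows "X = Y"
proof (rule eq_matI)
  fix i j assume ij: "i < dim_row Y" "j < dim_col Y"
  hence "(X - Y) $$ (i,j) = 0" unfolding e using Y by auto
  thus "X $$ (i,j) = Y $$ (i,j)" using ij Y by auto
qed (use X Y in auto)

lemma char_matrix_transpose:
  assumes X: "X \<in> carrier_mat n n" shows "char_matrix (X\<^sup>T) \<mu> = (char_matrix X \<mu>)\<^sup>T"
  using X unfolding char_matrix_def by (intro eq_matI) auto

lemma jump_transpose:
  assumes X: "X \<in> carrier_mat n n"
  shows "jump (char_matrix (X\<^sup>T) \<mu>) j = jump (char_matrix X \<mu>) j"
proof -
  have c: "char_matrix X \<mu> \<in> carrier_mat n n" using X by simp
  have "kernel_dim (char_matrix (X\<^sup>T) \<mu> ^\<^sub>m k) = kernel_dim (char_matrix X \<mu> ^\<^sub>m k)" for k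
    unfolding char_matrix_transpose[OF X] transpose_pow[OF c]
    by (rule kernel_dim_transpose[OF pow_carrier_mat[OF c]])
  thus ?thesis unfolding jump_def by (simp only:)
qed

section \<open>Jordan blocks across an arrow\<close>

lemma jump_arrow_zero:
  fixes C D :: "complex mat"
  assumes C: "C \<in> carrier_mat m n" and D: "D \<in> carrier_mat n m"
  shows "jump (C * D) (Suc j) \<le> jump (D * C) j"
proof -
  let ?P = "\<lambda>j. (D * C) ^\<^sub>m j" and ?R = "\<lambda>j. (C * D) ^\<^sub>m j"
  have DC: "D * C \<in> carrier_mat n n" and CD: "C * D \<in> carrier_mat m m" using C D by auto
  have P: "?P i \<in> carrier_mat n n" and R: "?R i \<in> carrier_mat m m" for i using DC CD by auto
  have CP: "C * ?P i = ?R i * C" "C * ?P i \<in> carrier_mat m n" for i using pow_mat_swap[OF C D] C P by auto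
  have DR: "?P i * D = D * ?R i" "?P i * D \<in> carrier_mat n m" for i using pow_mat_swap[OF D C] D P by auto
  have CPD: "C * ?P i * D = ?R (Suc i)" for i
    using assoc_mult_mat[OF R C D] CP by simp
  have DCP: "D * (C * ?P i) = ?P (Suc i)" for i
    using assoc_mult_mat[OF D C P] pow_mat_Suc_left[OF DC] by metis
  have PDC: "?P i * D * C = ?P (Suc i)" for i
    using assoc_mult_mat[OF P D C] by simp
  have CPDR: "C * (?P i * D) = ?R (Suc i)" for i
    using assoc_mult_mat[OF C P D] CPD by simp
  \<comment> \<open>Four Frobenius inequalities for alternating words in \<open>C\<close> and \<open>D\<close>; the words of odd length cancel
    in their sum.\<close>
  have F1: "kernel_dim (?R (Suc (Suc j))) + kernel_dim (?P (Suc j))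
      \<le> kernel_dim (C * ?P (Suc j)) + kernel_dim (?P (Suc j) * D)"
    using kernel_dim_Frobenius[OF C P[of "Suc j"] D] unfolding CPD .
  have F2: "kernel_dim (?P (Suc j) * D) + kernel_dim (C * ?P j) \<le> kernel_dim (?P (Suc j)) + kernel_dim (?R (Suc j))"
    using kernel_dim_Frobenius[OF D CP(2)[of j] D] unfolding DCP CPD .
  have F3: "kernel_dim (C * ?P (Suc j)) + kernel_dim (?P j * D) \<le> kernel_dim (?R (Suc j)) + kernel_dim (?P (Suc j))"
    using kernel_dim_Frobenius[OF C DR(2)[of j] C] unfolding CPDR PDC CP(1) .
  have F4: "kernel_dim (?R (Suc j)) + kernel_dim (?P j) \<le> kernel_dim (C * ?P j) + kernel_dim (?P j * D)"
    using kernel_dim_Frobenius[OF C P[of j] D] unfolding CPD .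
  from F1 F2 F3 F4 have "kernel_dim (?R (Suc (Suc j))) + kernel_dim (?P j) \<le> kernel_dim (?P (Suc j)) + kernel_dim (?R (Suc j))"
    by linarith
  thus ?thesis using kernel_dim_pow_Suc(1)[OF DC, of j] kernel_dim_pow_Suc(1)[OF CD, of "Suc j"]
    by linarith
qed

lemma char_matrix_swap:
  assumes C: "C \<in> carrier_mat m n" and D: "D \<in> carrier_mat n m"
  shows "D * char_matrix (C * D) \<mu> = char_matrix (D * C) \<mu> * D"
proof -
  have DC: "D * C \<in> carrier_mat n n" and CD: "C * D \<in> carrier_mat m m" using C D by auto
  have "D * C * D - D * (C * D) = 0\<^sub>m n m" using assoc_mult_mat[OF D C D] C D by auto
  hence "char_matrix (D * C) \<mu> * D - D * char_matrix (C * D) \<mu> = 0\<^sub>m n m"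
    using char_matrix_intertwine[OF D CD DC, of \<mu>] by simp
  from minus_mat_eq_zeroD[OF _ _ this] show ?thesis using C D DC CD
    by (metis char_matrix_closed mult_carrier_mat)
qed

text \<open>
  \<open>D\<close> maps the generalised eigenspaces of \<open>C * D\<close> into those of \<open>D * C\<close>. It is injective there, because
  \<open>C * D - \<mu>\<close> acts on the kernel of \<open>D\<close> as the invertible scalar \<open>- \<mu>\<close>.
\<close>

lemma kernel_dim_arrow_nonzero:
  fixes C D :: "complex mat"
  assumes C: "C \<in> carrier_mat m n" and D: "D \<in> carrier_mat n m" and \<mu>: "\<mu> \<noteq> 0"
  shows "kernel_dim (char_matrix (C * D) \<mu> ^\<^sub>m j) \<le> kernel_dim (char_matrix (D * C) \<mu> ^\<^sub>m j)"
proof -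
  define P where "P = char_matrix (C * D) \<mu>"
  define Q where "Q = char_matrix (D * C) \<mu>"
  have DC: "D * C \<in> carrier_mat n n" and CD: "C * D \<in> carrier_mat m m" using C D by auto
  have P: "P \<in> carrier_mat m m" and Q: "Q \<in> carrier_mat n n" unfolding P_def Q_def using CD DC by auto
  have Pj: "P ^\<^sub>m j \<in> carrier_mat m m" and Qj: "Q ^\<^sub>m j \<in> carrier_mat n n" using P Q by auto
  have e: "D * P ^\<^sub>m j = Q ^\<^sub>m j * D"
    by (rule intertwine_pow[OF D P Q]) (unfold P_def Q_def, rule char_matrix_swap[OF C D])
  have pow: "P ^\<^sub>m i *\<^sub>v w = (-\<mu>)^i \<cdot>\<^sub>v w" if w: "w \<in> carrier_vec m" "D *\<^sub>v w = 0\<^sub>v n" for i w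
  proof (induction i)
    case 0
    show ?case using P w by simp
  next
    case (Suc i)
    have "C * D *\<^sub>v w = 0\<^sub>v m" using assoc_mult_mat_vec[OF C D w(1)] mult_mat_zero_vec[OF C] w by simp
    moreover have "((-\<mu>) \<cdot>\<^sub>m 1\<^sub>m m) *\<^sub>v w = (-\<mu>) \<cdot>\<^sub>v w"
      using w(1) by (intro eq_vecI) auto
    ultimately have "P *\<^sub>v w = (-\<mu>) \<cdot>\<^sub>v w" unfolding P_def char_matrix_eq[OF CD]
      using w CD by (simp add: add_mult_distrib_mat_vec[of _ m m])
    moreover have "P ^\<^sub>m Suc i *\<^sub>v w = P *\<^sub>v (P ^\<^sub>m i *\<^sub>v w)"
      unfolding pow_mat_Suc_left[OF P] by (rule assoc_mult_mat_vec[OF P pow_carrier_mat[OF P] w(1)])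
    ultimately show ?case using Suc w P by (simp add: mult_mat_vec[OF P] smult_smult_assoc mult.commute)
  qed
  have inj: "mat_kernel (P ^\<^sub>m j) \<inter> mat_kernel D \<subseteq> {0\<^sub>v m}"
  proof
    fix w assume "w \<in> mat_kernel (P ^\<^sub>m j) \<inter> mat_kernel D"
    hence w: "w \<in> carrier_vec m" "P ^\<^sub>m j *\<^sub>v w = 0\<^sub>v m" "D *\<^sub>v w = 0\<^sub>v n"
      unfolding mat_kernel[OF Pj] mat_kernel[OF D] by auto
    have z: "(-\<mu>)^j \<cdot>\<^sub>v w = 0\<^sub>v m" using pow[OF w(1,3)] w(2) by simp
    have "w = 0\<^sub>v m"
    proof (rule eq_vecI)
      fix i assume i: "i < dim_vec (0\<^sub>v m :: complex vec)"
      have "((-\<mu>)^j \<cdot>\<^sub>v w) $ i = 0" unfolding z using i by simp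
      thus "w $ i = 0\<^sub>v m $ i" using \<mu> i w(1) by simp
    qed (use w in auto)
    thus "w \<in> {0\<^sub>v m}" by simp
  qed
  have "kernel_dim (P ^\<^sub>m j) = sdim n ((\<lambda>x. D *\<^sub>v x) ` mat_kernel (P ^\<^sub>m j))"
    unfolding kernel_dim_sdim[OF Pj] by (rule sdim_image_inj[OF lin_subspace_kernel[OF Pj] D inj, symmetric])
  also have "\<dots> \<le> sdim n (mat_kernel (Q ^\<^sub>m j))"
  proof (rule sdim_mono[OF lin_subspace_image[OF D lin_subspace_kernel[OF Pj]] lin_subspace_kernel[OF Qj]])
    show "(\<lambda>x. D *\<^sub>v x) ` mat_kernel (P ^\<^sub>m j) \<subseteq> mat_kernel (Q ^\<^sub>m j)"
    proof
      fix y assume "y \<in> (\<lambda>x. D *\<^sub>v x) ` mat_kernel (P ^\<^sub>m j)"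
      then obtain w where w: "w \<in> carrier_vec m" "P ^\<^sub>m j *\<^sub>v w = 0\<^sub>v m" "y = D *\<^sub>v w"
        unfolding mat_kernel[OF Pj] by auto
      have "Q ^\<^sub>m j *\<^sub>v y = D *\<^sub>v (P ^\<^sub>m j *\<^sub>v w)"
        unfolding w(3) using assoc_mult_mat_vec[OF Qj D w(1)] assoc_mult_mat_vec[OF D Pj w(1)] e by simp
      thus "y \<in> mat_kernel (Q ^\<^sub>m j)"
        unfolding mat_kernel[OF Qj] w(2) using w(1,3) D mult_mat_zero_vec[OF D] by auto
    qed
  qed
  finally show ?thesis unfolding P_def[symmetric] Q_def[symmetric] kernel_dim_sdim[OF Qj] .
qed

lemma jump_arrow_nonzero:
  fixes C D :: "complex mat"
  assumes C: "C \<in> carrier_mat m n" and D: "D \<in> carrier_mat n m" and \<mu>: "\<mu> \<noteq> 0"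
  shows "jump (char_matrix (C * D) \<mu>) j = jump (char_matrix (D * C) \<mu>) j"
proof -
  have "kernel_dim (char_matrix (C * D) \<mu> ^\<^sub>m k) = kernel_dim (char_matrix (D * C) \<mu> ^\<^sub>m k)" for k
    by (rule le_antisym[OF kernel_dim_arrow_nonzero[OF C D \<mu>] kernel_dim_arrow_nonzero[OF D C \<mu>]])
  thus ?thesis unfolding jump_def by (simp only:)
qed

section \<open>Jordan blocks across an x-point\<close>

lemma xpoint_space_iff:
  "XData A Bm Bp a b \<in> xpoint_space n m \<longleftrightarrow>
     A \<in> carrier_mat m n \<and> Bm \<in> carrier_mat n n \<and> Bp \<in> carrier_mat m m \<and>
     a \<in> carrier_mat m 1 \<and> b \<in> carrier_mat 1 n \<and>
     Bp * A - A * Bm + a * b = 0\<^sub>m m n \<and>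
     (\<forall>W. lin_subspace n W \<and> invariant_under Bm W \<and> W \<subseteq> mat_kernel A \<inter> mat_kernel b
        \<longrightarrow> W = {0\<^sub>v n}) \<and>
     (\<forall>W. lin_subspace m W \<and> invariant_under Bp W \<and>
        {A *\<^sub>v x + a *\<^sub>v y | x y. x \<in> carrier_vec n \<and> y \<in> carrier_vec 1} \<subseteq> W
        \<longrightarrow> W = carrier_vec m)"
  unfolding xpoint_space_def mem_Collect_eq
  apply (rule iffI)
  subgoal
    apply (elim exE)
    apply (erule conjE)
    apply (erule elem_data.inject(2)[THEN iffD1, elim_format])
    apply (elim conjE)
    apply hypsubst
    apply (intro conjI)
    apply assumption+
    done
  subgoal
    apply (intro exI)
    apply (erule conjI[OF refl])
    done
  done

lemma xpoint_spaceD: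
  assumes "XData A Bm Bp a b \<in> xpoint_space n m"
  shows "A \<in> carrier_mat m n" "Bm \<in> carrier_mat n n" "Bp \<in> carrier_mat m m"
    "a \<in> carrier_mat m 1" "b \<in> carrier_mat 1 n" "Bp * A - A * Bm + a * b = 0\<^sub>m m n"
    "\<And>W. lin_subspace n W \<Longrightarrow> invariant_under Bm W \<Longrightarrow> W \<subseteq> mat_kernel A \<inter> mat_kernel b
        \<Longrightarrow> W = {0\<^sub>v n}"
    "\<And>W. lin_subspace m W \<Longrightarrow> invariant_under Bp W \<Longrightarrow>
        {A *\<^sub>v x + a *\<^sub>v y | x y. x \<in> carrier_vec n \<and> y \<in> carrier_vec 1} \<subseteq> W \<Longrightarrow> W = carrier_vec m"
proof -
  note D = assms[unfolded xpoint_space_iff]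
  show "A \<in> carrier_mat m n" "Bm \<in> carrier_mat n n" "Bp \<in> carrier_mat m m"
    "a \<in> carrier_mat m 1" "b \<in> carrier_mat 1 n" "Bp * A - A * Bm + a * b = 0\<^sub>m m n"
    using D by - (elim conjE, assumption)+
  show "W = {0\<^sub>v n}" if "lin_subspace n W" "invariant_under Bm W" "W \<subseteq> mat_kernel A \<inter> mat_kernel b" for W
    using that by (intro D[THEN conjunct2, THEN conjunct2, THEN conjunct2, THEN conjunct2, THEN conjunct2,
      THEN conjunct2, THEN conjunct1, rule_format, of W] conjI)
  show "W = carrier_vec m" if "lin_subspace m W" "invariant_under Bp W"
    "{A *\<^sub>v x + a *\<^sub>v y | x y. x \<in> carrier_vec n \<and> y \<in> carrier_vec 1} \<subseteq> W" for W
    using that by (intro D[THEN conjunct2, THEN conjunct2, THEN conjunct2,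
      THEN conjunct2, THEN conjunct2, THEN conjunct2, THEN conjunct2, rule_format, of W] conjI)
qed

lemma xpoint_spaceE:
  assumes "d \<in> xpoint_space n m"
  obtains A Bm Bp a b where "d = XData A Bm Bp a b" "Bm \<in> carrier_mat n n" "Bp \<in> carrier_mat m m"
  using assms unfolding xpoint_space_def mem_Collect_eq by (elim exE conjE) (rule that)

text \<open>
  Condition (ii) of an x-point gives one half of the interlacing of Jordan types; the other half follows
  from (iii) by transposition.
\<close>

lemma jump_xpoint:
  assumes A: "A \<in> carrier_mat m n" and P: "P \<in> carrier_mat n n" and Q: "Q \<in> carrier_mat m m"
    and a: "a \<in> carrier_mat m 1" and b: "b \<in> carrier_mat 1 n"
    and eq: "Q * A - A * P + a * b = 0\<^sub>m m n"
    and obs: "\<And>W. lin_subspace n W \<Longrightarrow> invariant_under P W \<Longrightarrow> W \<subseteq> mat_kernel A \<inter> mat_kernel b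
        \<Longrightarrow> W = {0\<^sub>v n}"
  shows "jump P j \<le> jump Q j + 1"
proof -
  define \<beta> where "\<beta> i w = (b *\<^sub>v (P ^\<^sub>m i *\<^sub>v w)) $ 0" for i w
  have Pi: "P ^\<^sub>m i \<in> carrier_mat n n" for i using P by simp
  have Piw: "P ^\<^sub>m i *\<^sub>v w \<in> carrier_vec n" if "w \<in> carrier_vec n" for i w
    using mult_mat_vec_carrier[OF Pi that] .
  have \<beta>_add: "\<beta> i (u + w) = \<beta> i u + \<beta> i w" if "u \<in> carrier_vec n" "w \<in> carrier_vec n" for i u w
    unfolding \<beta>_def using that b
    by (simp add: mult_add_distrib_mat_vec[OF Pi] mult_add_distrib_mat_vec[OF b] Piw)
  have \<beta>_smult: "\<beta> i (c \<cdot>\<^sub>v w) = c * \<beta> i w" if "w \<in> carrier_vec n" for i c w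
    unfolding \<beta>_def using that b by (simp add: mult_mat_vec[OF Pi] mult_mat_vec[OF b] Piw)
  have \<beta>_minus: "\<beta> i (u - w) = \<beta> i u - \<beta> i w" if "u \<in> carrier_vec n" "w \<in> carrier_vec n" for i u w
  proof -
    have "u - w = u + (-1) \<cdot>\<^sub>v w" using that by (auto intro!: eq_vecI)
    thus ?thesis using \<beta>_add[of u "(-1) \<cdot>\<^sub>v w" i] \<beta>_smult[of w i "-1"] that by simp
  qed
  have \<beta>_pow: "\<beta> i (P ^\<^sub>m k *\<^sub>v w) = \<beta> (i + k) w" if "w \<in> carrier_vec n" for i k w
    unfolding \<beta>_def using pow_mat_add_vec[OF P that] by simp
  have \<beta>_zero: "b *\<^sub>v (P ^\<^sub>m i *\<^sub>v w) = 0\<^sub>v 1 \<longleftrightarrow> \<beta> i w = 0" if "w \<in> carrier_vec n" for i w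
  proof
    assume e: "b *\<^sub>v (P ^\<^sub>m i *\<^sub>v w) = 0\<^sub>v 1"
    show "\<beta> i w = 0" unfolding \<beta>_def e by simp
  next
    assume "\<beta> i w = 0"
    thus "b *\<^sub>v (P ^\<^sub>m i *\<^sub>v w) = 0\<^sub>v 1" unfolding \<beta>_def using b by (intro eq_vecI) auto
  qed
  have comm: "A *\<^sub>v (P *\<^sub>v u) = Q *\<^sub>v (A *\<^sub>v u)"
    if u: "u \<in> carrier_vec n" and bu: "b *\<^sub>v u = 0\<^sub>v 1" for u
  proof -
    have c: "Q *\<^sub>v (A *\<^sub>v u) \<in> carrier_vec m" "A *\<^sub>v (P *\<^sub>v u) \<in> carrier_vec m" using A P Q u by auto
    have QA: "Q * A \<in> carrier_mat m n" and AP: "A * P \<in> carrier_mat m n" and ab: "a * b \<in> carrier_mat m n"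
      using A P Q a b by auto
    have d: "Q * A - A * P \<in> carrier_mat m n" using AP by (rule minus_carrier_mat)
    have "(Q * A - A * P + a * b) *\<^sub>v u = (Q * A) *\<^sub>v u - (A * P) *\<^sub>v u + (a * b) *\<^sub>v u"
      unfolding add_mult_distrib_mat_vec[OF d ab u] minus_mult_distrib_mat_vec[OF QA AP u] ..
    also have "\<dots> = Q *\<^sub>v (A *\<^sub>v u) - A *\<^sub>v (P *\<^sub>v u) + a *\<^sub>v 0\<^sub>v 1"
      unfolding assoc_mult_mat_vec[OF Q A u] assoc_mult_mat_vec[OF A P u] assoc_mult_mat_vec[OF a b u] bu ..
    also have "a *\<^sub>v 0\<^sub>v 1 = 0\<^sub>v m" using a by (intro eq_vecI) auto
    also have "Q *\<^sub>v (A *\<^sub>v u) - A *\<^sub>v (P *\<^sub>v u) + 0\<^sub>v m = Q *\<^sub>v (A *\<^sub>v u) - A *\<^sub>v (P *\<^sub>v u)"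
      using c by (intro right_zero_vec minus_carrier_vec)
    also have "(Q * A - A * P + a * b) *\<^sub>v u = 0\<^sub>v m" unfolding eq using u by (intro eq_vecI) auto
    finally have z: "0\<^sub>v m = Q *\<^sub>v (A *\<^sub>v u) - A *\<^sub>v (P *\<^sub>v u)" .
    show ?thesis
    proof (rule eq_vecI)
      fix i assume i: "i < dim_vec (Q *\<^sub>v (A *\<^sub>v u))"
      hence im: "i < m" using Q by auto
      have "(0\<^sub>v m :: complex vec) $ i = (Q *\<^sub>v (A *\<^sub>v u) - A *\<^sub>v (P *\<^sub>v u)) $ i" using z by metis
      also have "\<dots> = (Q *\<^sub>v (A *\<^sub>v u)) $ i - (A *\<^sub>v (P *\<^sub>v u)) $ i"
        by (rule index_minus_vec(1)) (use A im in auto)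
      finally show "(A *\<^sub>v (P *\<^sub>v u)) $ i = (Q *\<^sub>v (A *\<^sub>v u)) $ i" using im by simp
    qed (use A Q in auto)
  qed
  \<comment> \<open>\<open>T\<close> is the largest \<open>P\<close>-invariant subspace on which \<open>b\<close> vanishes. There \<open>A\<close> intertwines \<open>P\<close>
    with \<open>Q\<close>, and it is injective by the observability assumption.\<close>
  define T where "T = {w \<in> carrier_vec n. \<forall>i. \<beta> i w = 0}"
  have \<beta>_0: "\<beta> i (0\<^sub>v n) = 0" for i using \<beta>_add[of "0\<^sub>v n" "0\<^sub>v n" i] by simp
  have T: "lin_subspace n T" unfolding lin_subspace_iff T_def
    by (auto simp: \<beta>_add \<beta>_smult \<beta>_0)
  have Tinv: "P ^\<^sub>m k *\<^sub>v w \<in> T" if "w \<in> T" for w k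
    using that unfolding T_def by (auto simp: \<beta>_pow Piw)
  have Tinj: "T \<inter> mat_kernel A \<subseteq> {0\<^sub>v n}"
  proof -
    have bT: "T \<subseteq> mat_kernel b"
    proof
      fix w assume "w \<in> T"
      hence w: "w \<in> carrier_vec n" "\<beta> 0 w = 0" unfolding T_def by auto
      thus "w \<in> mat_kernel b" using \<beta>_zero[of w 0] P unfolding mat_kernel[OF b] by simp
    qed
    have "invariant_under P (T \<inter> mat_kernel A)" unfolding invariant_under_def
    proof
      fix w assume w: "w \<in> T \<inter> mat_kernel A"
      hence wc: "w \<in> carrier_vec n" and Aw: "A *\<^sub>v w = 0\<^sub>v m" and bw: "b *\<^sub>v w = 0\<^sub>v 1"
        using bT unfolding T_def mat_kernel[OF A] mat_kernel[OF b] by auto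
      have PT: "P *\<^sub>v w \<in> T" using Tinv[of w 1] w P by simp
      have "A *\<^sub>v (P *\<^sub>v w) = Q *\<^sub>v 0\<^sub>v m" using comm[OF wc bw] Aw by simp
      hence "A *\<^sub>v (P *\<^sub>v w) = 0\<^sub>v m" unfolding mult_mat_zero_vec[OF Q] .
      thus "P *\<^sub>v w \<in> T \<inter> mat_kernel A" using PT unfolding T_def mat_kernel[OF A] by auto
    qed
    from obs[OF lin_subspace_Int[OF T lin_subspace_kernel[OF A]] this] bT show ?thesis by auto
  qed
  have AT: "A *\<^sub>v (P ^\<^sub>m k *\<^sub>v w) = Q ^\<^sub>m k *\<^sub>v (A *\<^sub>v w)" if w: "w \<in> T" for w k
  proof (induction k)
    case 0
    thus ?case using P Q A w unfolding T_def by (simp add: mult_mat_vec_carrier[of _ m n])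
  next
    case (Suc k)
    let ?u = "P ^\<^sub>m k *\<^sub>v w"
    have uT: "?u \<in> T" by (rule Tinv[OF w])
    hence u: "?u \<in> carrier_vec n" and bu: "b *\<^sub>v ?u = 0\<^sub>v 1" using \<beta>_zero[of ?u 0] P unfolding T_def by auto
    have wc: "w \<in> carrier_vec n" using w unfolding T_def by auto
    have "A *\<^sub>v (P *\<^sub>v ?u) = Q *\<^sub>v (A *\<^sub>v ?u)" by (rule comm[OF u bu])
    moreover have "P ^\<^sub>m Suc k *\<^sub>v w = P *\<^sub>v ?u"
      unfolding pow_mat_Suc_left[OF P] by (rule assoc_mult_mat_vec[OF P Pi wc])
    moreover have "Q ^\<^sub>m Suc k *\<^sub>v (A *\<^sub>v w) = Q *\<^sub>v (Q ^\<^sub>m k *\<^sub>v (A *\<^sub>v w))"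
      unfolding pow_mat_Suc_left[OF Q]
      by (rule assoc_mult_mat_vec[OF Q pow_carrier_mat[OF Q] mult_mat_vec_carrier[OF A wc]])
    ultimately show ?case using Suc by simp
  qed
  \<comment> \<open>The jump of \<open>P\<close> is the dimension of \<open>P ^ j W\<close>, and \<open>A\<close> embeds \<open>P ^ j (T \<inter> W)\<close> into the corresponding
    space of \<open>Q\<close>. It remains to see that the dimension drops by at most one from \<open>P ^ j W\<close> to \<open>P ^ j (T \<inter> W)\<close>.\<close>
  define W where "W = mat_kernel (P ^\<^sub>m Suc j)"
  have W: "lin_subspace n W" unfolding W_def by (rule lin_subspace_kernel[OF Pi])
  have Wc: "W \<subseteq> carrier_vec n" using W unfolding lin_subspace_iff by auto
  have Wz: "P ^\<^sub>m i *\<^sub>v w = 0\<^sub>v n" if "w \<in> W" "i > j" for i w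
  proof -
    have w: "w \<in> carrier_vec n" "P ^\<^sub>m Suc j *\<^sub>v w = 0\<^sub>v n" using that(1) unfolding W_def mat_kernel[OF Pi] by auto
    have "P ^\<^sub>m i *\<^sub>v w = P ^\<^sub>m (i - Suc j) *\<^sub>v (P ^\<^sub>m Suc j *\<^sub>v w)"
      using pow_mat_add_vec[OF P w(1), of "i - Suc j" "Suc j"] that(2) by simp
    also have "\<dots> = 0\<^sub>v n" unfolding w(2) by (rule mult_mat_zero_vec[OF Pi])
    finally show ?thesis .
  qed
  have Winv: "P ^\<^sub>m k *\<^sub>v w \<in> W" if "w \<in> W" for w k
  proof -
    have w: "w \<in> carrier_vec n" using that Wc by auto
    have "P ^\<^sub>m Suc j *\<^sub>v (P ^\<^sub>m k *\<^sub>v w) = P ^\<^sub>m (Suc j + k) *\<^sub>v w" by (rule pow_mat_add_vec[OF P w, symmetric])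
    also have "\<dots> = 0\<^sub>v n" by (rule Wz[OF that]) simp
    finally show ?thesis unfolding W_def mat_kernel[OF Pi] using Piw[OF w] by simp
  qed
  let ?K = "\<lambda>U. (\<lambda>x. P ^\<^sub>m j *\<^sub>v x) ` U"
  have TW: "lin_subspace n (T \<inter> W)" by (rule lin_subspace_Int[OF T W])
  have K': "lin_subspace n (?K (T \<inter> W))" by (rule lin_subspace_image[OF Pi TW])
  have "sdim n (?K (T \<inter> W)) = sdim m ((\<lambda>x. A *\<^sub>v x) ` ?K (T \<inter> W))"
  proof (rule sdim_image_inj[OF K' A, symmetric])
    show "?K (T \<inter> W) \<inter> mat_kernel A \<subseteq> {0\<^sub>v n}" using Tinj Tinv by blast
  qed
  also have "\<dots> \<le> sdim m ((\<lambda>x. Q ^\<^sub>m j *\<^sub>v x) ` mat_kernel (Q ^\<^sub>m Suc j))"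
  proof (rule sdim_mono[OF lin_subspace_image[OF A K']
      lin_subspace_image[OF pow_carrier_mat[OF Q] lin_subspace_kernel[OF pow_carrier_mat[OF Q]]]])
    show "(\<lambda>x. A *\<^sub>v x) ` ?K (T \<inter> W) \<subseteq> (\<lambda>x. Q ^\<^sub>m j *\<^sub>v x) ` mat_kernel (Q ^\<^sub>m Suc j)"
    proof
      fix y assume "y \<in> (\<lambda>x. A *\<^sub>v x) ` ?K (T \<inter> W)"
      then obtain w where w: "w \<in> T" "w \<in> W" "y = A *\<^sub>v (P ^\<^sub>m j *\<^sub>v w)" by auto
      have "Q ^\<^sub>m Suc j *\<^sub>v (A *\<^sub>v w) = 0\<^sub>v m"
        unfolding AT[OF w(1), symmetric] Wz[OF w(2) lessI] by (rule mult_mat_zero_vec[OF A])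
      hence "A *\<^sub>v w \<in> mat_kernel (Q ^\<^sub>m Suc j)"
        unfolding mat_kernel[OF pow_carrier_mat[OF Q]] using A w Wc by auto
      thus "y \<in> (\<lambda>x. Q ^\<^sub>m j *\<^sub>v x) ` mat_kernel (Q ^\<^sub>m Suc j)" using AT[OF w(1)] w(3) by auto
    qed
  qed
  also have "\<dots> = jump Q j" by (rule jump_eq_image[OF Q, symmetric])
  finally have le1: "sdim n (?K (T \<inter> W)) \<le> jump Q j" .
  have "sdim n (?K W) \<le> sdim n (?K (T \<inter> W)) + 1"
  proof (cases "W \<subseteq> T")
    case True
    hence "T \<inter> W = W" by auto
    thus ?thesis by simp
  next
    case False
    \<comment> \<open>The functionals \<open>\<beta> 0, \<dots>, \<beta> j\<close> identify \<open>W / (T \<inter> W)\<close> with a shift-stable subspace of a single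
      nilpotent Jordan block, hence with the sequences supported on the indices up to some \<open>h\<close>. If
      \<open>\<beta> h w = 0\<close>, then \<open>w\<close> agrees modulo \<open>T\<close> with an element of \<open>P W\<close>, which \<open>P ^ j\<close> kills.\<close>
    define H where "H = {i. \<exists>w\<in>W. \<beta> i w \<noteq> 0}"
    have Hb: "H \<subseteq> {..j}"
    proof
      fix i assume "i \<in> H"
      then obtain w where w: "w \<in> W" "\<beta> i w \<noteq> 0" unfolding H_def by auto
      have "\<not> i > j" using Wz[OF w(1)] w(2) mult_mat_zero_vec[OF b] unfolding \<beta>_def by auto
      thus "i \<in> {..j}" by auto
    qed
    have Hne: "H \<noteq> {}" using False Wc unfolding H_def T_def by auto
    have fH: "finite H" using Hb finite_subset by blast
    define h where "h = Max H"
    have "h \<in> H" unfolding h_def by (rule Max_in[OF fH Hne])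
    then obtain w0 where w0: "w0 \<in> W" "\<beta> h w0 \<noteq> 0" unfolding H_def by auto
    have above: "\<beta> i w = 0" if "w \<in> W" "i > h" for i w
      using that Max_ge[OF fH, of i] unfolding h_def H_def by force
    have w0c: "w0 \<in> carrier_vec n" using w0 Wc by auto
    have red: "\<exists>w'\<in>W. w - P *\<^sub>v w' \<in> T" if "m \<le> h" "w \<in> W" "\<And>i. i \<ge> m \<Longrightarrow> \<beta> i w = 0" for m w
      using that
    proof (induction m arbitrary: w)
      case 0
      hence w: "w \<in> carrier_vec n" using Wc by auto
      have "w - P *\<^sub>v 0\<^sub>v n = w" using w mult_mat_zero_vec[OF P] by auto
      hence "w - P *\<^sub>v 0\<^sub>v n \<in> T" using 0 w unfolding T_def by auto
      moreover have "0\<^sub>v n \<in> W" using W unfolding lin_subspace_iff by auto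
      ultimately show ?case by blast
    next
      case (Suc m)
      define c where "c = \<beta> m w / \<beta> h w0"
      define u where "u = c \<cdot>\<^sub>v (P ^\<^sub>m (h - m - 1) *\<^sub>v w0)"
      have uW: "u \<in> W" unfolding u_def using Winv[OF w0(1)] W unfolding lin_subspace_iff by auto
      have uc: "u \<in> carrier_vec n" using uW Wc by auto
      have wc: "w \<in> carrier_vec n" using Suc.prems Wc by auto
      have Pu: "\<beta> i (P *\<^sub>v u) = c * \<beta> (i + (h - m)) w0" for i
      proof -
        have "\<beta> i (P *\<^sub>v u) = \<beta> (i + 1) u" using \<beta>_pow[OF uc, of i 1] P by simp
        also have "\<dots> = c * \<beta> (i + 1 + (h - m - 1)) w0" unfolding u_def using \<beta>_smult \<beta>_pow[OF w0c] Piw[OF w0c] by simp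
        also have "i + 1 + (h - m - 1) = i + (h - m)" using Suc.prems(1) by simp
        finally show ?thesis .
      qed
      have PuW: "P *\<^sub>v u \<in> W" using Winv[OF uW, of 1] P by simp
      have Puc: "P *\<^sub>v u \<in> carrier_vec n" using PuW Wc by auto
      define w1 where "w1 = w - P *\<^sub>v u"
      have w1W: "w1 \<in> W"
      proof -
        have "w1 = w + (-1) \<cdot>\<^sub>v (P *\<^sub>v u)" unfolding w1_def using wc Puc by (auto intro!: eq_vecI)
        thus ?thesis using W Suc.prems(2) PuW unfolding lin_subspace_iff by auto
      qed
      have "\<beta> i w1 = 0" if i: "i \<ge> m" for i
      proof (cases "i = m")
        case True
        have "\<beta> m w1 = \<beta> m w - c * \<beta> h w0" unfolding w1_def \<beta>_minus[OF wc Puc] Pu using Suc.prems(1) by simp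
        thus ?thesis using True w0(2) unfolding c_def by simp
      next
        case False
        hence "\<beta> i w = 0" "\<beta> (i + (h - m)) w0 = 0" using i Suc.prems above[OF w0(1)] by auto
        thus ?thesis unfolding w1_def \<beta>_minus[OF wc Puc] Pu by simp
      qed
      with Suc.IH[of w1] Suc.prems(1) w1W obtain w' where w': "w' \<in> W" "w1 - P *\<^sub>v w' \<in> T" by auto
      have w'c: "w' \<in> carrier_vec n" using w' Wc by auto
      have "w - P *\<^sub>v (u + w') = w1 - P *\<^sub>v w'" unfolding w1_def mult_add_distrib_mat_vec[OF P uc w'c]
        using wc Puc P w'c by (auto intro!: eq_vecI)
      moreover have "u + w' \<in> W" using uW w'(1) W unfolding lin_subspace_iff by auto
      ultimately show ?case using w'(2) by metis
    qed
    define f where "f = b * P ^\<^sub>m h"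
    have f: "f \<in> carrier_mat 1 n" unfolding f_def using b Pi by auto
    have "?K (W \<inter> mat_kernel f) \<subseteq> ?K (T \<inter> W)"
    proof
      fix y assume "y \<in> ?K (W \<inter> mat_kernel f)"
      then obtain w where w: "w \<in> W" "w \<in> mat_kernel f" "y = P ^\<^sub>m j *\<^sub>v w" by auto
      have wc: "w \<in> carrier_vec n" using w Wc by auto
      have "f *\<^sub>v w = 0\<^sub>v 1" using w(2) unfolding mat_kernel[OF f] by auto
      hence "\<beta> h w = 0" unfolding f_def using \<beta>_zero[OF wc] assoc_mult_mat_vec[OF b Pi wc] by simp
      hence "\<And>i. i \<ge> h \<Longrightarrow> \<beta> i w = 0" using above[OF w(1)] by (metis le_neq_implies_less)
      from red[OF le_refl w(1) this] obtain w' where w': "w' \<in> W" "w - P *\<^sub>v w' \<in> T" by auto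
      have w'c: "w' \<in> carrier_vec n" using w' Wc by auto
      have Pw': "P *\<^sub>v w' \<in> W" using Winv[OF w'(1), of 1] P by simp
      have Pw'c: "P *\<^sub>v w' \<in> carrier_vec n" using Pw' Wc by auto
      have "w - P *\<^sub>v w' = w + (-1) \<cdot>\<^sub>v (P *\<^sub>v w')" using wc Pw'c by (auto intro!: eq_vecI)
      hence "w - P *\<^sub>v w' \<in> W" using W w(1) Pw' unfolding lin_subspace_iff by auto
      moreover have "P ^\<^sub>m j *\<^sub>v (w - P *\<^sub>v w') = y"
      proof -
        have "P ^\<^sub>m j *\<^sub>v (P *\<^sub>v w') = P ^\<^sub>m (j + 1) *\<^sub>v w'" using pow_mat_add_vec[OF P w'c, of j 1] P by simp
        also have "\<dots> = 0\<^sub>v n" by (rule Wz[OF w'(1)]) simp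
        finally show ?thesis unfolding w(3) using mult_minus_distrib_mat_vec[OF Pi wc Pw'c]
          Piw[OF wc] by simp
      qed
      ultimately show "y \<in> ?K (T \<inter> W)" using w'(2) by blast
    qed
    from sdim_mono[OF lin_subspace_image[OF Pi lin_subspace_Int[OF W lin_subspace_kernel[OF f]]] K' this]
    show ?thesis using sdim_image_hyperplane[OF W Pi f, of j] by simp
  qed
  thus ?thesis using le1 jump_eq_image[OF P] unfolding W_def by simp
qed

lemma invariant_under_char_matrix:
  assumes X: "X \<in> carrier_mat n n" and W: "lin_subspace n W" and i: "invariant_under (char_matrix X \<mu>) W"
  shows "invariant_under X W"
  unfolding invariant_under_def
proof
  fix x assume x: "x \<in> W"
  hence xc: "x \<in> carrier_vec n" using W unfolding lin_subspace_iff by auto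
  have "char_matrix X \<mu> *\<^sub>v x = X *\<^sub>v x + ((-\<mu>) \<cdot>\<^sub>m 1\<^sub>m n) *\<^sub>v x"
    unfolding char_matrix_eq[OF X] by (rule add_mult_distrib_mat_vec[OF X _ xc]) simp
  also have "((-\<mu>) \<cdot>\<^sub>m 1\<^sub>m n) *\<^sub>v x = (-\<mu>) \<cdot>\<^sub>v x" using xc by (intro eq_vecI) auto
  finally have "char_matrix X \<mu> *\<^sub>v x + \<mu> \<cdot>\<^sub>v x = X *\<^sub>v x" using X xc by (intro eq_vecI) auto
  moreover have "char_matrix X \<mu> *\<^sub>v x + \<mu> \<cdot>\<^sub>v x \<in> W"
    using i x W unfolding invariant_under_def lin_subspace_iff by auto
  ultimately show "X *\<^sub>v x \<in> W" by simp
qed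

lemma jump_xpoint_shifted:
  assumes A: "A \<in> carrier_mat m n" and P: "P \<in> carrier_mat n n" and Q: "Q \<in> carrier_mat m m"
    and a: "a \<in> carrier_mat m 1" and b: "b \<in> carrier_mat 1 n"
    and eq: "Q * A - A * P + a * b = 0\<^sub>m m n"
    and obs: "\<And>W. lin_subspace n W \<Longrightarrow> invariant_under P W \<Longrightarrow> W \<subseteq> mat_kernel A \<inter> mat_kernel b
        \<Longrightarrow> W = {0\<^sub>v n}"
  shows "jump (char_matrix P \<mu>) j \<le> jump (char_matrix Q \<mu>) j + 1"
proof (rule jump_xpoint[OF A _ _ a b])
  show "char_matrix Q \<mu> * A - A * char_matrix P \<mu> + a * b = 0\<^sub>m m n"
    unfolding char_matrix_intertwine[OF A P Q, symmetric] by (rule eq)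
  show "W = {0\<^sub>v n}" if "lin_subspace n W" "invariant_under (char_matrix P \<mu>) W"
    "W \<subseteq> mat_kernel A \<inter> mat_kernel b" for W
    using obs[OF that(1) invariant_under_char_matrix[OF P that(1,2)] that(3)] .
qed (use P Q in auto)

text \<open>
  Transposition turns condition (iii) into condition (ii): the annihilator of an unobservable subspace
  of the dual is an invariant subspace containing the images of \<open>A\<close> and \<open>a\<close>.
\<close>

lemma observable_transpose:
  assumes A: "A \<in> carrier_mat m n" and Q: "Q \<in> carrier_mat m m" and a: "a \<in> carrier_mat m 1"
    and gen: "\<And>W. lin_subspace m W \<Longrightarrow> invariant_under Q W \<Longrightarrow>
        {A *\<^sub>v x + a *\<^sub>v y | x y. x \<in> carrier_vec n \<and> y \<in> carrier_vec 1} \<subseteq> W \<Longrightarrow> W = carrier_vec m"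
    and U: "lin_subspace m U" "invariant_under (Q\<^sup>T) U" "U \<subseteq> mat_kernel (A\<^sup>T) \<inter> mat_kernel (a\<^sup>T)"
  shows "U = {0\<^sub>v m}"
proof -
  define W where "W = {x \<in> carrier_vec m. \<forall>u\<in>U. u \<bullet> x = 0}"
  have Uc: "U \<subseteq> carrier_vec m" and U0: "0\<^sub>v m \<in> U" using U(1) unfolding lin_subspace_iff by auto
  have AT: "A\<^sup>T \<in> carrier_mat n m" and aT: "a\<^sup>T \<in> carrier_mat 1 m" using A a by auto
  have adj: "u \<bullet> (M *\<^sub>v x) = (M\<^sup>T *\<^sub>v u) \<bullet> x"
    if "M \<in> carrier_mat m k" "u \<in> carrier_vec m" "x \<in> carrier_vec k" for M u k and x :: "complex vec"
    using transpose_vec_mult_scalar[OF that(1,3,2)] by simp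
  have W: "lin_subspace m W"
    unfolding lin_subspace_iff W_def using Uc
    by (auto simp: scalar_prod_add_distrib[of _ m] subset_iff)
  have "invariant_under Q W" unfolding invariant_under_def
  proof
    fix x assume x: "x \<in> W"
    hence xc: "x \<in> carrier_vec m" unfolding W_def by auto
    have "u \<bullet> (Q *\<^sub>v x) = 0" if u: "u \<in> U" for u
    proof -
      have "Q\<^sup>T *\<^sub>v u \<in> U" using U(2) u unfolding invariant_under_def by auto
      thus ?thesis using adj[OF Q _ xc, of u] u Uc x unfolding W_def by auto
    qed
    thus "Q *\<^sub>v x \<in> W" unfolding W_def using Q xc by auto
  qed
  moreover have "{A *\<^sub>v x + a *\<^sub>v y | x y. x \<in> carrier_vec n \<and> y \<in> carrier_vec 1} \<subseteq> W"
  proof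
    fix z assume "z \<in> {A *\<^sub>v x + a *\<^sub>v y | x y. x \<in> carrier_vec n \<and> y \<in> carrier_vec 1}"
    then obtain x y where z: "z = A *\<^sub>v x + a *\<^sub>v y" "x \<in> carrier_vec n" "y \<in> carrier_vec 1" by auto
    have Ax: "A *\<^sub>v x \<in> carrier_vec m" and ay: "a *\<^sub>v y \<in> carrier_vec m" using A a z by auto
    have "u \<bullet> z = 0" if u: "u \<in> U" for u
    proof -
      have uc: "u \<in> carrier_vec m" using u Uc by auto
      have k: "A\<^sup>T *\<^sub>v u = 0\<^sub>v n" "a\<^sup>T *\<^sub>v u = 0\<^sub>v 1" using U(3) u mat_kernelD(2)[OF AT] mat_kernelD(2)[OF aT] by auto
      have "u \<bullet> z = u \<bullet> (A *\<^sub>v x) + u \<bullet> (a *\<^sub>v y)"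
        unfolding z(1) by (rule scalar_prod_add_distrib[OF uc Ax ay])
      also have "\<dots> = 0" unfolding adj[OF A uc z(2)] adj[OF a uc z(3)] k using z by simp
      finally show ?thesis .
    qed
    thus "z \<in> W" unfolding W_def using z(1) Ax ay by auto
  qed
  ultimately have full: "W = carrier_vec m" by (rule gen[OF W])
  have "u = 0\<^sub>v m" if u: "u \<in> U" for u
  proof (rule eq_vecI)
    fix i assume i: "i < dim_vec (0\<^sub>v m :: complex vec)"
    have "unit_vec m i \<in> W" unfolding full by simp
    hence "u \<bullet> unit_vec m i = 0" using u unfolding W_def by auto
    thus "u $ i = 0\<^sub>v m $ i" using i u Uc by auto
  qed (use u Uc in auto)
  thus ?thesis using U0 by blast
qed

section \<open>Profiles of matrices\<close>

text \<open>
  The size of the \<open>i\<close>-th largest Jordan block of \<open>X\<close> for the eigenvalue \<open>\<mu>\<close>, where \<open>i\<close> counts from \<open>0\<close>.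
\<close>

definition block_size :: "complex mat \<Rightarrow> complex \<Rightarrow> nat \<Rightarrow> nat" where
  "block_size X \<mu> i = card {j. i < jump (char_matrix X \<mu>) j}"

text \<open>
  The degree of the \<open>i\<close>-th invariant factor of \<open>X\<close>, where \<open>i = 0\<close> is the minimal polynomial. The sum
  ranges over the eigenvalues.
\<close>

definition profile :: "complex mat \<Rightarrow> nat \<Rightarrow> nat" where
  "profile X i = (\<Sum>\<mu> | \<exists>j. jump (char_matrix X \<mu>) j \<noteq> 0. block_size X \<mu> i)"

lemma jordan_data:
  fixes X :: "complex mat"
  assumes X: "X \<in> carrier_mat n n"
  obtains n_as where "sum_list (map fst n_as) = n"
    "\<And>\<mu> k. kernel_dim (char_matrix X \<mu> ^\<^sub>m k) = (\<Sum>(m,e)\<leftarrow>n_as. if e = \<mu> then min k m else 0)"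
proof -
  obtain n_as where jnf: "jordan_nf X n_as"
    using char_poly_factorized[OF X] jordan_nf_exists[OF X] by blast
  hence "similar_mat X (jordan_matrix n_as)" unfolding jordan_nf_def by auto
  then obtain k where "{X, jordan_matrix n_as} \<subseteq> carrier_mat k k"
    using similar_matD by blast
  hence k: "dim_row X = k" "dim_row (jordan_matrix n_as) = k" by (auto dest: carrier_matD(1))
  have "sum_list (map fst n_as) = n" using k carrier_matD(1)[OF X] unfolding jordan_matrix_dim by (simp only:)
  moreover have "(\<Sum>m \<leftarrow> map fst [(m, e)\<leftarrow>n_as . e = \<mu>]. min k m) = (\<Sum>(m,e)\<leftarrow>n_as. if e = \<mu> then min k m else 0)" for \<mu> k
    by (induction n_as) auto
  ultimately show ?thesis using that dim_gen_eigenspace[OF jnf] unfolding dim_gen_eigenspace_def by metis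
qed

lemma jump_zero_beyond:
  assumes X: "X \<in> carrier_mat n n" and j: "n \<le> j"
  shows "jump (char_matrix X \<mu>) j = 0"
proof -
  obtain n_as where s: "sum_list (map fst n_as) = n" and
    k: "\<And>\<mu> k. kernel_dim (char_matrix X \<mu> ^\<^sub>m k) = (\<Sum>(m,e)\<leftarrow>n_as. if e = \<mu> then min k m else 0)"
    using jordan_data[OF X] by blast
  have "m \<le> n" if "(m, e) \<in> set n_as" for m e
    using member_le_sum_list[of m "map fst n_as"] that s by force
  hence "(\<Sum>(m,e)\<leftarrow>n_as. if e = \<mu> then min (Suc j) m else 0) = (\<Sum>(m,e)\<leftarrow>n_as. if e = \<mu> then min j m else 0)"
    using j by (intro arg_cong[where f = sum_list] map_cong) force+
  thus ?thesis unfolding jump_def k by simp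
qed

lemma finite_spec:
  assumes X: "X \<in> carrier_mat n n"
  shows "finite {\<mu>. \<exists>j. jump (char_matrix X \<mu>) j \<noteq> 0}"
proof -
  obtain n_as where
    k: "\<And>\<mu> k. kernel_dim (char_matrix X \<mu> ^\<^sub>m k) = (\<Sum>(m,e)\<leftarrow>n_as. if e = \<mu> then min k m else 0)"
    using jordan_data[OF X] by blast
  have j0: "jump (char_matrix X \<mu>) j = 0" if "\<mu> \<notin> snd ` set n_as" for \<mu> j
  proof -
    have s: "(\<Sum>(m,e)\<leftarrow>n_as. if e = \<mu> then min i m else 0) = 0" for i
      using that by (induction n_as) auto
    have z: "kernel_dim (char_matrix X \<mu> ^\<^sub>m i) = 0" for i unfolding k by (rule s)
    show ?thesis unfolding jump_def z by simp
  qed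
  have "{\<mu>. \<exists>j. jump (char_matrix X \<mu>) j \<noteq> 0} \<subseteq> snd ` set n_as"
  proof (rule subsetI, rule ccontr)
    fix \<mu> assume "\<mu> \<in> {\<mu>. \<exists>j. jump (char_matrix X \<mu>) j \<noteq> 0}" and n: "\<mu> \<notin> snd ` set n_as"
    then obtain j where "jump (char_matrix X \<mu>) j \<noteq> 0" by auto
    thus False unfolding j0[OF n] by simp
  qed
  thus ?thesis by (rule finite_subset) simp
qed

lemma block_size_zero: "\<not> (\<exists>j. jump (char_matrix X \<mu>) j \<noteq> 0) \<Longrightarrow> block_size X \<mu> i = 0"
  unfolding block_size_def by simp

lemma profile_eq_sum:
  assumes "finite S" "{\<mu>. \<exists>j. jump (char_matrix X \<mu>) j \<noteq> 0} \<subseteq> S"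
  shows "profile X i = (\<Sum>\<mu>\<in>S. block_size X \<mu> i)"
  unfolding profile_def by (rule sum.mono_neutral_left[OF assms]) (use block_size_zero in blast)

lemma finite_block_size_set:
  assumes X: "X \<in> carrier_mat n n"
  shows "finite {j. i < jump (char_matrix X \<mu>) j}"
proof (rule finite_subset)
  show "{j. i < jump (char_matrix X \<mu>) j} \<subseteq> {..<n}"
    using jump_zero_beyond[OF X, of _ \<mu>] by (auto simp: not_le[symmetric])
qed simp

lemma profile_antimono:
  assumes X: "X \<in> carrier_mat n n" shows "profile X (Suc i) \<le> profile X i"
  unfolding profile_def block_size_def
  by (intro sum_mono card_mono finite_block_size_set[OF X]) auto

lemma profile_zero:
  assumes X: "X \<in> carrier_mat n n" and i: "n \<le> i" shows "profile X i = 0"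
proof -
  have "\<not> i < jump (char_matrix X \<mu>) j" for \<mu> j
    using jump_le[OF char_matrix_closed[OF X], of \<mu> j] i by simp
  thus ?thesis unfolding profile_def block_size_def by simp
qed

text \<open>
  The parts of the conjugate partition have the same sum.
\<close>

lemma sum_card_levels:
  fixes c :: "nat \<Rightarrow> nat"
  assumes "\<And>j. c j \<le> n" "\<And>j. j \<ge> n \<Longrightarrow> c j = 0"
  shows "(\<Sum>i<n. card {j. i < c j}) = (\<Sum>j<n. c j)"
proof -
  have "(\<Sum>i<n. card {j. i < c j}) = (\<Sum>i<n. \<Sum>j<n. if i < c j then 1 else 0)"
  proof (rule sum.cong[OF refl])
    fix i
    have "{j. i < c j} = {j\<in>{..<n}. i < c j}" using assms(2) by (auto simp: not_le[symmetric])
    thus "card {j. i < c j} = (\<Sum>j<n. if i < c j then 1 else 0)" by (simp add: sum.If_cases Int_def)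
  qed
  also have "\<dots> = (\<Sum>j<n. \<Sum>i<n. if i < c j then 1 else 0)" by (rule sum.swap)
  also have "\<dots> = (\<Sum>j<n. c j)"
  proof (rule sum.cong[OF refl])
    fix j
    have "{..<n} \<inter> {i. i < c j} = {..<c j}" using assms(1)[of j] by auto
    thus "(\<Sum>i<n. if i < c j then 1 else 0) = c j" by (simp add: sum.If_cases)
  qed
  finally show ?thesis .
qed

lemma sum_profile:
  assumes X: "X \<in> carrier_mat n n"
  shows "(\<Sum>i<n. profile X i) = n"
proof -
  obtain n_as where s: "sum_list (map fst n_as) = n" and
    k: "\<And>\<mu> k. kernel_dim (char_matrix X \<mu> ^\<^sub>m k) = (\<Sum>(m,e)\<leftarrow>n_as. if e = \<mu> then min k m else 0)"
    using jordan_data[OF X] by blast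
  define S where "S = {\<mu>. \<exists>j. jump (char_matrix X \<mu>) j \<noteq> 0} \<union> snd ` set n_as"
  have fS: "finite S" unfolding S_def using finite_spec[OF X] by simp
  have m: "m \<le> n" if "(m, e) \<in> set n_as" for m e
    using member_le_sum_list[of m "map fst n_as"] that s by force
  have "(\<Sum>i<n. block_size X \<mu> i) = (\<Sum>(m,e)\<leftarrow>n_as. if e = \<mu> then m else 0)" for \<mu>
  proof -
    have c: "char_matrix X \<mu> \<in> carrier_mat n n" using X by simp
    have "(\<Sum>i<n. block_size X \<mu> i) = (\<Sum>j<n. jump (char_matrix X \<mu>) j)"
      unfolding block_size_def by (rule sum_card_levels) (use jump_le[OF c] jump_zero_beyond[OF X] in auto)
    also have "\<dots> = kernel_dim (char_matrix X \<mu> ^\<^sub>m n)"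
    proof -
      have "kernel_dim (char_matrix X \<mu> ^\<^sub>m 0) = 0" unfolding k by (induction n_as) auto
      thus ?thesis using sum_jump[OF c, of n] c X by simp
    qed
    also have "\<dots> = (\<Sum>(m,e)\<leftarrow>n_as. if e = \<mu> then m else 0)" unfolding k
      using m by (intro arg_cong[where f = sum_list] map_cong) force+
    finally show ?thesis .
  qed
  hence "(\<Sum>\<mu>\<in>S. \<Sum>i<n. block_size X \<mu> i) = (\<Sum>\<mu>\<in>S. \<Sum>(m,e)\<leftarrow>n_as. if e = \<mu> then m else 0)" by simp
  also have "\<dots> = sum_list (map fst n_as)"
  proof -
    have "snd ` set n_as \<subseteq> S" unfolding S_def by auto
    thus ?thesis using fS
      by (induction n_as) (auto simp: sum.distrib)
  qed
  finally have "(\<Sum>\<mu>\<in>S. \<Sum>i<n. block_size X \<mu> i) = n" using s by simp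
  moreover have "(\<Sum>i<n. profile X i) = (\<Sum>i<n. \<Sum>\<mu>\<in>S. block_size X \<mu> i)"
    by (intro sum.cong refl profile_eq_sum[OF fS]) (auto simp: S_def)
  ultimately show ?thesis using sum.swap[of "\<lambda>i \<mu>. block_size X \<mu> i" S "{..<n}"] by simp
qed

lemma profile_shift:
  assumes X: "X \<in> carrier_mat n n"
  shows "profile (X + c \<cdot>\<^sub>m 1\<^sub>m n) = profile X"
proof
  fix i
  let ?Y = "X + c \<cdot>\<^sub>m 1\<^sub>m n"
  have Y: "?Y \<in> carrier_mat n n" using X by simp
  have e: "char_matrix ?Y (\<mu> + c) = char_matrix X \<mu>" for \<mu>
    unfolding char_matrix_eq[OF X] char_matrix_eq[OF Y] using X by (intro eq_matI) (auto simp: algebra_simps)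
  have l: "block_size ?Y (\<mu> + c) i = block_size X \<mu> i" for \<mu> unfolding block_size_def e ..
  have s: "{\<mu>. \<exists>j. jump (char_matrix ?Y \<mu>) j \<noteq> 0} = (\<lambda>\<mu>. \<mu> + c) ` {\<mu>. \<exists>j. jump (char_matrix X \<mu>) j \<noteq> 0}"
  proof (intro Set.set_eqI iffI)
    fix \<mu> assume "\<mu> \<in> {\<mu>. \<exists>j. jump (char_matrix ?Y \<mu>) j \<noteq> 0}"
    hence "\<mu> - c \<in> {\<mu>. \<exists>j. jump (char_matrix X \<mu>) j \<noteq> 0}" using e[of "\<mu> - c"] by simp
    thus "\<mu> \<in> (\<lambda>\<mu>. \<mu> + c) ` {\<mu>. \<exists>j. jump (char_matrix X \<mu>) j \<noteq> 0}" by (intro image_eqI[of _ _ "\<mu> - c"]) auto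
  qed (auto simp: e)
  show "profile ?Y i = profile X i"
    unfolding profile_def s by (subst sum.reindex) (auto simp: l)
qed

lemma profile_arrow:
  fixes C D :: "complex mat"
  assumes C: "C \<in> carrier_mat m n" and D: "D \<in> carrier_mat n m"
  shows "profile (C * D) i \<le> profile (D * C) i + 1"
proof -
  have DC: "D * C \<in> carrier_mat n n" and CD: "C * D \<in> carrier_mat m m" using C D by auto
  define S where "S = {\<mu>. \<exists>j. jump (char_matrix (C * D) \<mu>) j \<noteq> 0} \<union> {\<mu>. \<exists>j. jump (char_matrix (D * C) \<mu>) j \<noteq> 0} \<union> {0}"
  have fS: "finite S" unfolding S_def using finite_spec[OF CD] finite_spec[OF DC] by simp
  have z: "char_matrix (C * D) 0 = C * D" "char_matrix (D * C) 0 = D * C"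
    unfolding char_matrix_eq[OF CD] char_matrix_eq[OF DC] using C D by auto
  have f0: "finite {j. i < jump (D * C) j}" using finite_block_size_set[OF DC, of i 0] z by simp
  have "{j. i < jump (C * D) j} \<subseteq> insert 0 (Suc ` {j. i < jump (D * C) j})"
  proof
    fix j assume j: "j \<in> {j. i < jump (C * D) j}"
    show "j \<in> insert 0 (Suc ` {j. i < jump (D * C) j})"
    proof (cases j)
      case (Suc k)
      with j jump_arrow_zero[OF C D, of k] show ?thesis by auto
    qed simp
  qed
  hence "card {j. i < jump (C * D) j} \<le> card (insert 0 (Suc ` {j. i < jump (D * C) j}))"
    by (rule card_mono[rotated]) (use f0 in auto)
  also have "\<dots> \<le> Suc (card (Suc ` {j. i < jump (D * C) j}))" by (rule card_insert_le_m1) auto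
  also have "\<dots> = Suc (card {j. i < jump (D * C) j})" by (simp add: card_image)
  finally have l0: "block_size (C * D) 0 i \<le> block_size (D * C) 0 i + 1" unfolding block_size_def z by simp
  have "(\<Sum>\<mu>\<in>S - {0}. block_size (C * D) \<mu> i) = (\<Sum>\<mu>\<in>S - {0}. block_size (D * C) \<mu> i)"
    unfolding block_size_def using jump_arrow_nonzero[OF C D] by (intro sum.cong) auto
  moreover have "0 \<in> S" unfolding S_def by simp
  ultimately have "(\<Sum>\<mu>\<in>S. block_size (C * D) \<mu> i) \<le> (\<Sum>\<mu>\<in>S. block_size (D * C) \<mu> i) + 1"
    using l0 sum.remove[OF fS, of 0 "\<lambda>\<mu>. block_size (C * D) \<mu> i"]
      sum.remove[OF fS, of 0 "\<lambda>\<mu>. block_size (D * C) \<mu> i"] by simp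
  moreover have "profile (C * D) i = (\<Sum>\<mu>\<in>S. block_size (C * D) \<mu> i)"
    by (rule profile_eq_sum[OF fS]) (auto simp: S_def)
  moreover have "profile (D * C) i = (\<Sum>\<mu>\<in>S. block_size (D * C) \<mu> i)"
    by (rule profile_eq_sum[OF fS]) (auto simp: S_def)
  ultimately show ?thesis by simp
qed

text \<open>
  In terms of conjugate partitions: if every column is longer by at most one, then deleting the first row
  leaves rows that are not longer.
\<close>

lemma profile_le_of_jump:
  assumes X: "X \<in> carrier_mat n n" and Y: "Y \<in> carrier_mat m m"
    and le: "\<And>\<mu> j. jump (char_matrix X \<mu>) j \<le> jump (char_matrix Y \<mu>) j + 1"
  shows "profile X (Suc i) \<le> profile Y i"
proof -
  define S where "S = {\<mu>. \<exists>j. jump (char_matrix X \<mu>) j \<noteq> 0} \<union> {\<mu>. \<exists>j. jump (char_matrix Y \<mu>) j \<noteq> 0}"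
  have fS: "finite S" unfolding S_def using finite_spec[OF X] finite_spec[OF Y] by simp
  have "block_size X \<mu> (Suc i) \<le> block_size Y \<mu> i" for \<mu>
    unfolding block_size_def
  proof (rule card_mono[OF finite_block_size_set[OF Y]], rule subsetI)
    fix j assume "j \<in> {j. Suc i < jump (char_matrix X \<mu>) j}"
    with le[of \<mu> j] show "j \<in> {j. i < jump (char_matrix Y \<mu>) j}" by simp
  qed
  hence "(\<Sum>\<mu>\<in>S. block_size X \<mu> (Suc i)) \<le> (\<Sum>\<mu>\<in>S. block_size Y \<mu> i)" by (intro sum_mono)
  moreover have "profile X (Suc i) = (\<Sum>\<mu>\<in>S. block_size X \<mu> (Suc i))"
    by (rule profile_eq_sum[OF fS]) (auto simp: S_def)
  moreover have "profile Y i = (\<Sum>\<mu>\<in>S. block_size Y \<mu> i)"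
    by (rule profile_eq_sum[OF fS]) (auto simp: S_def)
  ultimately show ?thesis by simp
qed

lemma profile_xpoint:
  assumes "XData A Bm Bp a b \<in> xpoint_space n m"
  shows "profile Bm (Suc i) \<le> profile Bp i" "profile Bp (Suc i) \<le> profile Bm i"
proof -
  note D = xpoint_spaceD[OF assms]
  note A = D(1) and P = D(2) and Q = D(3) and a = D(4) and b = D(5) and eq = D(6) and obs = D(7) and gen = D(8)
  show "profile Bm (Suc i) \<le> profile Bp i"
    by (rule profile_le_of_jump[OF P Q jump_xpoint_shifted[OF A P Q a b eq obs]])
  have AT: "A\<^sup>T \<in> carrier_mat n m" and PT: "Bm\<^sup>T \<in> carrier_mat n n" and QT: "Bp\<^sup>T \<in> carrier_mat m m"
    and aT: "a\<^sup>T \<in> carrier_mat 1 m" and bT: "- b\<^sup>T \<in> carrier_mat n 1" using A P Q a b by auto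
  have "Bm\<^sup>T * A\<^sup>T - A\<^sup>T * Bp\<^sup>T + (- b\<^sup>T) * a\<^sup>T = - (Bp * A - A * Bm + a * b)\<^sup>T"
  proof -
    have 1: "Bm\<^sup>T * A\<^sup>T = (A * Bm)\<^sup>T" by (rule transpose_mult[OF A P, symmetric])
    have 2: "A\<^sup>T * Bp\<^sup>T = (Bp * A)\<^sup>T" by (rule transpose_mult[OF Q A, symmetric])
    have 3: "(- b\<^sup>T) * a\<^sup>T = - (a * b)\<^sup>T"
      using transpose_mult[OF a b] a b by simp
    have g: "U\<^sup>T - V\<^sup>T + - W\<^sup>T = - (V - U + W)\<^sup>T"
      if "U \<in> carrier_mat m n" "V \<in> carrier_mat m n" "W \<in> carrier_mat m n" for U V W :: "complex mat"
      using that by (intro eq_matI) auto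
    show ?thesis unfolding 1 2 3
      by (rule g[OF mult_carrier_mat[OF A P] mult_carrier_mat[OF Q A] mult_carrier_mat[OF a b]])
  qed
  also have "\<dots> = 0\<^sub>m n m" unfolding eq by (intro eq_matI) auto
  finally have eqT: "Bm\<^sup>T * A\<^sup>T - A\<^sup>T * Bp\<^sup>T + (- b\<^sup>T) * a\<^sup>T = 0\<^sub>m n m" .
  have "jump (char_matrix (Bp\<^sup>T) \<mu>) j \<le> jump (char_matrix (Bm\<^sup>T) \<mu>) j + 1" for \<mu> j
    by (rule jump_xpoint_shifted[OF AT QT PT bT aT eqT]) (rule observable_transpose[OF A Q a gen])
  hence "jump (char_matrix Bp \<mu>) j \<le> jump (char_matrix Bm \<mu>) j + 1" for \<mu> j
    unfolding jump_transpose[OF P] jump_transpose[OF Q] .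
  thus "profile Bp (Suc i) \<le> profile Bm i" by (rule profile_le_of_jump[OF Q P])
qed

section \<open>The criterion is necessary\<close>

text \<open>
  A partition of \<open>v \<zeta>\<close> has at most \<open>v \<zeta>\<close> nonzero parts, so the sum is over all of them.
\<close>

definition admissible :: "bow \<Rightarrow> (nat \<Rightarrow> nat) \<Rightarrow> (nat \<Rightarrow> nat \<Rightarrow> nat) \<Rightarrow> bool" where
  "admissible B v p \<longleftrightarrow>
     (\<forall>\<zeta><length B. (\<forall>i. p \<zeta> (Suc i) \<le> p \<zeta> i) \<and> (\<forall>i\<ge>v \<zeta>. p \<zeta> i = 0) \<and> (\<Sum>i<v \<zeta>. p \<zeta> i) = v \<zeta>) \<and>
     (\<forall>e<length B. \<forall>i. case B ! e of
        Arrow \<Rightarrow> p (seg_before B e) i \<le> p (seg_after B e) i + 1 \<and> p (seg_after B e) i \<le> p (seg_before B e) i + 1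
      | XPoint \<Rightarrow> p (seg_before B e) (Suc i) \<le> p (seg_after B e) i \<and> p (seg_after B e) (Suc i) \<le> p (seg_before B e) i)"

lemma seg_before_less: "e < length B \<Longrightarrow> seg_before B e < length B"
  unfolding seg_before_def by (rule mod_less_divisor) auto

lemma elem_after_seg_before: "e < length B \<Longrightarrow> elem_after B (seg_before B e) = e"
  unfolding elem_after_def seg_before_def
  by (cases e) (auto simp: mod_Suc_eq)

lemma seg_before_elem_after: "\<zeta> < length B \<Longrightarrow> seg_before B (elem_after B \<zeta>) = \<zeta>"
  unfolding elem_after_def seg_before_def by (cases "Suc \<zeta> = length B") auto

lemma elem_after_less: "\<zeta> < length B \<Longrightarrow> elem_after B \<zeta> < length B"
  unfolding elem_after_def by (auto intro: mod_less_divisor)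

lemma moment_carrier:
  assumes m: "m \<in> rep_space B v" and z: "\<zeta> < length B"
  shows "moment_from_before (m ! \<zeta>) \<in> carrier_mat (v \<zeta>) (v \<zeta>)"
    "moment_from_after (m ! elem_after B \<zeta>) \<in> carrier_mat (v \<zeta>) (v \<zeta>)"
proof -
  have 1: "m ! \<zeta> \<in> elem_space B v \<zeta>" using m z unfolding rep_space_def by auto
  show "moment_from_before (m ! \<zeta>) \<in> carrier_mat (v \<zeta>) (v \<zeta>)"
    using 1 unfolding elem_space_def arrow_space_def xpoint_space_def seg_after_def
    by (cases "B ! \<zeta>") auto
  have 2: "m ! elem_after B \<zeta> \<in> elem_space B v (elem_after B \<zeta>)"
    using m elem_after_less[OF z] unfolding rep_space_def by auto
  show "moment_from_after (m ! elem_after B \<zeta>) \<in> carrier_mat (v \<zeta>) (v \<zeta>)"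
    using 2 unfolding elem_space_def arrow_space_def xpoint_space_def seg_before_elem_after[OF z]
    by (cases "B ! elem_after B \<zeta>") auto
qed

lemma fibre_imp_admissible:
  assumes "m \<in> moment_fibre B v lam"
  shows "admissible B v (\<lambda>\<zeta>. profile (- moment_from_before (m ! \<zeta>)))"
proof -
  have m: "m \<in> rep_space B v" and mom: "\<And>\<zeta>. \<zeta> < length B \<Longrightarrow> moment_map B m \<zeta> = deformation B v lam \<zeta>"
    using assms unfolding moment_fibre_def by auto
  define X where "X \<zeta> = - moment_from_before (m ! \<zeta>)" for \<zeta>
  have X: "X \<zeta> \<in> carrier_mat (v \<zeta>) (v \<zeta>)" if "\<zeta> < length B" for \<zeta>
    unfolding X_def using moment_carrier(1)[OF m that] by simp
  \<comment> \<open>By the moment map equation the contributions of the two neighbours of a segment differ by a scalar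
    matrix only, so both have the same profile.\<close>
  have after: "profile (moment_from_after (m ! elem_after B \<zeta>)) = profile (X \<zeta>)" if z: "\<zeta> < length B" for \<zeta>
  proof -
    obtain c where c: "deformation B v lam \<zeta> = c \<cdot>\<^sub>m 1\<^sub>m (v \<zeta>)"
    proof (cases "\<zeta> \<in> wavy_lines B")
      case True thus ?thesis using that unfolding deformation_def by auto
    next
      case False
      have "0\<^sub>m (v \<zeta>) (v \<zeta>) = (0 :: complex) \<cdot>\<^sub>m 1\<^sub>m (v \<zeta>)" by (intro eq_matI) auto
      thus ?thesis using False that unfolding deformation_def by auto
    qed
    have "moment_from_after (m ! elem_after B \<zeta>) = X \<zeta> + moment_map B m \<zeta>"
      unfolding X_def moment_map_def elem_before_def using moment_carrier[OF m z] by (intro eq_matI) auto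
    thus ?thesis unfolding mom[OF z] c using profile_shift[OF X[OF z]] by simp
  qed
  show ?thesis unfolding admissible_def X_def[symmetric]
  proof (intro conjI allI impI)
    fix \<zeta> i assume z: "\<zeta> < length B"
    show "profile (X \<zeta>) (Suc i) \<le> profile (X \<zeta>) i" by (rule profile_antimono[OF X[OF z]])
    show "v \<zeta> \<le> i \<Longrightarrow> profile (X \<zeta>) i = 0" by (rule profile_zero[OF X[OF z]])
    show "(\<Sum>i<v \<zeta>. profile (X \<zeta>) i) = v \<zeta>" by (rule sum_profile[OF X[OF z]])
  next
    fix e i assume e: "e < length B"
    have me: "m ! e \<in> elem_space B v e" using m e unfolding rep_space_def by auto
    have before: "profile (X (seg_before B e)) = profile (moment_from_after (m ! e))"
      using after[OF seg_before_less[OF e]] elem_after_seg_before[OF e] by simp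
    show "case B ! e of
        Arrow \<Rightarrow> profile (X (seg_before B e)) i \<le> profile (X (seg_after B e)) i + 1 \<and>
          profile (X (seg_after B e)) i \<le> profile (X (seg_before B e)) i + 1
      | XPoint \<Rightarrow> profile (X (seg_before B e)) (Suc i) \<le> profile (X (seg_after B e)) i \<and>
          profile (X (seg_after B e)) (Suc i) \<le> profile (X (seg_before B e)) i"
    proof (cases "B ! e")
      case Arrow
      then obtain C D where d: "m ! e = ArrowData C D" and C: "C \<in> carrier_mat (v e) (v (seg_before B e))"
        and D: "D \<in> carrier_mat (v (seg_before B e)) (v e)"
        using me unfolding elem_space_def arrow_space_def seg_after_def by auto
      have C': "- C \<in> carrier_mat (v e) (v (seg_before B e))" using C by simp
      have "X e = (- C) * D" unfolding X_def d using C D by simp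
      moreover have "moment_from_after (m ! e) = D * (- C)" unfolding d using C D by simp
      ultimately show ?thesis using Arrow profile_arrow[OF C' D] profile_arrow[OF D C']
        unfolding seg_after_def before by simp
    next
      case XPoint
      then obtain A Bm Bp a b where d: "m ! e = XData A Bm Bp a b"
        and x: "XData A Bm Bp a b \<in> xpoint_space (v (seg_before B e)) (v e)"
        using me unfolding elem_space_def xpoint_space_def seg_after_def by auto
      have "X e = Bp" unfolding X_def d by simp
      thus ?thesis using XPoint profile_xpoint[OF x] unfolding seg_after_def before d by simp
    qed
  qed
qed

section \<open>Increments of partitions\<close>

lemma sum_support_eq:
  fixes f :: "nat \<Rightarrow> nat"
  assumes "\<And>i. i \<ge> n \<Longrightarrow> f i = 0" "\<And>i. i \<ge> m \<Longrightarrow> f i = 0"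
  shows "sum f {..<n} = sum f {..<m}"
proof -
  have "sum f {..<n} = sum f {..<max n m}" by (rule sum.mono_neutral_left) (use assms in auto)
  also have "\<dots> = sum f {..<m}" by (rule sum.mono_neutral_right) (use assms in auto)
  finally show ?thesis .
qed

lemma arc_constant:
  assumes e: "e < length B" and p: "p < length B" and q: "q < length B" and ne: "e \<noteq> p" "e \<noteq> q"
    and c: "\<forall>S\<in>cut_arcs B p q. \<forall>\<zeta>\<in>S. \<forall>\<eta>\<in>S. d \<zeta> = d \<eta>"
  shows "d (seg_before B e) = d (seg_after B e)"
proof (cases "p = q")
  case True
  have "\<forall>\<zeta>\<in>{..<length B}. \<forall>\<eta>\<in>{..<length B}. d \<zeta> = d \<eta>" 
    by (rule bspec[OF c]) (simp add: cut_arcs_def True)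
  from bspec[OF bspec[OF this, of "seg_before B e"], of e]
  show ?thesis using seg_before_less[OF e] e unfolding seg_after_def by simp
next
  case False
  let ?A = "{min p q..<max p q}"
  have c': "\<forall>\<zeta>\<in>?A. \<forall>\<eta>\<in>?A. d \<zeta> = d \<eta>" "\<forall>\<zeta>\<in>{..<length B} - ?A. \<forall>\<eta>\<in>{..<length B} - ?A. d \<zeta> = d \<eta>"
    by (rule bspec[OF c], simp add: cut_arcs_def False)+
  have "seg_before B e \<in> ?A \<longleftrightarrow> e \<in> ?A"
  proof (cases e)
    case 0
    hence "seg_before B e = length B - 1" unfolding seg_before_def using e by simp
    thus ?thesis using 0 ne p q by auto
  next
    case (Suc k)
    hence "seg_before B e = k" unfolding seg_before_def using e by simp
    thus ?thesis using Suc ne by auto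
  qed
  thus ?thesis
    using bspec[OF bspec[OF c'(1), of "seg_before B e"], of e]
      bspec[OF bspec[OF c'(2), of "seg_before B e"], of e] seg_before_less[OF e] e
    unfolding seg_after_def by (cases "e \<in> ?A") auto
qed

text \<open>
  The conditions at an x-point never bound a first row from above, so first rows may be lengthened
  independently on both sides of an x-point.
\<close>

lemma admissible_add_row:
  assumes p: "admissible B v p"
    and d: "\<And>e. e < length B \<Longrightarrow> B ! e = Arrow \<Longrightarrow> d (seg_before B e) = d (seg_after B e)"
  shows "admissible B (\<lambda>\<zeta>. v \<zeta> + d \<zeta>) (\<lambda>\<zeta> i. p \<zeta> i + (if i = 0 then d \<zeta> else 0))"
  unfolding admissible_def
proof (intro conjI allI impI)
  fix \<zeta> i assume z: "\<zeta> < length B"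
  have P: "\<And>i. p \<zeta> (Suc i) \<le> p \<zeta> i" "\<And>i. i \<ge> v \<zeta> \<Longrightarrow> p \<zeta> i = 0" "(\<Sum>i<v \<zeta>. p \<zeta> i) = v \<zeta>"
    using p z unfolding admissible_def by auto
  show "p \<zeta> (Suc i) + (if Suc i = 0 then d \<zeta> else 0) \<le> p \<zeta> i + (if i = 0 then d \<zeta> else 0)"
    using P(1)[of i] by simp
  show "v \<zeta> + d \<zeta> \<le> i \<Longrightarrow> p \<zeta> i + (if i = 0 then d \<zeta> else 0) = 0" using P(2)[of i] by auto
  have "(\<Sum>i<v \<zeta> + d \<zeta>. p \<zeta> i) = v \<zeta>" using sum_support_eq[of "v \<zeta> + d \<zeta>" "p \<zeta>" "v \<zeta>"] P by simp
  moreover have "(\<Sum>i<v \<zeta> + d \<zeta>. if i = 0 then d \<zeta> else 0) = d \<zeta>" by (simp add: sum.delta)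
  ultimately show "(\<Sum>i<v \<zeta> + d \<zeta>. p \<zeta> i + (if i = 0 then d \<zeta> else 0)) = v \<zeta> + d \<zeta>"
    by (simp add: sum.distrib)
next
  fix e i assume e: "e < length B"
  note P = p[unfolded admissible_def, THEN conjunct2, rule_format, OF e, of i]
  show "case B ! e of
      Arrow \<Rightarrow> p (seg_before B e) i + (if i = 0 then d (seg_before B e) else 0) \<le> p (seg_after B e) i + (if i = 0 then d (seg_after B e) else 0) + 1 \<and>
        p (seg_after B e) i + (if i = 0 then d (seg_after B e) else 0) \<le> p (seg_before B e) i + (if i = 0 then d (seg_before B e) else 0) + 1
    | XPoint \<Rightarrow> p (seg_before B e) (Suc i) + (if Suc i = 0 then d (seg_before B e) else 0) \<le> p (seg_after B e) i + (if i = 0 then d (seg_after B e) else 0) \<and>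
        p (seg_after B e) (Suc i) + (if Suc i = 0 then d (seg_after B e) else 0) \<le> p (seg_before B e) i + (if i = 0 then d (seg_before B e) else 0)"
    using P d[OF e] by (cases "B ! e") auto
qed

text \<open>
  Parts \<open>0\<close> and \<open>1\<close> may face each other across an arrow, so rows of length one may be appended
  independently on both sides of an arrow.
\<close>

lemma admissible_add_column:
  assumes p: "admissible B v p"
    and d: "\<And>e. e < length B \<Longrightarrow> B ! e = XPoint \<Longrightarrow> d (seg_before B e) = d (seg_after B e)"
  shows "\<exists>p'. admissible B (\<lambda>\<zeta>. v \<zeta> + d \<zeta>) p'"
proof -
  define l where "l \<zeta> = (LEAST i. p \<zeta> i = 0)" for \<zeta>
  \<comment> \<open>\<open>d \<zeta>\<close> new rows of length one are placed below the \<open>l \<zeta>\<close> nonempty rows.\<close>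
  define p' where "p' \<zeta> i = p \<zeta> i + (if l \<zeta> \<le> i \<and> i < l \<zeta> + d \<zeta> then 1 else 0)" for \<zeta> i
  have P: "\<And>i. p \<zeta> (Suc i) \<le> p \<zeta> i" "\<And>i. i \<ge> v \<zeta> \<Longrightarrow> p \<zeta> i = 0" "(\<Sum>i<v \<zeta>. p \<zeta> i) = v \<zeta>"
    if "\<zeta> < length B" for \<zeta> using p that unfolding admissible_def by auto
  have lz: "p \<zeta> i = 0 \<longleftrightarrow> l \<zeta> \<le> i" if z: "\<zeta> < length B" for \<zeta> i
  proof
    assume "p \<zeta> i = 0" thus "l \<zeta> \<le> i" unfolding l_def by (rule Least_le)
  next
    assume "l \<zeta> \<le> i"
    hence "p \<zeta> i \<le> p \<zeta> (l \<zeta>)" by (rule lift_Suc_antimono_le[of "p \<zeta>", OF P(1)[OF z]])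
    moreover have "p \<zeta> (l \<zeta>) = 0" unfolding l_def by (rule LeastI[of _ "v \<zeta>"]) (rule P(2)[OF z], simp)
    ultimately show "p \<zeta> i = 0" by simp
  qed
  have "admissible B (\<lambda>\<zeta>. v \<zeta> + d \<zeta>) p'" unfolding admissible_def
  proof (intro conjI allI impI)
    fix \<zeta> i assume z: "\<zeta> < length B"
    have lv: "l \<zeta> \<le> v \<zeta>" using lz[OF z] P(2)[OF z, of "v \<zeta>"] by simp
    show "p' \<zeta> (Suc i) \<le> p' \<zeta> i" unfolding p'_def using P(1)[OF z, of i] lz[OF z, of i] lz[OF z, of "Suc i"] by auto
    show "v \<zeta> + d \<zeta> \<le> i \<Longrightarrow> p' \<zeta> i = 0" unfolding p'_def using P(2)[OF z, of i] lv by auto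
    have "(\<Sum>i<v \<zeta> + d \<zeta>. p \<zeta> i) = v \<zeta>" using sum_support_eq[of "v \<zeta> + d \<zeta>" "p \<zeta>" "v \<zeta>"] P[OF z] by simp
    moreover have "(\<Sum>i<v \<zeta> + d \<zeta>. if l \<zeta> \<le> i \<and> i < l \<zeta> + d \<zeta> then 1 else 0 :: nat) = d \<zeta>"
    proof -
      have "{..<v \<zeta> + d \<zeta>} \<inter> {i. l \<zeta> \<le> i \<and> i < l \<zeta> + d \<zeta>} = {l \<zeta>..<l \<zeta> + d \<zeta>}" using lv by auto
      thus ?thesis by (simp add: sum.If_cases)
    qed
    ultimately show "(\<Sum>i<v \<zeta> + d \<zeta>. p' \<zeta> i) = v \<zeta> + d \<zeta>" unfolding p'_def by (simp add: sum.distrib)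
  next
    fix e i assume e: "e < length B"
    note b = seg_before_less[OF e]
    have a: "seg_after B e < length B" using e unfolding seg_after_def .
    note R = p[unfolded admissible_def, THEN conjunct2, rule_format, OF e]
    show "case B ! e of
        Arrow \<Rightarrow> p' (seg_before B e) i \<le> p' (seg_after B e) i + 1 \<and> p' (seg_after B e) i \<le> p' (seg_before B e) i + 1
      | XPoint \<Rightarrow> p' (seg_before B e) (Suc i) \<le> p' (seg_after B e) i \<and> p' (seg_after B e) (Suc i) \<le> p' (seg_before B e) i"
    proof (cases "B ! e")
      case Arrow
      thus ?thesis using R[of i] lz[OF a, of i] lz[OF b, of i] unfolding p'_def by auto
    next
      case XPoint
      have "p' \<zeta> (Suc i) \<le> p' \<eta> i"
        if z: "\<zeta> < length B" "\<eta> < length B" "d \<zeta> = d \<eta>" and r: "\<And>i. p \<zeta> (Suc i) \<le> p \<eta> i" for \<zeta> \<eta>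
      proof -
        have "p \<zeta> (Suc (l \<eta>)) = 0" using r[of "l \<eta>"] lz[OF z(2), of "l \<eta>"] by simp
        hence "l \<zeta> \<le> Suc (l \<eta>)" using lz[OF z(1)] by simp
        thus ?thesis unfolding p'_def using r[of i] lz[OF z(1), of "Suc i"] lz[OF z(2), of i] z(3) by auto
      qed
      from this[OF a b] this[OF b a] show ?thesis using R XPoint d[OF e XPoint] by simp
    qed
  qed
  thus ?thesis by blast
qed

lemma susy_increment_admissible:
  assumes s: "susy_increment B V V'" and V: "\<forall>\<zeta><length B. V \<zeta> \<ge> 0"
    and p: "admissible B (\<lambda>\<zeta>. nat (V \<zeta>)) p"
  shows "(\<forall>\<zeta><length B. V' \<zeta> \<ge> 0) \<and> (\<exists>p'. admissible B (\<lambda>\<zeta>. nat (V' \<zeta>)) p')"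
proof -
  obtain x y where xy: "x < length B" "y < length B" "B ! x = B ! y"
    and nn: "\<forall>\<zeta><length B. V' \<zeta> - V \<zeta> \<ge> 0"
    and c: "\<forall>S\<in>cut_arcs B x y. \<forall>\<zeta>\<in>S. \<forall>\<eta>\<in>S. V' \<zeta> - V \<zeta> = V' \<eta> - V \<eta>"
    using s unfolding susy_increment_def by blast
  define d where "d \<zeta> = nat (V' \<zeta> - V \<zeta>)" for \<zeta>
  have cd: "\<forall>S\<in>cut_arcs B x y. \<forall>\<zeta>\<in>S. \<forall>\<eta>\<in>S. d \<zeta> = d \<eta>" using c unfolding d_def by metis
  have dd: "d (seg_before B e) = d (seg_after B e)" if "e < length B" "B ! e \<noteq> B ! x" for e
    by (rule arc_constant[OF that(1) xy(1,2) _ _ cd]) (use that xy in auto)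
  have v': "nat (V' \<zeta>) = nat (V \<zeta>) + d \<zeta>" if "\<zeta> < length B" for \<zeta>
    using nn[rule_format, OF that] V[rule_format, OF that] unfolding d_def by arith
  have "\<exists>p'. admissible B (\<lambda>\<zeta>. nat (V \<zeta>) + d \<zeta>) p'"
  proof (cases "B ! x")
    case Arrow
    show ?thesis by (rule admissible_add_column[OF p]) (use dd Arrow in auto)
  next
    case XPoint
    show ?thesis using admissible_add_row[OF p, of d] dd XPoint by auto
  qed
  hence "\<exists>p'. admissible B (\<lambda>\<zeta>. nat (V' \<zeta>)) p'"
    unfolding admissible_def using v' by simp
  moreover have "\<forall>\<zeta><length B. V' \<zeta> \<ge> 0" using nn V by (metis diff_ge_0_iff_ge order_trans)
  ultimately show ?thesis by blast
qed

lemma susy_increments_admissible: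
  assumes "susy_increments B V V'" and V: "\<forall>\<zeta><length B. V \<zeta> \<ge> 0"
    and p: "admissible B (\<lambda>\<zeta>. nat (V \<zeta>)) p"
  shows "(\<forall>\<zeta><length B. V' \<zeta> \<ge> 0) \<and> (\<exists>p'. admissible B (\<lambda>\<zeta>. nat (V' \<zeta>)) p')"
  using assms(1) unfolding susy_increments_def
proof (induction rule: rtranclp_induct)
  case base
  show ?case using V p by blast
next
  case (step y z)
  thus ?case using susy_increment_admissible[OF step.hyps(2)] by blast
qed

section \<open>Nilpotent matrices of given Jordan type\<close>

definition column_mat :: "nat \<Rightarrow> nat \<Rightarrow> (nat \<Rightarrow> complex vec) \<Rightarrow> complex mat" where
  "column_mat n m F = mat n m (\<lambda>(r, c). F c $ r)"

lemma column_mat_carrier [simp]: "column_mat n m F \<in> carrier_mat n m"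
  unfolding column_mat_def by simp

lemma column_mat_unit: "c < m \<Longrightarrow> F c \<in> carrier_vec n \<Longrightarrow> column_mat n m F *\<^sub>v unit_vec m c = F c"
  unfolding column_mat_def by (intro eq_vecI) auto

lemma mat_eq_unitI:
  fixes M N :: "complex mat"
  assumes M: "M \<in> carrier_mat n m" and N: "N \<in> carrier_mat n m"
    and e: "\<And>c. c < m \<Longrightarrow> M *\<^sub>v unit_vec m c = N *\<^sub>v unit_vec m c"
  shows "M = N"
proof (rule eq_matI)
  fix i j assume ij: "i < dim_row N" "j < dim_col N"
  have entry: "X $$ (i, j) = (X *\<^sub>v unit_vec m j) $ i" if "X \<in> carrier_mat n m" for X :: "complex mat"
    using that ij N by auto
  have j: "j < m" using ij N by simp
  show "M $$ (i, j) = N $$ (i, j)" unfolding entry[OF M] entry[OF N] e[OF j] ..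
qed (use M N in auto)

definition is_partition :: "nat \<Rightarrow> (nat \<Rightarrow> nat) \<Rightarrow> bool" where
  "is_partition n p \<longleftrightarrow> (\<forall>i. p (Suc i) \<le> p i) \<and> (\<exists>M. (\<forall>i\<ge>M. p i = 0) \<and> (\<Sum>i<M. p i) = n)"

text \<open>
  The Young diagram of \<open>p\<close>. The box \<open>(i, s)\<close> stands for the basis vector \<open>x ^ s\<close> of the \<open>i\<close>-th summand of
  the module \<open>\<Oplus>\<^sub>i \<complex>[x] / (x ^ p i)\<close>.
\<close>

definition boxes :: "(nat \<Rightarrow> nat) \<Rightarrow> (nat \<times> nat) set" where
  "boxes p = {(i, s). s < p i}"

text \<open>
  An arbitrary enumeration of the boxes, which translates them into coordinates.
\<close>

definition box_index :: "(nat \<Rightarrow> nat) \<Rightarrow> nat \<times> nat \<Rightarrow> nat" where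
  "box_index p = (SOME f. bij_betw f (boxes p) {..<card (boxes p)})"

text \<open>
  Boxes outside the diagram give zero, in accordance with \<open>x ^ p i = 0\<close>. This makes the formulas for
  linear maps on basis vectors valid without side conditions.
\<close>

definition box_vec :: "(nat \<Rightarrow> nat) \<Rightarrow> nat \<Rightarrow> nat \<times> nat \<Rightarrow> complex vec" where
  "box_vec p n x = (if x \<in> boxes p then unit_vec n (box_index p x) else 0\<^sub>v n)"

definition box_mat :: "(nat \<Rightarrow> nat) \<Rightarrow> nat \<Rightarrow> nat \<Rightarrow> (nat \<times> nat \<Rightarrow> complex vec) \<Rightarrow> complex mat" where
  "box_mat p n m F = column_mat m n (\<lambda>c. F (inv_into (boxes p) (box_index p) c))"

text \<open>
  Multiplication by \<open>x\<close>.
\<close>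

definition shift_mat :: "(nat \<Rightarrow> nat) \<Rightarrow> nat \<Rightarrow> complex mat" where
  "shift_mat p n = box_mat p n n (\<lambda>(i, s). box_vec p n (i, Suc s))"

lemma boxes_finite_card:
  assumes "is_partition n p" shows "finite (boxes p)" "card (boxes p) = n"
proof -
  obtain M where M: "\<And>i. i \<ge> M \<Longrightarrow> p i = 0" "(\<Sum>i<M. p i) = n" using assms unfolding is_partition_def by auto
  have e: "boxes p = Sigma {..<M} (\<lambda>i. {..<p i})"
    unfolding boxes_def using M(1) by (auto simp: not_le[symmetric])
  show "finite (boxes p)" unfolding e by auto
  show "card (boxes p) = n" unfolding e using M(2) by (simp add: card_SigmaI)
qed

lemma box_index_bij:
  assumes "is_partition n p" shows "bij_betw (box_index p) (boxes p) {..<n}"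
proof -
  have "\<exists>f. bij_betw f (boxes p) {..<card (boxes p)}"
    by (rule finite_same_card_bij[OF boxes_finite_card(1)[OF assms]]) auto
  from someI_ex[OF this] show ?thesis unfolding box_index_def boxes_finite_card(2)[OF assms] .
qed

lemma box_vec_carrier [simp]: "box_vec p n x \<in> carrier_vec n"
  unfolding box_vec_def by simp

lemma box_vec_outside: "p i \<le> s \<Longrightarrow> box_vec p n (i, s) = 0\<^sub>v n"
  unfolding box_vec_def boxes_def by simp

lemma box_mat_carrier [simp]: "box_mat p n m F \<in> carrier_mat m n"
  unfolding box_mat_def by simp

lemma box_mat_box_vec:
  assumes p: "is_partition n p" and x: "x \<in> boxes p" and F: "F x \<in> carrier_vec m"
  shows "box_mat p n m F *\<^sub>v box_vec p n x = F x"
proof -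
  note b = box_index_bij[OF p]
  have c: "box_index p x < n" using bij_betwE[OF b] x by auto
  have i: "inv_into (boxes p) (box_index p) (box_index p x) = x"
    by (rule inv_into_f_f[OF bij_betw_imp_inj_on[OF b] x])
  show ?thesis unfolding box_mat_def box_vec_def if_P[OF x]
    by (subst column_mat_unit[OF c]) (use F i in auto)
qed

lemma unit_vec_box_vec:
  assumes p: "is_partition n p" and c: "c < n"
  obtains x where "x \<in> boxes p" "unit_vec n c = box_vec p n x"
proof -
  have "c \<in> box_index p ` boxes p" using box_index_bij[OF p] c unfolding bij_betw_def by simp
  then obtain x where "x \<in> boxes p" "c = box_index p x" by auto
  thus ?thesis using that unfolding box_vec_def by auto
qed

lemma mat_eq_box_vecI:
  assumes p: "is_partition n p" and M: "M \<in> carrier_mat m n" and N: "N \<in> carrier_mat m n"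
    and e: "\<And>i s. s < p i \<Longrightarrow> M *\<^sub>v box_vec p n (i, s) = N *\<^sub>v box_vec p n (i, s)"
  shows "M = N"
proof (rule mat_eq_unitI[OF M N])
  fix c assume "c < n"
  then obtain x where "x \<in> boxes p" "unit_vec n c = box_vec p n x" by (rule unit_vec_box_vec[OF p])
  thus "M *\<^sub>v unit_vec n c = N *\<^sub>v unit_vec n c" using e unfolding boxes_def by auto
qed

lemma box_mat_outside:
  assumes "p i \<le> s" shows "box_mat p n m F *\<^sub>v box_vec p n (i, s) = 0\<^sub>v m"
  unfolding box_vec_outside[of p i s, OF assms] by (rule mult_mat_zero_vec[OF box_mat_carrier])

lemma shift_map_box_vec:
  assumes p: "is_partition n p" and k: "q i \<le> p i + k i"
  shows "box_mat p n m (\<lambda>(i, s). box_vec q m (i, s + k i)) *\<^sub>v box_vec p n (i, s) = box_vec q m (i, s + k i)"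
proof (cases "s < p i")
  case True
  hence x: "(i, s) \<in> boxes p" unfolding boxes_def by simp
  show ?thesis using box_mat_box_vec[OF p x, where m = m and F = "\<lambda>(i, s). box_vec q m (i, s + k i)"] by simp
next
  case False
  hence le: "p i \<le> s" by simp
  show ?thesis unfolding box_mat_outside[of p i s, OF le] using k le by (simp add: box_vec_outside)
qed

lemma shift_mat_carrier [simp]: "shift_mat p n \<in> carrier_mat n n"
  unfolding shift_mat_def by simp

lemma shift_mat_box_vec:
  assumes p: "is_partition n p" shows "shift_mat p n *\<^sub>v box_vec p n (i, s) = box_vec p n (i, Suc s)"
  using shift_map_box_vec[OF p, where q = p and k = "\<lambda>_. 1" and m = n] unfolding shift_mat_def by simp

lemma shift_mat_pow_box_vec:
  assumes p: "is_partition n p" shows "shift_mat p n ^\<^sub>m k *\<^sub>v box_vec p n (i, s) = box_vec p n (i, s + k)"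
proof (induction k)
  case 0
  have "shift_mat p n ^\<^sub>m 0 = 1\<^sub>m n" using carrier_matD(1)[OF shift_mat_carrier[of p n]] by simp
  thus ?case by simp
next
  case (Suc k)
  have "shift_mat p n ^\<^sub>m Suc k *\<^sub>v box_vec p n (i, s) = shift_mat p n *\<^sub>v (shift_mat p n ^\<^sub>m k *\<^sub>v box_vec p n (i, s))"
    unfolding pow_mat_Suc_left[OF shift_mat_carrier]
    by (rule assoc_mult_mat_vec[OF shift_mat_carrier pow_carrier_mat[OF shift_mat_carrier] box_vec_carrier])
  thus ?case unfolding Suc shift_mat_box_vec[OF p] by simp
qed

text \<open>
  In each row, one of \<open>C\<close> and \<open>D\<close> is the identity on box positions and the other is the shift: the shift goes
  towards the longer row, or towards the tail of the arrow if the lengths agree.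
\<close>

lemma arrow_exists:
  assumes p: "is_partition n p" and q: "is_partition m q"
    and pq: "\<And>i. p i \<le> q i + 1" "\<And>i. q i \<le> p i + 1"
  obtains C D where "C \<in> carrier_mat m n" "D \<in> carrier_mat n m" "D * C = shift_mat p n" "C * D = shift_mat q m"
proof -
  define k where "k i = (if q i > p i then 1 else 0 :: nat)" for i
  define l where "l i = (if q i \<le> p i then 1 else 0 :: nat)" for i
  define C where "C = box_mat p n m (\<lambda>(i, s). box_vec q m (i, s + k i))"
  define D where "D = box_mat q m n (\<lambda>(i, s). box_vec p n (i, s + l i))"
  have C: "C \<in> carrier_mat m n" and D: "D \<in> carrier_mat n m" unfolding C_def D_def by simp_all
  have Ce: "C *\<^sub>v box_vec p n (i, s) = box_vec q m (i, s + k i)" for i s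
    unfolding C_def by (rule shift_map_box_vec[OF p]) (use pq(2)[of i] in \<open>auto simp: k_def\<close>)
  have De: "D *\<^sub>v box_vec q m (i, s) = box_vec p n (i, s + l i)" for i s
    unfolding D_def by (rule shift_map_box_vec[OF q]) (use pq(1)[of i] in \<open>auto simp: l_def\<close>)
  have kl: "s + k i + l i = Suc s" "s + l i + k i = Suc s" for i s unfolding k_def l_def by auto
  have "D * C = shift_mat p n"
    by (rule mat_eq_box_vecI[OF p mult_carrier_mat[OF D C] shift_mat_carrier])
      (unfold assoc_mult_mat_vec[OF D C box_vec_carrier] Ce De shift_mat_box_vec[OF p] kl, rule refl)
  moreover have "C * D = shift_mat q m"
    by (rule mat_eq_box_vecI[OF q mult_carrier_mat[OF C D] shift_mat_carrier])
      (unfold assoc_mult_mat_vec[OF C D box_vec_carrier] Ce De shift_mat_box_vec[OF q] kl, rule refl)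
  ultimately show ?thesis using that C D by blast
qed

section \<open>X-points from cyclic extensions\<close>

definition zero_pad :: "nat \<Rightarrow> nat \<Rightarrow> complex vec \<Rightarrow> complex vec" where
  "zero_pad t K y = vec (t + K) (\<lambda>i. if i < t then y $ i else 0)"

text \<open>
  For a submodule embedded by \<open>J\<close> with a cyclic quotient generated by \<open>\<epsilon>\<close>, the columns form a basis: one of
  the submodule, continued by a Krylov sequence of \<open>\<epsilon>\<close>.
\<close>

definition krylov :: "nat \<Rightarrow> nat \<Rightarrow> nat \<Rightarrow> complex mat \<Rightarrow> complex mat \<Rightarrow> complex vec \<Rightarrow> complex mat" where
  "krylov n t K J B \<epsilon> = column_mat n (t + K) (\<lambda>c. if c < t then J *\<^sub>v unit_vec t c else B ^\<^sub>m (c - t) *\<^sub>v \<epsilon>)"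

text \<open>
  The operator on the column coordinates of \<open>krylov\<close> that acts by \<open>T\<close> on the first \<open>t\<close> of them, shifts the
  vectors \<open>B ^ k \<epsilon>\<close>, and replaces \<open>B ^ K \<epsilon>\<close> by \<open>J u\<close>.
\<close>

definition companion :: "nat \<Rightarrow> nat \<Rightarrow> complex mat \<Rightarrow> complex vec \<Rightarrow> complex mat" where
  "companion t K T u = column_mat (t + K) (t + K)
     (\<lambda>c. if c < t then zero_pad t K (T *\<^sub>v unit_vec t c)
          else if Suc c < t + K then unit_vec (t + K) (Suc c) else zero_pad t K u)"

text \<open>
  For \<open>K = 0\<close> this is zero.
\<close>

definition last_coord :: "nat \<Rightarrow> nat \<Rightarrow> complex mat" where
  "last_coord t K = mat 1 (t + K) (\<lambda>(_, c). if t \<le> c \<and> Suc c = t + K then 1 else 0)"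

definition vec_mat :: "nat \<Rightarrow> complex vec \<Rightarrow> complex mat" where
  "vec_mat n r = column_mat n 1 (\<lambda>_. r)"

lemma zero_pad_carrier [simp]: "zero_pad t K y \<in> carrier_vec (t + K)"
  unfolding zero_pad_def by simp

lemma krylov_carrier [simp]: "krylov n t K J B \<epsilon> \<in> carrier_mat n (t + K)"
  unfolding krylov_def by simp

lemma companion_carrier [simp]: "companion t K T u \<in> carrier_mat (t + K) (t + K)"
  unfolding companion_def by simp

lemma last_coord_carrier [simp]: "last_coord t K \<in> carrier_mat 1 (t + K)"
  unfolding last_coord_def by simp

lemma vec_mat_carrier [simp]: "vec_mat n r \<in> carrier_mat n 1"
  unfolding vec_mat_def by simp

lemma vec_mat_mult:
  assumes r: "r \<in> carrier_vec n" and y: "y \<in> carrier_vec 1"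
  shows "vec_mat n r *\<^sub>v y = y $ 0 \<cdot>\<^sub>v r"
  unfolding vec_mat_def column_mat_def using r y by (intro eq_vecI) (auto simp: scalar_prod_def)

lemma last_coord_mult:
  assumes x: "x \<in> carrier_vec (t + K)"
  shows "last_coord t K *\<^sub>v x = vec 1 (\<lambda>_. if K = 0 then 0 else x $ (t + K - 1))"
proof (rule eq_vecI)
  fix i assume "i < dim_vec (vec 1 (\<lambda>_. if K = 0 then 0 else x $ (t + K - 1)))"
  hence i: "i = 0" by simp
  have "(last_coord t K *\<^sub>v x) $ 0 = (\<Sum>c<t + K. (if t \<le> c \<and> Suc c = t + K then 1 else 0) * x $ c)"
    unfolding last_coord_def using x by (auto simp: scalar_prod_def atLeast0LessThan intro!: sum.cong)
  also have "\<dots> = (\<Sum>c<t + K. if c = t + K - 1 then (if K = 0 then 0 else x $ c) else 0)"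
    by (intro sum.cong) auto
  also have "\<dots> = (if K = 0 then 0 else x $ (t + K - 1))" by (auto simp: sum.delta)
  finally show "(last_coord t K *\<^sub>v x) $ i = vec 1 (\<lambda>_. if K = 0 then 0 else x $ (t + K - 1)) $ i"
    using i by simp
qed (simp add: last_coord_def)

lemma krylov_unit:
  assumes J: "J \<in> carrier_mat n t" and B: "B \<in> carrier_mat n n" and e: "\<epsilon> \<in> carrier_vec n" and c: "c < t + K"
  shows "krylov n t K J B \<epsilon> *\<^sub>v unit_vec (t + K) c = (if c < t then J *\<^sub>v unit_vec t c else B ^\<^sub>m (c - t) *\<^sub>v \<epsilon>)"
  unfolding krylov_def
  by (rule column_mat_unit[OF c]) (use J mult_mat_vec_carrier[OF pow_carrier_mat[OF B] e] in auto)

lemma krylov_zero_pad: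
  assumes J: "J \<in> carrier_mat n t" and y: "y \<in> carrier_vec t"
  shows "krylov n t K J B \<epsilon> *\<^sub>v zero_pad t K y = J *\<^sub>v y"
proof (rule eq_vecI)
  fix i assume "i < dim_vec (J *\<^sub>v y)"
  hence i: "i < n" using J by simp
  have "(krylov n t K J B \<epsilon> *\<^sub>v zero_pad t K y) $ i = (\<Sum>c<t + K. krylov n t K J B \<epsilon> $$ (i, c) * zero_pad t K y $ c)"
    using i by (simp add: krylov_def column_mat_def zero_pad_def scalar_prod_def atLeast0LessThan)
  also have "\<dots> = (\<Sum>c<t. J $$ (i, c) * y $ c)"
  proof (rule sum.mono_neutral_cong_right)
    show "\<forall>c\<in>{..<t + K} - {..<t}. krylov n t K J B \<epsilon> $$ (i, c) * zero_pad t K y $ c = 0"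
      unfolding zero_pad_def by auto
    fix c assume "c \<in> {..<t}"
    hence c: "c < t" by simp
    have "(J *\<^sub>v unit_vec t c) $ i = J $$ (i, c)" using J i c by auto
    thus "krylov n t K J B \<epsilon> $$ (i, c) * zero_pad t K y $ c = J $$ (i, c) * y $ c"
      using c i unfolding krylov_def column_mat_def zero_pad_def by simp
  qed auto
  also have "\<dots> = (J *\<^sub>v y) $ i" using J y i by (simp add: scalar_prod_def atLeast0LessThan)
  finally show "(krylov n t K J B \<epsilon> *\<^sub>v zero_pad t K y) $ i = (J *\<^sub>v y) $ i" .
qed (use J in \<open>simp add: krylov_def column_mat_def\<close>)

text \<open>
  The error term of rank at most one vanishes if \<open>B ^ K \<epsilon> = J u\<close>; at an x-point it will become \<open>- a b\<close>.
\<close>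

lemma krylov_companion:
  assumes J: "J \<in> carrier_mat n t" and B: "B \<in> carrier_mat n n" and e: "\<epsilon> \<in> carrier_vec n"
    and T: "T \<in> carrier_mat t t" and u: "u \<in> carrier_vec t" and BJ: "B * J = J * T"
  shows "B * krylov n t K J B \<epsilon> = krylov n t K J B \<epsilon> * companion t K T u
      + vec_mat n (B ^\<^sub>m K *\<^sub>v \<epsilon> - J *\<^sub>v u) * last_coord t K"
proof -
  let ?M = "krylov n t K J B \<epsilon>" and ?Q = "companion t K T u" and ?l = "last_coord t K"
  define r where "r = B ^\<^sub>m K *\<^sub>v \<epsilon> - J *\<^sub>v u"
  have Bk: "B ^\<^sub>m k *\<^sub>v \<epsilon> \<in> carrier_vec n" for k by (rule mult_mat_vec_carrier[OF pow_carrier_mat[OF B] e])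
  have Ju: "J *\<^sub>v u \<in> carrier_vec n" using J u by auto
  have r: "r \<in> carrier_vec n" unfolding r_def using Bk Ju by simp
  have MQ: "?M * ?Q \<in> carrier_mat n (t + K)" and rl: "vec_mat n r * ?l \<in> carrier_mat n (t + K)"
    using mult_carrier_mat[OF krylov_carrier companion_carrier] mult_carrier_mat[OF vec_mat_carrier last_coord_carrier] by auto
  show ?thesis unfolding r_def[symmetric]
  proof (rule mat_eq_unitI[OF mult_carrier_mat[OF B krylov_carrier] add_carrier_mat[OF rl]])
    fix c assume c: "c < t + K"
    let ?e = "unit_vec (t + K) c :: complex vec"
    have ec: "?e \<in> carrier_vec (t + K)" by simp
    have L: "(B * ?M) *\<^sub>v ?e = B *\<^sub>v (?M *\<^sub>v ?e)" by (rule assoc_mult_mat_vec[OF B krylov_carrier ec])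
    have R: "(?M * ?Q + vec_mat n r * ?l) *\<^sub>v ?e = ?M *\<^sub>v (?Q *\<^sub>v ?e) + vec_mat n r *\<^sub>v (?l *\<^sub>v ?e)"
      unfolding add_mult_distrib_mat_vec[OF MQ rl ec] assoc_mult_mat_vec[OF krylov_carrier companion_carrier ec]
        assoc_mult_mat_vec[OF vec_mat_carrier last_coord_carrier ec] ..
    have lv: "?l *\<^sub>v ?e \<in> carrier_vec 1" by (rule mult_mat_vec_carrier[OF last_coord_carrier ec])
    have Qe: "?Q *\<^sub>v ?e = (if c < t then zero_pad t K (T *\<^sub>v unit_vec t c)
          else if Suc c < t + K then unit_vec (t + K) (Suc c) else zero_pad t K u)"
      unfolding companion_def by (rule column_mat_unit[OF c]) auto
    have zero: "vec_mat n r *\<^sub>v (?l *\<^sub>v ?e) = 0\<^sub>v n" if "c < t \<or> Suc c < t + K"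
      unfolding vec_mat_mult[OF r lv] unfolding last_coord_mult[OF ec] using that c r by (intro eq_vecI) auto
    consider (a) "c < t" | (b) "c \<ge> t" "Suc c < t + K" | (z) "c \<ge> t" "Suc c = t + K" using c by linarith
    thus "(B * ?M) *\<^sub>v ?e = (?M * ?Q + vec_mat n r * ?l) *\<^sub>v ?e"
    proof cases
      case a
      have uc: "unit_vec t c \<in> carrier_vec t" by simp
      have Tc: "T *\<^sub>v unit_vec t c \<in> carrier_vec t" using T by auto
      have "B *\<^sub>v (?M *\<^sub>v ?e) = (B * J) *\<^sub>v unit_vec t c"
        unfolding krylov_unit[OF J B e c] using a assoc_mult_mat_vec[OF B J uc] by simp
      also have "\<dots> = J *\<^sub>v (T *\<^sub>v unit_vec t c)" unfolding BJ by (rule assoc_mult_mat_vec[OF J T uc])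
      also have "\<dots> = ?M *\<^sub>v (?Q *\<^sub>v ?e)" using a krylov_zero_pad[OF J Tc] unfolding Qe by simp
      also have "\<dots> = \<dots> + 0\<^sub>v n"
        by (rule right_zero_vec[symmetric], rule mult_mat_vec_carrier[OF krylov_carrier])
          (rule mult_mat_vec_carrier[OF companion_carrier ec])
      finally show ?thesis unfolding L R using zero a by simp
    next
      case b
      have "B *\<^sub>v (?M *\<^sub>v ?e) = B ^\<^sub>m Suc (c - t) *\<^sub>v \<epsilon>"
        unfolding krylov_unit[OF J B e c] pow_mat_Suc_left[OF B]
        using b assoc_mult_mat_vec[OF B pow_carrier_mat[OF B] e] by simp
      also have "\<dots> = ?M *\<^sub>v (?Q *\<^sub>v ?e)" unfolding Qe
        using b krylov_unit[OF J B e b(2)] by (simp add: Suc_diff_le)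
      also have "\<dots> = \<dots> + 0\<^sub>v n"
        by (rule right_zero_vec[symmetric], rule mult_mat_vec_carrier[OF krylov_carrier])
          (rule mult_mat_vec_carrier[OF companion_carrier ec])
      finally show ?thesis unfolding L R using zero b by simp
    next
      case z
      have K: "K = Suc (c - t)" using z by linarith
      have "B *\<^sub>v (?M *\<^sub>v ?e) = B ^\<^sub>m K *\<^sub>v \<epsilon>"
      proof -
        have "?M *\<^sub>v ?e = B ^\<^sub>m (c - t) *\<^sub>v \<epsilon>" using krylov_unit[OF J B e c] z by simp
        moreover have "B ^\<^sub>m K = B * B ^\<^sub>m (c - t)" using pow_mat_Suc_left[OF B, of "c - t"] unfolding K[symmetric] .
        ultimately show ?thesis using assoc_mult_mat_vec[OF B pow_carrier_mat[OF B] e] by simp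
      qed
      moreover have "?M *\<^sub>v (?Q *\<^sub>v ?e) = J *\<^sub>v u" unfolding Qe using z krylov_zero_pad[OF J u] by simp
      moreover have "vec_mat n r *\<^sub>v (?l *\<^sub>v ?e) = r"
        unfolding vec_mat_mult[OF r lv] unfolding last_coord_mult[OF ec] using z r by (intro eq_vecI) auto
      moreover have "B ^\<^sub>m K *\<^sub>v \<epsilon> = J *\<^sub>v u + r" unfolding r_def using Bk[of K] Ju B J by (intro eq_vecI) auto
      ultimately show ?thesis unfolding L R by simp
    qed
  qed
qed

text \<open>
  The matrix \<open>J\<close> makes the \<open>\<complex>[x]\<close>-module given by \<open>T\<close> a submodule of the one given by \<open>B\<close>, with a cyclic
  quotient of dimension \<open>K\<close> generated by \<open>\<epsilon>\<close>.
\<close>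

definition cyclic_ext ::
    "nat \<Rightarrow> nat \<Rightarrow> complex mat \<Rightarrow> nat \<Rightarrow> complex mat \<Rightarrow> complex mat \<Rightarrow> complex vec \<Rightarrow> complex vec \<Rightarrow> bool" where
  "cyclic_ext t K T n B J \<epsilon> u \<longleftrightarrow>
     n = t + K \<and> T \<in> carrier_mat t t \<and> B \<in> carrier_mat n n \<and> J \<in> carrier_mat n t \<and>
     \<epsilon> \<in> carrier_vec n \<and> u \<in> carrier_vec t \<and> B * J = J * T \<and> B ^\<^sub>m K *\<^sub>v \<epsilon> = J *\<^sub>v u \<and>
     (\<forall>W. lin_subspace n W \<and> invariant_under B W \<and> (\<lambda>x. J *\<^sub>v x) ` carrier_vec t \<subseteq> W \<and> \<epsilon> \<in> W
        \<longrightarrow> W = carrier_vec n)"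

lemma cyclic_ext_commute:
  assumes "cyclic_ext t K T n B J \<epsilon> u"
  shows "B * krylov n t K J B \<epsilon> = krylov n t K J B \<epsilon> * companion t K T u"
proof -
  have H: "T \<in> carrier_mat t t" "B \<in> carrier_mat n n" "J \<in> carrier_mat n t" "\<epsilon> \<in> carrier_vec n"
    "u \<in> carrier_vec t" "B * J = J * T" "B ^\<^sub>m K *\<^sub>v \<epsilon> = J *\<^sub>v u"
    using assms unfolding cyclic_ext_def by blast+
  have "vec_mat n (B ^\<^sub>m K *\<^sub>v \<epsilon> - J *\<^sub>v u) * last_coord t K = 0\<^sub>m n (t + K)"
  proof -
    have "B ^\<^sub>m K *\<^sub>v \<epsilon> - J *\<^sub>v u = 0\<^sub>v n" unfolding H(7) using H(3,5) by (intro eq_vecI) auto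
    hence "vec_mat n (B ^\<^sub>m K *\<^sub>v \<epsilon> - J *\<^sub>v u) = 0\<^sub>m n 1" unfolding vec_mat_def column_mat_def by (intro eq_matI) auto
    thus ?thesis using left_mult_zero_mat[OF last_coord_carrier] by (simp only:)
  qed
  thus ?thesis using krylov_companion[OF H(3,2,4,1,5,6), of K]
      right_add_zero_mat[OF mult_carrier_mat[OF krylov_carrier companion_carrier]] by simp
qed

text \<open>
  The column space of the square matrix is invariant under \<open>B\<close> and contains \<open>\<epsilon>\<close> and the image of \<open>J\<close>, so it
  is everything.
\<close>

lemma cyclic_ext_inverse:
  assumes H: "cyclic_ext t K T n B J \<epsilon> u"
  obtains R where "R \<in> carrier_mat n n" "krylov n t K J B \<epsilon> * R = 1\<^sub>m n" "R * krylov n t K J B \<epsilon> = 1\<^sub>m n"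
proof -
  let ?M = "krylov n t K J B \<epsilon>" and ?Q = "companion t K T u"
  have n: "n = t + K" and B: "B \<in> carrier_mat n n" and J: "J \<in> carrier_mat n t" and e: "\<epsilon> \<in> carrier_vec n"
    and u: "u \<in> carrier_vec t" and Beu: "B ^\<^sub>m K *\<^sub>v \<epsilon> = J *\<^sub>v u"
    using H unfolding cyclic_ext_def by blast+
  have gen: "W = carrier_vec n" if "lin_subspace n W" "invariant_under B W"
    "(\<lambda>x. J *\<^sub>v x) ` carrier_vec t \<subseteq> W" "\<epsilon> \<in> W" for W
    using H that unfolding cyclic_ext_def by blast
  have M: "?M \<in> carrier_mat n n" using krylov_carrier[of n t K] unfolding n .
  have Q: "?Q \<in> carrier_mat n n" using companion_carrier[of t K] unfolding n .
  have "(\<lambda>x. ?M *\<^sub>v x) ` carrier_vec n = carrier_vec n"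
  proof (rule gen[OF lin_subspace_image[OF M lin_subspace_carrier]])
    show "invariant_under B ((\<lambda>x. ?M *\<^sub>v x) ` carrier_vec n)" unfolding invariant_under_def
    proof
      fix y assume "y \<in> (\<lambda>x. ?M *\<^sub>v x) ` carrier_vec n"
      then obtain x where x: "x \<in> carrier_vec n" "y = ?M *\<^sub>v x" by auto
      have "B *\<^sub>v y = ?M *\<^sub>v (?Q *\<^sub>v x)"
        unfolding x(2) assoc_mult_mat_vec[OF B M x(1), symmetric] cyclic_ext_commute[OF H]
        by (rule assoc_mult_mat_vec[OF M Q x(1)])
      moreover have "?Q *\<^sub>v x \<in> carrier_vec n" by (rule mult_mat_vec_carrier[OF Q x(1)])
      ultimately show "B *\<^sub>v y \<in> (\<lambda>x. ?M *\<^sub>v x) ` carrier_vec n" by blast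
    qed
    show JM: "(\<lambda>x. J *\<^sub>v x) ` carrier_vec t \<subseteq> (\<lambda>x. ?M *\<^sub>v x) ` carrier_vec n"
    proof
      fix y assume "y \<in> (\<lambda>x. J *\<^sub>v x) ` carrier_vec t"
      then obtain x where x: "x \<in> carrier_vec t" "y = J *\<^sub>v x" by auto
      have "y = ?M *\<^sub>v zero_pad t K x" unfolding x(2) by (rule krylov_zero_pad[OF J x(1), symmetric])
      moreover have "zero_pad t K x \<in> carrier_vec n" unfolding n by simp
      ultimately show "y \<in> (\<lambda>x. ?M *\<^sub>v x) ` carrier_vec n" by blast
    qed
    show "\<epsilon> \<in> (\<lambda>x. ?M *\<^sub>v x) ` carrier_vec n"
    proof (cases "K = 0")
      case True
      hence "\<epsilon> = J *\<^sub>v u" using Beu e B by simp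
      thus ?thesis using JM u by blast
    next
      case False
      hence t: "t < t + K" by simp
      have "?M *\<^sub>v unit_vec (t + K) t = B ^\<^sub>m 0 *\<^sub>v \<epsilon>" using krylov_unit[OF J B e t] by simp
      also have "\<dots> = \<epsilon>" using B e by simp
      finally have "\<epsilon> = ?M *\<^sub>v unit_vec n t" unfolding n by simp
      thus ?thesis by (rule image_eqI) simp
    qed
  qed
  hence "\<forall>c<n. \<exists>x\<in>carrier_vec n. ?M *\<^sub>v x = unit_vec n c" by (metis image_iff unit_vec_carrier)
  then obtain X where X: "\<And>c. c < n \<Longrightarrow> X c \<in> carrier_vec n \<and> ?M *\<^sub>v X c = unit_vec n c" by metis
  let ?R = "column_mat n n X"
  have "?M * ?R = 1\<^sub>m n"
  proof (rule mat_eq_unitI[OF mult_carrier_mat[OF M column_mat_carrier] one_carrier_mat])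
    fix c assume c: "c < n"
    show "(?M * ?R) *\<^sub>v unit_vec n c = 1\<^sub>m n *\<^sub>v unit_vec n c"
      using assoc_mult_mat_vec[OF M column_mat_carrier, of "unit_vec n c" n X] column_mat_unit[OF c, of X n] X[OF c] by simp
  qed
  moreover from this have "?R * ?M = 1\<^sub>m n" by (rule mat_mult_left_right_inverse[OF M column_mat_carrier])
  ultimately show ?thesis using that column_mat_carrier by blast
qed

lemma cyclic_ext_inj:
  assumes H: "cyclic_ext t K T n B J \<epsilon> u" and y: "y \<in> carrier_vec t" "J *\<^sub>v y = 0\<^sub>v n"
  shows "y = 0\<^sub>v t"
proof -
  let ?M = "krylov n t K J B \<epsilon>"
  have n: "n = t + K" and J: "J \<in> carrier_mat n t" using H unfolding cyclic_ext_def by blast+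
  obtain R where R: "R \<in> carrier_mat n n" "R * ?M = 1\<^sub>m n" using cyclic_ext_inverse[OF H] by blast
  have p: "zero_pad t K y \<in> carrier_vec n" unfolding n by simp
  have M: "?M \<in> carrier_mat n n" using krylov_carrier[of n t K] unfolding n .
  have "zero_pad t K y = R *\<^sub>v (?M *\<^sub>v zero_pad t K y)" using assoc_mult_mat_vec[OF R(1) M p] p unfolding R(2) by simp
  also have "\<dots> = 0\<^sub>v n" unfolding krylov_zero_pad[OF J y(1)] y(2) by (rule mult_mat_zero_vec[OF R(1)])
  finally have z: "zero_pad t K y = 0\<^sub>v n" .
  show ?thesis
  proof (rule eq_vecI)
    fix i assume i: "i < dim_vec (0\<^sub>v t :: complex vec)"
    have "zero_pad t K y $ i = 0" unfolding z using i n by simp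
    thus "y $ i = 0\<^sub>v t $ i" using i unfolding zero_pad_def by simp
  qed (use y in auto)
qed

text \<open>
  Two cyclic extensions of the same module are glued to an x-point. Both quotients are cyclic, but they
  may have different dimensions.
\<close>

lemma xpoint_of_cyclic_ext:
  assumes H: "cyclic_ext t K T n P J \<epsilon> u" and H': "cyclic_ext t K' T m Q J' \<epsilon>' u'"
  shows "\<exists>A a b. XData A P Q a b \<in> xpoint_space n m"
proof -
  let ?M = "krylov n t K J P \<epsilon>" and ?C = "companion t K T u" and ?G = "krylov m t K J' Q \<epsilon>'" and ?l = "last_coord t K"
  have n: "n = t + K" and T: "T \<in> carrier_mat t t" and P: "P \<in> carrier_mat n n" and J: "J \<in> carrier_mat n t"
    and u: "u \<in> carrier_vec t"
    using H unfolding cyclic_ext_def by blast+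
  have Q: "Q \<in> carrier_mat m m" and J': "J' \<in> carrier_mat m t" and e': "\<epsilon>' \<in> carrier_vec m" and QJ: "Q * J' = J' * T"
    using H' unfolding cyclic_ext_def by blast+
  have gen: "W = carrier_vec m" if "lin_subspace m W" "invariant_under Q W"
    "(\<lambda>x. J' *\<^sub>v x) ` carrier_vec t \<subseteq> W" "\<epsilon>' \<in> W" for W
    using H' that unfolding cyclic_ext_def by blast
  obtain R where R: "R \<in> carrier_mat n n" and MR: "?M * R = 1\<^sub>m n" and RM: "R * ?M = 1\<^sub>m n"
    by (rule cyclic_ext_inverse[OF H])
  have M: "?M \<in> carrier_mat n n" using krylov_carrier[of n t K] unfolding n .
  have C: "?C \<in> carrier_mat n n" using companion_carrier[of t K] unfolding n .
  have G: "?G \<in> carrier_mat m n" using krylov_carrier[of m t K] unfolding n .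
  have l: "?l \<in> carrier_mat 1 n" using last_coord_carrier[of t K] unfolding n .
  \<comment> \<open>\<open>R\<close> reads off coordinates with respect to the basis \<open>J, \<epsilon>, P \<epsilon>, \<dots>\<close> of the space before the x-point,
    and \<open>?G\<close> sends them to the same combination of \<open>J', \<epsilon>', Q \<epsilon>', \<dots>\<close> after it. This commutes with
    \<open>P\<close> and \<open>Q\<close> except on the last basis vector, where the error is \<open>r\<close>.\<close>
  define r where "r = Q ^\<^sub>m K *\<^sub>v \<epsilon>' - J' *\<^sub>v u"
  have r: "r \<in> carrier_vec m" unfolding r_def using J' u mult_mat_vec_carrier[OF pow_carrier_mat[OF Q] e'] by auto
  have rc: "vec_mat m r \<in> carrier_mat m 1" by (rule vec_mat_carrier)
  define A where "A = ?G * R"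
  define a where "a = - vec_mat m r"
  define b where "b = ?l * R"
  have A: "A \<in> carrier_mat m n" and a: "a \<in> carrier_mat m 1" and b: "b \<in> carrier_mat 1 n"
    unfolding A_def a_def b_def using G R l rc by (auto simp only: mult_carrier_mat uminus_carrier_iff_mat)
  have RP: "R * P = ?C * R"
  proof -
    have RPc: "R * P \<in> carrier_mat n n" using R P by simp
    have "R * P = R * P * (?M * R)" unfolding MR by (rule right_mult_one_mat[OF RPc, symmetric])
    also have "\<dots> = R * P * ?M * R" by (rule assoc_mult_mat[OF RPc M R, symmetric])
    also have "R * P * ?M = R * (P * ?M)" by (rule assoc_mult_mat[OF R P M])
    also have "\<dots> = R * ?M * ?C" unfolding cyclic_ext_commute[OF H] by (rule assoc_mult_mat[OF R M C, symmetric])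
    also have "\<dots> = ?C" unfolding RM using C by simp
    finally show ?thesis .
  qed
  have QG: "Q * ?G = ?G * ?C + vec_mat m r * ?l"
    unfolding r_def by (rule krylov_companion[OF J' Q e' T u QJ])
  have eq: "Q * A - A * P + a * b = 0\<^sub>m m n"
  proof -
    have GC: "?G * ?C \<in> carrier_mat m n" and rl: "vec_mat m r * ?l \<in> carrier_mat m n"
      using mult_carrier_mat[OF G C] mult_carrier_mat[OF rc l] by auto
    have "Q * A = (Q * ?G) * R" unfolding A_def by (rule assoc_mult_mat[OF Q G R, symmetric])
    also have "\<dots> = ?G * ?C * R + vec_mat m r * ?l * R" unfolding QG by (rule add_mult_distrib_mat[OF GC rl R])
    finally have 1: "Q * A = ?G * ?C * R + vec_mat m r * ?l * R" .
    have "A * P = ?G * (R * P)" unfolding A_def by (rule assoc_mult_mat[OF G R P])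
    also have "\<dots> = ?G * ?C * R" unfolding RP by (rule assoc_mult_mat[OF G C R, symmetric])
    finally have 2: "A * P = ?G * ?C * R" .
    have 3: "a * b = - (vec_mat m r * ?l * R)" unfolding a_def b_def
      using assoc_mult_mat[OF rc l R] uminus_mult_left_mat[of "vec_mat m r" "?l * R"] rc l R by auto
    have cancel: "U + V - U + - V = 0\<^sub>m m n" if "U \<in> carrier_mat m n" "V \<in> carrier_mat m n" for U V :: "complex mat"
      using that by (intro eq_matI) auto
    show ?thesis unfolding 1 2 3 by (rule cancel[OF mult_carrier_mat[OF GC R] mult_carrier_mat[OF rl R]])
  qed
  have obs: "W = {0\<^sub>v n}" if W: "lin_subspace n W" and inv: "invariant_under P W"
    and k: "W \<subseteq> mat_kernel A \<inter> mat_kernel b" for W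
  proof -
    have Wc: "W \<subseteq> carrier_vec n" and W0: "0\<^sub>v n \<in> W" using W unfolding lin_subspace_iff by auto
    have Rw: "R *\<^sub>v w \<in> carrier_vec (t + K)" if "w \<in> W" for w using that Wc R n by auto
    \<comment> \<open>Repeated multiplication by \<open>P\<close> moves every one of the last \<open>K\<close> coordinates into the last place,
      where \<open>b\<close> sees it.\<close>
    have co: "(R *\<^sub>v w) $ (t + K - 1 - j) = 0" if "j < K" "w \<in> W" for j w
      using that
    proof (induction j arbitrary: w)
      case 0
      have wc: "w \<in> carrier_vec n" using 0 Wc by auto
      have "b *\<^sub>v w = 0\<^sub>v 1" using k 0 mat_kernelD(2)[OF b] by auto
      hence "?l *\<^sub>v (R *\<^sub>v w) = 0\<^sub>v 1" unfolding b_def assoc_mult_mat_vec[OF l R wc] .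
      hence "vec 1 (\<lambda>_. if K = 0 then 0 else (R *\<^sub>v w) $ (t + K - 1)) = 0\<^sub>v 1"
        unfolding last_coord_mult[OF Rw[OF 0(2)]] .
      from arg_cong[OF this, of "\<lambda>x. x $ 0"] show ?case using 0(1) by (simp del: index_mult_mat_vec)
    next
      case (Suc j)
      have wc: "w \<in> carrier_vec n" using Suc Wc by auto
      have Pw: "P *\<^sub>v w \<in> W" using inv Suc unfolding invariant_under_def by auto
      let ?x = "R *\<^sub>v w" and ?i = "t + K - 1 - j"
      have i: "?i < t + K" "t < ?i" using Suc(2) by auto
      have "R *\<^sub>v (P *\<^sub>v w) = ?C *\<^sub>v ?x"
        using assoc_mult_mat_vec[OF R P wc] assoc_mult_mat_vec[OF C R wc] RP by simp
      hence "(?C *\<^sub>v ?x) $ ?i = 0" using Suc.IH[OF _ Pw] Suc(2) by simp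
      moreover have "row ?C ?i = unit_vec (t + K) (?i - 1)"
        using i unfolding companion_def column_mat_def zero_pad_def by (intro eq_vecI) (auto simp: unit_vec_def)
      moreover have "(?C *\<^sub>v ?x) $ ?i = row ?C ?i \<bullet> ?x" using i(1) by (intro index_mult_mat_vec) (simp add: companion_def column_mat_def)
      ultimately have "?x $ (?i - 1) = 0" using Rw[OF Suc(3)] i by simp
      moreover have "?i - 1 = t + K - 1 - Suc j" by simp
      ultimately show ?case by simp
    qed
    have "w = 0\<^sub>v n" if w: "w \<in> W" for w
    proof -
      have wc: "w \<in> carrier_vec n" using w Wc by auto
      define y where "y = vec t (\<lambda>i. (R *\<^sub>v w) $ i)"
      have y: "y \<in> carrier_vec t" unfolding y_def by simp
      have "(R *\<^sub>v w) $ i = 0" if "t \<le> i" "i < t + K" for i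
        using co[of "t + K - 1 - i" w] that w by auto
      hence Ry: "R *\<^sub>v w = zero_pad t K y"
        using Rw[OF w] R n unfolding zero_pad_def y_def by (intro eq_vecI) auto
      have "0\<^sub>v m = A *\<^sub>v w" using k w mat_kernelD(2)[OF A] by auto
      also have "\<dots> = ?G *\<^sub>v zero_pad t K y" unfolding A_def assoc_mult_mat_vec[OF G R wc] Ry ..
      also have "\<dots> = J' *\<^sub>v y" by (rule krylov_zero_pad[OF J' y])
      finally have "y = 0\<^sub>v t" using cyclic_ext_inj[OF H' y] by simp
      hence "R *\<^sub>v w = 0\<^sub>v n" unfolding Ry n zero_pad_def by (intro eq_vecI) auto
      hence "?M *\<^sub>v (R *\<^sub>v w) = 0\<^sub>v n" using mult_mat_zero_vec[OF M] by simp
      thus ?thesis using assoc_mult_mat_vec[OF M R wc] wc unfolding MR by simp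
    qed
    thus ?thesis using W0 by blast
  qed
  have gen': "W = carrier_vec m" if W: "lin_subspace m W" and inv: "invariant_under Q W"
    and k: "{A *\<^sub>v x + a *\<^sub>v y | x y. x \<in> carrier_vec n \<and> y \<in> carrier_vec 1} \<subseteq> W" for W
  proof (rule gen[OF W inv])
    have GW: "?G *\<^sub>v z \<in> W" if z: "z \<in> carrier_vec n" for z
    proof -
      have Mz: "?M *\<^sub>v z \<in> carrier_vec n" using M z by auto
      have "A *\<^sub>v (?M *\<^sub>v z) = ?G *\<^sub>v ((R * ?M) *\<^sub>v z)"
        unfolding A_def assoc_mult_mat_vec[OF G R Mz] assoc_mult_mat_vec[OF R M z] ..
      also have "\<dots> = ?G *\<^sub>v z" unfolding RM using z by simp
      finally have "?G *\<^sub>v z = A *\<^sub>v (?M *\<^sub>v z) + a *\<^sub>v 0\<^sub>v 1"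
        using mult_mat_zero_vec[OF a] mult_mat_vec_carrier[OF A Mz] by simp
      thus ?thesis using k Mz zero_carrier_vec[of 1] by blast
    qed
    show JW: "(\<lambda>x. J' *\<^sub>v x) ` carrier_vec t \<subseteq> W"
    proof
      fix y assume "y \<in> (\<lambda>x. J' *\<^sub>v x) ` carrier_vec t"
      then obtain x where x: "x \<in> carrier_vec t" "y = J' *\<^sub>v x" by auto
      have "zero_pad t K x \<in> carrier_vec n" unfolding n by simp
      from GW[OF this] show "y \<in> W" unfolding krylov_zero_pad[OF J' x(1)] x(2) .
    qed
    show "\<epsilon>' \<in> W"
    proof (cases "K = 0")
      case False
      hence t: "t < t + K" by simp
      have "?G *\<^sub>v unit_vec (t + K) t = Q ^\<^sub>m 0 *\<^sub>v \<epsilon>'" using krylov_unit[OF J' Q e' t] by simp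
      also have "\<dots> = \<epsilon>'" using Q e' by simp
      finally show ?thesis using GW[of "unit_vec (t + K) t"] n by simp
    next
      case True
      \<comment> \<open>Now \<open>b = 0\<close>, and \<open>\<epsilon>'\<close> is reached through \<open>a\<close>.\<close>
      let ?y = "vec 1 (\<lambda>_. -1) :: complex vec"
      have Ju: "J' *\<^sub>v u \<in> carrier_vec m" using J' u by auto
      have y: "?y \<in> carrier_vec 1" by simp
      have "a *\<^sub>v ?y = r"
      proof -
        have "a *\<^sub>v ?y = - (vec_mat m r *\<^sub>v ?y)" unfolding a_def by (intro eq_vecI) (auto simp: vec_mat_def column_mat_def)
        also have "\<dots> = r" unfolding vec_mat_mult[OF r y] using r by (intro eq_vecI) auto
        finally show ?thesis .
      qed
      hence "A *\<^sub>v 0\<^sub>v n + a *\<^sub>v ?y = r" using mult_mat_zero_vec[OF A] r by simp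
      hence "r \<in> W" using k y zero_carrier_vec[of n] by blast
      moreover have "J' *\<^sub>v u \<in> W" using JW u by blast
      ultimately have "r + J' *\<^sub>v u \<in> W" using W unfolding lin_subspace_iff by blast
      moreover have "r + J' *\<^sub>v u = \<epsilon>'" 
      proof -
        have "x - y + y = x" if "x \<in> carrier_vec m" "y \<in> carrier_vec m" for x y :: "complex vec"
          using that by (intro eq_vecI) auto
        from this[OF e' Ju] show ?thesis unfolding r_def True using Q e' by simp
      qed
      ultimately show ?thesis by simp
    qed
  qed
  have "XData A P Q a b \<in> xpoint_space n m"
    unfolding xpoint_space_iff
    by (intro conjI allI impI eq A P Q a b; (elim conjE)?; (rule obs gen'; assumption)?)
  thus ?thesis by blast
qed

lemma cyclic_ext_exists:
  assumes t: "is_partition t \<tau>" and p: "is_partition n p"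
    and le: "\<And>i. \<tau> i \<le> p i" "\<And>i. p (Suc i) \<le> \<tau> i"
  obtains K J \<epsilon> u where "cyclic_ext t K (shift_mat \<tau> t) n (shift_mat p n) J \<epsilon> u"
proof -
  define k where "k i = p i - \<tau> i" for i
  have k: "\<tau> i + k i = p i" for i unfolding k_def using le(1)[of i] by simp
  obtain M where M: "\<And>i. i \<ge> M \<Longrightarrow> p i = 0" "(\<Sum>i<M. p i) = n" using p unfolding is_partition_def by auto
  obtain L where L: "\<And>i. i \<ge> L \<Longrightarrow> \<tau> i = 0" "(\<Sum>i<L. \<tau> i) = t" using t unfolding is_partition_def by auto
  have "\<tau> i = 0" if "i \<ge> M" for i using M(1)[OF that] le(1)[of i] by simp
  hence tM: "(\<Sum>i<M. \<tau> i) = t" using sum_support_eq[of M \<tau> L] L by simp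
  define K where "K = (\<Sum>i<M. k i)"
  have n: "n = t + K" unfolding K_def M(2)[symmetric] tM[symmetric] sum.distrib[symmetric] k ..
  let ?T = "shift_mat \<tau> t" and ?B = "shift_mat p n"
  \<comment> \<open>Generator \<open>i\<close> of the smaller module goes to \<open>x ^ k i\<close> times generator \<open>i\<close> minus generator \<open>i + 1\<close>: modulo
    the image, each generator is a multiple of the preceding one, so the quotient is generated by the
    first. The order of the image is right because of the interlacing condition.\<close>
  define F where "F = (\<lambda>(i, s). box_vec p n (i, s + k i) - box_vec p n (Suc i, s))"
  define J where "J = box_mat \<tau> t n F"
  define \<epsilon> where "\<epsilon> = box_vec p n (0, 0)"
  have J: "J \<in> carrier_mat n t" unfolding J_def by simp
  have Fc: "F x \<in> carrier_vec n" for x unfolding F_def by (cases x) simp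
  have Je: "J *\<^sub>v box_vec \<tau> t (i, s) = box_vec p n (i, s + k i) - box_vec p n (Suc i, s)" for i s
  proof (cases "s < \<tau> i")
    case True
    hence x: "(i, s) \<in> boxes \<tau>" unfolding boxes_def by simp
    show ?thesis unfolding J_def box_mat_box_vec[OF t x Fc] by (simp add: F_def)
  next
    case False
    hence s: "\<tau> i \<le> s" by simp
    have "p i \<le> s + k i" using s k[of i] by simp
    moreover have "p (Suc i) \<le> s" using s le(2)[of i] by simp
    ultimately show ?thesis unfolding J_def box_mat_outside[of \<tau> i s, OF s] by (simp add: box_vec_outside)
  qed
  have BJ: "?B * J = J * ?T"
  proof (rule mat_eq_box_vecI[OF t mult_carrier_mat[OF shift_mat_carrier J] mult_carrier_mat[OF J shift_mat_carrier]])
    fix i s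
    have "(?B * J) *\<^sub>v box_vec \<tau> t (i, s) = ?B *\<^sub>v (box_vec p n (i, s + k i) - box_vec p n (Suc i, s))"
      unfolding assoc_mult_mat_vec[OF shift_mat_carrier J box_vec_carrier] Je ..
    also have "\<dots> = box_vec p n (i, Suc s + k i) - box_vec p n (Suc i, Suc s)"
      unfolding mult_minus_distrib_mat_vec[OF shift_mat_carrier box_vec_carrier box_vec_carrier] shift_mat_box_vec[OF p] by simp
    also have "\<dots> = (J * ?T) *\<^sub>v box_vec \<tau> t (i, s)"
      unfolding assoc_mult_mat_vec[OF J shift_mat_carrier box_vec_carrier] shift_mat_box_vec[OF t] Je ..
    finally show "(?B * J) *\<^sub>v box_vec \<tau> t (i, s) = (J * ?T) *\<^sub>v box_vec \<tau> t (i, s)" .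
  qed
  let ?R = "(\<lambda>x. J *\<^sub>v x) ` carrier_vec t"
  have R: "lin_subspace n ?R" by (rule lin_subspace_image[OF J lin_subspace_carrier])
  have JR: "J *\<^sub>v box_vec \<tau> t x \<in> ?R" for x by (rule imageI) simp
  have powR: "?B ^\<^sub>m j *\<^sub>v y \<in> ?R" if y: "y \<in> ?R" for j y
  proof -
    obtain x where x: "x \<in> carrier_vec t" "y = J *\<^sub>v x" using y by auto
    have "?B ^\<^sub>m j *\<^sub>v y = (?B ^\<^sub>m j * J) *\<^sub>v x"
      unfolding x(2) by (rule assoc_mult_mat_vec[OF pow_carrier_mat[OF shift_mat_carrier] J x(1), symmetric])
    also have "\<dots> = J *\<^sub>v (?T ^\<^sub>m j *\<^sub>v x)"
      unfolding intertwine_pow[OF J shift_mat_carrier shift_mat_carrier BJ[symmetric], symmetric]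
      by (rule assoc_mult_mat_vec[OF J pow_carrier_mat[OF shift_mat_carrier] x(1)])
    finally show ?thesis using mult_mat_vec_carrier[OF pow_carrier_mat[OF shift_mat_carrier] x(1)] by blast
  qed
  have chain: "?B ^\<^sub>m (\<Sum>l<i. k l) *\<^sub>v \<epsilon> - box_vec p n (i, 0) \<in> ?R" for i
  proof (induction i)
    case 0
    have "?B ^\<^sub>m (\<Sum>l<0. k l) *\<^sub>v \<epsilon> - box_vec p n (0, 0) = 0\<^sub>v n"
      unfolding \<epsilon>_def shift_mat_pow_box_vec[OF p] by (simp add: minus_cancel_vec[OF box_vec_carrier])
    thus ?case using R unfolding lin_subspace_iff by auto
  next
    case (Suc i)
    let ?a = "?B ^\<^sub>m (\<Sum>l<i. k l) *\<^sub>v \<epsilon>" and ?b = "box_vec p n (i, 0)" and ?c = "box_vec p n (Suc i, 0)"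
    have a: "?a \<in> carrier_vec n" and ec: "\<epsilon> \<in> carrier_vec n"
      unfolding \<epsilon>_def using mult_mat_vec_carrier[OF pow_carrier_mat[OF shift_mat_carrier] box_vec_carrier] by auto
    have "?B ^\<^sub>m k i *\<^sub>v (?a - ?b) \<in> ?R" by (rule powR[OF Suc])
    hence 1: "?B ^\<^sub>m (\<Sum>l<Suc i. k l) *\<^sub>v \<epsilon> - box_vec p n (i, k i) \<in> ?R"
      unfolding mult_minus_distrib_mat_vec[OF pow_carrier_mat[OF shift_mat_carrier] a box_vec_carrier]
        pow_mat_add_vec[OF shift_mat_carrier ec, symmetric] shift_mat_pow_box_vec[OF p] by (simp add: add.commute)
    have 2: "box_vec p n (i, k i) - ?c \<in> ?R" using JR[of "(i, 0)"] unfolding Je by simp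
    have "(?B ^\<^sub>m (\<Sum>l<Suc i. k l) *\<^sub>v \<epsilon> - box_vec p n (i, k i)) + (box_vec p n (i, k i) - ?c) \<in> ?R"
      using 1 2 R unfolding lin_subspace_iff by blast
    moreover have "(?B ^\<^sub>m (\<Sum>l<Suc i. k l) *\<^sub>v \<epsilon> - box_vec p n (i, k i)) + (box_vec p n (i, k i) - ?c)
        = ?B ^\<^sub>m (\<Sum>l<Suc i. k l) *\<^sub>v \<epsilon> - ?c"
    proof -
      have "(x - y) + (y - z) = x - z"
        if "x \<in> carrier_vec n" "y \<in> carrier_vec n" "z \<in> carrier_vec n" for x y z :: "complex vec"
        using that by (intro eq_vecI) auto
      thus ?thesis using mult_mat_vec_carrier[OF pow_carrier_mat[OF shift_mat_carrier] ec] box_vec_carrier by metis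
    qed
    ultimately show ?case by simp
  qed
  have "?B ^\<^sub>m K *\<^sub>v \<epsilon> \<in> ?R"
  proof -
    have z: "box_vec p n (M, 0) = 0\<^sub>v n" using M(1)[of M] by (intro box_vec_outside) simp
    have "?B ^\<^sub>m K *\<^sub>v \<epsilon> - 0\<^sub>v n = ?B ^\<^sub>m K *\<^sub>v \<epsilon>"
      using mult_mat_vec_carrier[OF pow_carrier_mat[OF shift_mat_carrier[of p n]], of \<epsilon> K] unfolding \<epsilon>_def by auto
    thus ?thesis using chain[of M] unfolding z K_def[symmetric] by simp
  qed
  then obtain u where u: "u \<in> carrier_vec t" "?B ^\<^sub>m K *\<^sub>v \<epsilon> = J *\<^sub>v u" by auto
  have gen: "W = carrier_vec n" if W: "lin_subspace n W" and inv: "invariant_under ?B W" and JW: "?R \<subseteq> W" and eW: "\<epsilon> \<in> W" for W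
  proof -
    have "box_vec p n (i, s) \<in> W" for i s
    proof (induction i arbitrary: s)
      case 0
      show ?case
      proof (induction s)
        case 0 show ?case using eW unfolding \<epsilon>_def .
      next
        case (Suc s)
        thus ?case using inv shift_mat_box_vec[OF p, of 0 s] unfolding invariant_under_def by metis
      qed
    next
      case (Suc i)
      have "box_vec p n (Suc i, s) = box_vec p n (i, s + k i) - J *\<^sub>v box_vec \<tau> t (i, s)"
      proof -
        have "y = x - (x - y)" if "x \<in> carrier_vec n" "y \<in> carrier_vec n" for x y :: "complex vec"
          using that by (intro eq_vecI) auto
        from this[OF box_vec_carrier box_vec_carrier] show ?thesis unfolding Je .
      qed
      thus ?case using lin_subspace_minus[OF W Suc.IH[of "s + k i"] subsetD[OF JW JR[of "(i, s)"]]] by (simp only:)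
    qed
    hence "\<And>c. c < n \<Longrightarrow> unit_vec n c \<in> W" by (metis unit_vec_box_vec[OF p] surj_pair)
    thus ?thesis by (rule lin_subspace_eq_carrierI[OF W])
  qed
  have "cyclic_ext t K ?T n ?B J \<epsilon> u"
    unfolding cyclic_ext_def
    by (intro conjI allI impI n shift_mat_carrier J u BJ; (elim conjE)?; (rule gen; assumption)?) (simp add: \<epsilon>_def)
  thus ?thesis by (rule that)
qed

lemma xpoint_exists:
  assumes p: "is_partition n p" and q: "is_partition m q"
    and pq: "\<And>i. p (Suc i) \<le> q i" "\<And>i. q (Suc i) \<le> p i"
  shows "\<exists>A a b. XData A (shift_mat p n) (shift_mat q m) a b \<in> xpoint_space n m"
proof -
  \<comment> \<open>The largest partition that interlaces with both.\<close>
  define \<tau> where "\<tau> i = min (p i) (q i)" for i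
  obtain M where M: "\<And>i. i \<ge> M \<Longrightarrow> p i = 0" using p unfolding is_partition_def by auto
  have pp: "p (Suc i) \<le> p i" "q (Suc i) \<le> q i" for i using p q unfolding is_partition_def by auto
  have t: "is_partition (\<Sum>i<M. \<tau> i) \<tau>"
    unfolding is_partition_def
  proof (intro conjI allI exI[of _ M] impI)
    show "\<tau> (Suc i) \<le> \<tau> i" for i unfolding \<tau>_def using pp[of i] by auto
    show "M \<le> i \<Longrightarrow> \<tau> i = 0" for i unfolding \<tau>_def using M[of i] by simp
  qed simp
  have 1: "\<tau> i \<le> p i" "\<tau> i \<le> q i" "p (Suc i) \<le> \<tau> i" "q (Suc i) \<le> \<tau> i" for i
    unfolding \<tau>_def using pp[of i] pq[of i] by auto
  obtain K J \<epsilon> u where H: "cyclic_ext (\<Sum>i<M. \<tau> i) K (shift_mat \<tau> (\<Sum>i<M. \<tau> i)) n (shift_mat p n) J \<epsilon> u"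
    by (rule cyclic_ext_exists[OF t p 1(1,3)])
  obtain K' J' \<epsilon>' u' where H': "cyclic_ext (\<Sum>i<M. \<tau> i) K' (shift_mat \<tau> (\<Sum>i<M. \<tau> i)) m (shift_mat q m) J' \<epsilon>' u'"
    by (rule cyclic_ext_exists[OF t q 1(2,4)])
  show ?thesis by (rule xpoint_of_cyclic_ext[OF H H'])
qed

section \<open>The criterion is sufficient\<close>

lemma admissible_imp_fibre:
  assumes ad: "admissible B v p"
  shows "moment_fibre B v (\<lambda>_. 0) \<noteq> {}"
proof -
  have P: "is_partition (v \<zeta>) (p \<zeta>)" if "\<zeta> < length B" for \<zeta>
    using ad that unfolding admissible_def is_partition_def by blast
  have "\<exists>d. d \<in> elem_space B v e \<and> moment_from_before d = - shift_mat (p e) (v e) \<and>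
      moment_from_after d = shift_mat (p (seg_before B e)) (v (seg_before B e))" if e: "e < length B" for e
  proof -
    note b = P[OF seg_before_less[OF e]] and a = P[OF e]
    note R = ad[unfolded admissible_def, THEN conjunct2, rule_format, OF e]
    show ?thesis
    proof (cases "B ! e")
      case Arrow
      then obtain C D where CD: "C \<in> carrier_mat (v e) (v (seg_before B e))" "D \<in> carrier_mat (v (seg_before B e)) (v e)"
        "D * C = shift_mat (p (seg_before B e)) (v (seg_before B e))" "C * D = shift_mat (p e) (v e)"
        using arrow_exists[OF b a] R unfolding seg_after_def by auto
      have "ArrowData (- C) D \<in> elem_space B v e"
        using Arrow CD(1,2) unfolding elem_space_def arrow_space_def seg_after_def by auto
      moreover have "moment_from_before (ArrowData (- C) D) = - shift_mat (p e) (v e)"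
        "moment_from_after (ArrowData (- C) D) = shift_mat (p (seg_before B e)) (v (seg_before B e))"
        using CD by (auto simp flip: CD(3,4))
      ultimately show ?thesis by blast
    next
      case XPoint
      then obtain A x y where x: "XData A (shift_mat (p (seg_before B e)) (v (seg_before B e))) (shift_mat (p e) (v e)) x y
          \<in> xpoint_space (v (seg_before B e)) (v e)"
        using xpoint_exists[OF b a] R unfolding seg_after_def by auto
      have "XData A (shift_mat (p (seg_before B e)) (v (seg_before B e))) (shift_mat (p e) (v e)) x y \<in> elem_space B v e"
        using x XPoint unfolding elem_space_def seg_after_def by simp
      thus ?thesis by (metis moment_from_after.simps(2) moment_from_before.simps(2))
    qed
  qed
  then obtain d where d: "\<And>e. e < length B \<Longrightarrow> d e \<in> elem_space B v e \<and> moment_from_before (d e) = - shift_mat (p e) (v e) \<and>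
      moment_from_after (d e) = shift_mat (p (seg_before B e)) (v (seg_before B e))" by metis
  let ?m = "map d [0..<length B]"
  have "?m \<in> moment_fibre B v (\<lambda>_. 0)"
    unfolding moment_fibre_def rep_space_def mem_Collect_eq
  proof (intro conjI allI impI)
    show "length ?m = length B" by simp
    show "?m ! i \<in> elem_space B v i" if "i < length B" for i using d[OF that] that by simp
    fix \<zeta> assume z: "\<zeta> < length B"
    have e: "elem_after B \<zeta> < length B" by (rule elem_after_less[OF z])
    have "moment_map B ?m \<zeta> = - shift_mat (p \<zeta>) (v \<zeta>) + shift_mat (p \<zeta>) (v \<zeta>)"
      unfolding moment_map_def elem_before_def using d[OF z] d[OF e] z e seg_before_elem_after[OF z] by simp
    also have "\<dots> = 0\<^sub>m (v \<zeta>) (v \<zeta>)" by (rule uminus_l_inv_mat[OF shift_mat_carrier])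
    also have "\<dots> = deformation B v (\<lambda>_. 0) \<zeta>" unfolding deformation_def by (auto intro!: eq_matI)
    finally show "moment_map B ?m \<zeta> = deformation B v (\<lambda>_. 0) \<zeta>" .
  qed
  thus ?thesis by blast
qed

section \<open>Base change\<close>

lemma mat_inverse_invertible:
  fixes G :: "complex mat"
  assumes G: "G \<in> carrier_mat n n" and i: "invertible_mat G"
  shows "the (mat_inverse G) \<in> carrier_mat n n" "G * the (mat_inverse G) = 1\<^sub>m n" "the (mat_inverse G) * G = 1\<^sub>m n"
proof -
  obtain K where K: "G * K = 1\<^sub>m (dim_row G)" "K * G = 1\<^sub>m (dim_row K)"
    using i unfolding invertible_mat_def inverts_mat_def by auto
  have c: "dim_col K = n" using arg_cong[OF K(1), of dim_col] G by simp
  have r: "dim_row K = n" using arg_cong[OF K(2), of dim_col] G by simp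
  have Kc: "K \<in> carrier_mat n n" using r c by auto
  have "G \<in> Units (ring_mat TYPE(complex) n undefined)"
    unfolding Units_def ring_mat_def using G K Kc by (auto simp: r)
  then obtain G' where "mat_inverse G = Some G'" using mat_inverse(1)[OF G] by fastforce
  with mat_inverse(2)[OF G this]
  show "the (mat_inverse G) \<in> carrier_mat n n" "G * the (mat_inverse G) = 1\<^sub>m n" "the (mat_inverse G) * G = 1\<^sub>m n"
    by auto
qed

lemma conj_mult:
  fixes U V :: "complex mat"
  assumes "H \<in> carrier_mat a a" "U \<in> carrier_mat a b" "G' \<in> carrier_mat b b" "G \<in> carrier_mat b b"
    "V \<in> carrier_mat b c" "K \<in> carrier_mat c c" "G' * G = 1\<^sub>m b"
  shows "(H * U * G') * (G * V * K) = H * (U * V) * K"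
proof -
  have HU: "H * U \<in> carrier_mat a b" and GV: "G * V \<in> carrier_mat b c" and VK: "V * K \<in> carrier_mat b c"
    using assms by auto
  have "(H * U * G') * (G * V * K) = H * U * (G' * (G * V * K))"
    by (rule assoc_mult_mat[OF HU assms(3)]) (use assms in auto)
  also have "G' * (G * V * K) = (G' * G) * (V * K)"
    using assoc_mult_mat[OF assms(4,5,6)] assoc_mult_mat[OF assms(3,4) VK] by simp
  also have "\<dots> = V * K" unfolding assms(7) by (rule left_mult_one_mat[OF VK])
  also have "H * U * (V * K) = H * U * V * K" by (rule assoc_mult_mat[OF HU assms(5,6), symmetric])
  also have "H * U * V = H * (U * V)" by (rule assoc_mult_mat[OF assms(1,2,5)])
  finally show ?thesis .
qed

lemma invariant_under_image:
  assumes G: "G \<in> carrier_mat n n" and G': "G' \<in> carrier_mat n n" and GG: "G' * G = 1\<^sub>m n"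
    and X: "X \<in> carrier_mat n n" and W: "W \<subseteq> carrier_vec n" and inv: "invariant_under (G * X * G') W"
  shows "invariant_under X ((\<lambda>x. G' *\<^sub>v x) ` W)"
  unfolding invariant_under_def
proof
  fix y assume "y \<in> (\<lambda>x. G' *\<^sub>v x) ` W"
  then obtain w where w: "w \<in> W" "y = G' *\<^sub>v w" by auto
  have wc: "w \<in> carrier_vec n" using w W by auto
  have "G' * (G * X * G') = X * G'"
  proof -
    have "G' * (G * X * G') = (G' * G) * (X * G')"
      using assoc_mult_mat[OF G X G'] assoc_mult_mat[OF G' G, of "X * G'" n] X G' by simp
    thus ?thesis unfolding GG using X G' by simp
  qed
  hence "X *\<^sub>v y = G' *\<^sub>v ((G * X * G') *\<^sub>v w)"
    unfolding w(2) using assoc_mult_mat_vec[OF X G' wc]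
      assoc_mult_mat_vec[OF G' mult_carrier_mat[OF mult_carrier_mat[OF G X] G'] wc] by simp
  moreover have "(G * X * G') *\<^sub>v w \<in> W" using inv w unfolding invariant_under_def by auto
  ultimately show "X *\<^sub>v y \<in> (\<lambda>x. G' *\<^sub>v x) ` W" by auto
qed

lemma xpoint_space_conj:
  assumes x: "XData A Bm Bp a b \<in> xpoint_space n m"
    and G: "G \<in> carrier_mat n n" "G' \<in> carrier_mat n n" "G * G' = 1\<^sub>m n" "G' * G = 1\<^sub>m n"
    and H: "H \<in> carrier_mat m m" "H' \<in> carrier_mat m m" "H * H' = 1\<^sub>m m" "H' * H = 1\<^sub>m m"
  shows "XData (H * A * G') (G * Bm * G') (H * Bp * H') (H * a) (b * G') \<in> xpoint_space n m"
proof -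
  note D = xpoint_spaceD[OF x]
  note A = D(1) and P = D(2) and Q = D(3) and a = D(4) and b = D(5) and eq = D(6) and obs = D(7) and gen = D(8)
  have HA: "H * A \<in> carrier_mat m n" and Ha: "H * a \<in> carrier_mat m 1" using H A a by auto
  have e1: "(H * Bp * H') * (H * A * G') = H * (Bp * A) * G'"
    by (rule conj_mult[OF H(1) Q H(2,1) A G(2) H(4)])
  have e2: "(H * A * G') * (G * Bm * G') = H * (A * Bm) * G'"
    by (rule conj_mult[OF H(1) A G(2,1) P G(2) G(4)])
  have e3: "(H * a) * (b * G') = H * (a * b) * G'"
    using assoc_mult_mat[OF Ha b G(2)] assoc_mult_mat[OF H(1) a b] by simp
  have QA: "Bp * A \<in> carrier_mat m n" and AP: "A * Bm \<in> carrier_mat m n" and ab: "a * b \<in> carrier_mat m n"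
    using A P Q a b by auto
  have "(H * Bp * H') * (H * A * G') - (H * A * G') * (G * Bm * G') + (H * a) * (b * G')
      = H * (Bp * A - A * Bm + a * b) * G'"
  proof -
    have d: "Bp * A - A * Bm \<in> carrier_mat m n" using AP by (rule minus_carrier_mat)
    have h: "H * (Bp * A) \<in> carrier_mat m n" "H * (A * Bm) \<in> carrier_mat m n" "H * (a * b) \<in> carrier_mat m n"
      using H QA AP ab by auto
    have hd: "H * (Bp * A) - H * (A * Bm) \<in> carrier_mat m n" using h(2) by (rule minus_carrier_mat)
    have "H * (Bp * A - A * Bm + a * b) = H * (Bp * A) - H * (A * Bm) + H * (a * b)"
      unfolding mult_add_distrib_mat[OF H(1) d ab] mult_minus_distrib_mat[OF H(1) QA AP] ..
    thus ?thesis unfolding e1 e2 e3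
      using add_mult_distrib_mat[OF hd h(3) G(2)] minus_mult_distrib_mat[OF h(1,2) G(2)] by simp
  qed
  also have "\<dots> = 0\<^sub>m m n" unfolding eq using H G by simp
  finally have eq': "(H * Bp * H') * (H * A * G') - (H * A * G') * (G * Bm * G') + (H * a) * (b * G') = 0\<^sub>m m n" .
  have obs': "W = {0\<^sub>v n}" if W: "lin_subspace n W" and inv: "invariant_under (G * Bm * G') W"
    and k: "W \<subseteq> mat_kernel (H * A * G') \<inter> mat_kernel (b * G')" for W
  proof -
    have Wc: "W \<subseteq> carrier_vec n" and W0: "0\<^sub>v n \<in> W" using W unfolding lin_subspace_iff by auto
    let ?U = "(\<lambda>x. G' *\<^sub>v x) ` W"
    have "?U \<subseteq> mat_kernel A \<inter> mat_kernel b"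
    proof
      fix u assume "u \<in> ?U"
      then obtain w where w: "w \<in> W" "u = G' *\<^sub>v w" by auto
      have wc: "w \<in> carrier_vec n" using w Wc by auto
      have uc: "u \<in> carrier_vec n" using w(2) wc G by auto
      have HAG: "H * A * G' \<in> carrier_mat m n" and bG: "b * G' \<in> carrier_mat 1 n" using HA b G by auto
      have "(H * A * G') *\<^sub>v w = 0\<^sub>v m" "(b * G') *\<^sub>v w = 0\<^sub>v 1"
        using k w(1) mat_kernelD(2)[OF HAG] mat_kernelD(2)[OF bG] by auto
      hence z: "H *\<^sub>v (A *\<^sub>v u) = 0\<^sub>v m" "b *\<^sub>v u = 0\<^sub>v 1"
        unfolding w(2) using assoc_mult_mat_vec[OF HA G(2) wc] assoc_mult_mat_vec[OF b G(2) wc]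
          assoc_mult_mat_vec[OF H(1) A, of "G' *\<^sub>v w"] G wc by auto
      have "A *\<^sub>v u = (H' * H) *\<^sub>v (A *\<^sub>v u)" unfolding H(4) using A uc by simp
      also have "\<dots> = H' *\<^sub>v (H *\<^sub>v (A *\<^sub>v u))" by (rule assoc_mult_mat_vec[OF H(2,1)]) (use A uc in auto)
      also have "\<dots> = 0\<^sub>v m" unfolding z(1) by (rule mult_mat_zero_vec[OF H(2)])
      finally show "u \<in> mat_kernel A \<inter> mat_kernel b"
        using z(2) uc unfolding mat_kernel[OF A] mat_kernel[OF b] by auto
    qed
    from obs[OF lin_subspace_image[OF G(2) W] invariant_under_image[OF G(1,2,4) P Wc inv] this]
    have U0: "?U = {0\<^sub>v n}" .
    have "w = 0\<^sub>v n" if w: "w \<in> W" for w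
    proof -
      have wc: "w \<in> carrier_vec n" using w Wc by auto
      have "w = (G * G') *\<^sub>v w" unfolding G(3) using wc by simp
      also have "\<dots> = G *\<^sub>v (G' *\<^sub>v w)" by (rule assoc_mult_mat_vec[OF G(1,2) wc])
      also have "G' *\<^sub>v w = 0\<^sub>v n" using U0 w by blast
      also have "G *\<^sub>v 0\<^sub>v n = 0\<^sub>v n" by (rule mult_mat_zero_vec[OF G(1)])
      finally show ?thesis .
    qed
    thus ?thesis using W0 by blast
  qed
  have gen': "W = carrier_vec m" if W: "lin_subspace m W" and inv: "invariant_under (H * Bp * H') W"
    and k: "{(H * A * G') *\<^sub>v x + (H * a) *\<^sub>v y | x y. x \<in> carrier_vec n \<and> y \<in> carrier_vec 1} \<subseteq> W" for W
  proof -
    have Wc: "W \<subseteq> carrier_vec m" using W unfolding lin_subspace_iff by auto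
    let ?U = "(\<lambda>x. H' *\<^sub>v x) ` W"
    have "{A *\<^sub>v x + a *\<^sub>v y | x y. x \<in> carrier_vec n \<and> y \<in> carrier_vec 1} \<subseteq> ?U"
    proof
      fix z assume "z \<in> {A *\<^sub>v x + a *\<^sub>v y | x y. x \<in> carrier_vec n \<and> y \<in> carrier_vec 1}"
      then obtain x y where z: "z = A *\<^sub>v x + a *\<^sub>v y" and x: "x \<in> carrier_vec n" and y: "y \<in> carrier_vec 1" by auto
      have Ax: "A *\<^sub>v x \<in> carrier_vec m" and ay: "a *\<^sub>v y \<in> carrier_vec m" and Gx: "G *\<^sub>v x \<in> carrier_vec n"
        using A a G x y by auto
      have zc: "z \<in> carrier_vec m" unfolding z using Ax ay by auto
      have "(H * A * G') *\<^sub>v (G *\<^sub>v x) = H *\<^sub>v (A *\<^sub>v ((G' * G) *\<^sub>v x))"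
        using assoc_mult_mat_vec[OF HA G(2) Gx] assoc_mult_mat_vec[OF G(2,1) x]
          assoc_mult_mat_vec[OF H(1) A, of "G' *\<^sub>v (G *\<^sub>v x)"] G Gx by auto
      also have "(G' * G) *\<^sub>v x = x" unfolding G(4) using x by simp
      finally have "(H * A * G') *\<^sub>v (G *\<^sub>v x) + (H * a) *\<^sub>v y = H *\<^sub>v z"
        unfolding z mult_add_distrib_mat_vec[OF H(1) Ax ay] assoc_mult_mat_vec[OF H(1) a y] by simp
      moreover have "(H * A * G') *\<^sub>v (G *\<^sub>v x) + (H * a) *\<^sub>v y \<in> W" using k Gx y by blast
      ultimately have "H *\<^sub>v z \<in> W" by simp
      moreover have "z = H' *\<^sub>v (H *\<^sub>v z)"
        using assoc_mult_mat_vec[OF H(2,1) zc] zc unfolding H(4) by simp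
      ultimately show "z \<in> ?U" by blast
    qed
    from gen[OF lin_subspace_image[OF H(2) W] invariant_under_image[OF H(1,2,4) Q Wc inv] this]
    have U: "?U = carrier_vec m" .
    have "w \<in> W" if w: "w \<in> carrier_vec m" for w
    proof -
      have "H' *\<^sub>v w \<in> ?U" unfolding U using H w by auto
      then obtain u where u: "u \<in> W" "H' *\<^sub>v w = H' *\<^sub>v u" by auto
      have uc: "u \<in> carrier_vec m" using u Wc by auto
      have "w = H *\<^sub>v (H' *\<^sub>v w)" using assoc_mult_mat_vec[OF H(1,2) w] w unfolding H(3) by simp
      also have "\<dots> = u" unfolding u(2) using assoc_mult_mat_vec[OF H(1,2) uc] uc unfolding H(3) by simp
      finally show ?thesis using u by simp
    qed
    thus ?thesis using Wc by auto
  qed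
  show ?thesis unfolding xpoint_space_iff
    by (intro conjI allI impI eq'; (elim conjE)?; (rule obs' gen'; assumption)?) (use A P Q a b G H in auto)
qed

lemma gauge_act_elem_space:
  assumes g: "g \<in> gauge_group B v" and m: "m \<in> rep_space B v" and e: "e < length B"
  shows "elem_act (g ! seg_before B e) (g ! seg_after B e) (m ! e) \<in> elem_space B v e"
proof -
  let ?G = "g ! seg_before B e" and ?H = "g ! seg_after B e"
  let ?G' = "the (mat_inverse ?G)" and ?H' = "the (mat_inverse ?H)"
  let ?n = "v (seg_before B e)" and ?m = "v (seg_after B e)"
  have e': "seg_after B e < length B" using e unfolding seg_after_def .
  have Gc: "?G \<in> carrier_mat ?n ?n" "invertible_mat ?G" and Hc: "?H \<in> carrier_mat ?m ?m" "invertible_mat ?H"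
    using g seg_before_less[OF e] e' unfolding gauge_group_def by auto
  note G = mat_inverse_invertible[OF Gc] and H = mat_inverse_invertible[OF Hc]
  have me: "m ! e \<in> elem_space B v e" using m e unfolding rep_space_def by auto
  show ?thesis
  proof (cases "B ! e")
    case Arrow
    then obtain C D where "m ! e = ArrowData C D" "C \<in> carrier_mat ?m ?n" "D \<in> carrier_mat ?n ?m"
      using me unfolding elem_space_def arrow_space_def by auto
    thus ?thesis using Arrow Gc Hc G H unfolding elem_space_def arrow_space_def by auto
  next
    case XPoint
    hence x: "m ! e \<in> xpoint_space ?n ?m" using me unfolding elem_space_def by simp
    then obtain A Bm Bp a b where d: "m ! e = XData A Bm Bp a b" by (rule xpoint_spaceE)
    note d = d x[unfolded d]
    show ?thesis unfolding elem_space_def XPoint d(1)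
      using xpoint_space_conj[OF d(2) Gc(1) G Hc(1) H] by simp
  qed
qed

lemma moment_from_elem_act:
  assumes d: "d \<in> arrow_space n m \<or> d \<in> xpoint_space n m"
    and g: "g \<in> carrier_mat n n" "invertible_mat g" and h: "h \<in> carrier_mat m m" "invertible_mat h"
  shows "moment_from_before (elem_act g h d) = h * moment_from_before d * the (mat_inverse h)"
    and "moment_from_after (elem_act g h d) = g * moment_from_after d * the (mat_inverse g)"
proof -
  note G = mat_inverse_invertible[OF g] and H = mat_inverse_invertible[OF h]
  have "moment_from_before (elem_act g h d) = h * moment_from_before d * the (mat_inverse h) \<and>
    moment_from_after (elem_act g h d) = g * moment_from_after d * the (mat_inverse g)"
    using d
  proof
    assume "d \<in> arrow_space n m"
    then obtain C D where d: "d = ArrowData C D" and C: "C \<in> carrier_mat m n" and D: "D \<in> carrier_mat n m"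
      unfolding arrow_space_def by auto
    have "h * (C * D) * the (mat_inverse h) = (h * C * the (mat_inverse g)) * (g * D * the (mat_inverse h))"
      by (rule conj_mult[OF h(1) C G(1) g(1) D H(1) G(3), symmetric])
    moreover have "g * (D * C) * the (mat_inverse g) = (g * D * the (mat_inverse h)) * (h * C * the (mat_inverse g))"
      by (rule conj_mult[OF g(1) D H(1) h(1) C G(1) H(3), symmetric])
    ultimately show ?thesis unfolding d using g h G H C D by simp
  next
    assume "d \<in> xpoint_space n m"
    then obtain A Bm Bp a b where d: "d = XData A Bm Bp a b" and Bm: "Bm \<in> carrier_mat n n" and Bp: "Bp \<in> carrier_mat m m"
      by (rule xpoint_spaceE)
    show ?thesis unfolding d using g h G H Bm Bp by simp
  qed
  thus "moment_from_before (elem_act g h d) = h * moment_from_before d * the (mat_inverse h)"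
    "moment_from_after (elem_act g h d) = g * moment_from_after d * the (mat_inverse g)" by auto
qed

lemma gauge_act_fibre:
  assumes g: "g \<in> gauge_group B v" and m: "m \<in> moment_fibre B v (\<lambda>_. 0)"
  shows "gauge_act B g m \<in> moment_fibre B v (\<lambda>_. 0)"
proof -
  have mr: "m \<in> rep_space B v" and mom: "\<And>\<zeta>. \<zeta> < length B \<Longrightarrow> moment_map B m \<zeta> = deformation B v (\<lambda>_. 0) \<zeta>"
    using m unfolding moment_fibre_def by auto
  have zero: "deformation B v (\<lambda>_. 0) \<zeta> = 0\<^sub>m (v \<zeta>) (v \<zeta>)" for \<zeta>
    unfolding deformation_def by (auto intro!: eq_matI)
  have nth: "gauge_act B g m ! e = elem_act (g ! seg_before B e) (g ! seg_after B e) (m ! e)" if "e < length B" for e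
    unfolding gauge_act_def using that by simp
  have rep: "gauge_act B g m \<in> rep_space B v"
    unfolding rep_space_def mem_Collect_eq
  proof (intro conjI allI impI)
    show "length (gauge_act B g m) = length B" unfolding gauge_act_def by simp
    show "gauge_act B g m ! i \<in> elem_space B v i" if "i < length B" for i
      unfolding nth[OF that] by (rule gauge_act_elem_space[OF g mr that])
  qed
  have "moment_map B (gauge_act B g m) \<zeta> = 0\<^sub>m (v \<zeta>) (v \<zeta>)" if z: "\<zeta> < length B" for \<zeta>
  proof -
    let ?e = "elem_after B \<zeta>" and ?h = "g ! \<zeta>"
    have gc: "g ! i \<in> carrier_mat (v i) (v i)" "invertible_mat (g ! i)" if "i < length B" for i
      using g that unfolding gauge_group_def by auto
    note H = mat_inverse_invertible[OF gc[OF z]]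
    have e: "?e < length B" by (rule elem_after_less[OF z])
    have sp: "m ! i \<in> arrow_space (v (seg_before B i)) (v i) \<or> m ! i \<in> xpoint_space (v (seg_before B i)) (v i)"
      if "i < length B" for i
      using mr that unfolding rep_space_def elem_space_def seg_after_def by (cases "B ! i") auto
    note X = moment_carrier[OF mr z]
    have "moment_from_before (gauge_act B g m ! \<zeta>) = ?h * moment_from_before (m ! \<zeta>) * the (mat_inverse ?h)"
      unfolding nth[OF z] seg_after_def
      by (rule moment_from_elem_act(1)[OF sp[OF z] gc[OF seg_before_less[OF z]] gc[OF z]])
    moreover have "moment_from_after (gauge_act B g m ! ?e) = ?h * moment_from_after (m ! ?e) * the (mat_inverse ?h)"
      unfolding nth[OF e] seg_after_def
      using moment_from_elem_act(2)[OF sp[OF e] gc[OF seg_before_less[OF e]] gc[OF e]]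
      unfolding seg_before_elem_after[OF z] .
    ultimately have "moment_map B (gauge_act B g m) \<zeta>
        = ?h * (moment_from_before (m ! \<zeta>) + moment_from_after (m ! ?e)) * the (mat_inverse ?h)"
      unfolding moment_map_def elem_before_def mult_add_distrib_mat[OF gc(1)[OF z] X]
      using add_mult_distrib_mat[OF mult_carrier_mat[OF gc(1)[OF z] X(1)] mult_carrier_mat[OF gc(1)[OF z] X(2)] H(1)]
      by simp
    also have "moment_from_before (m ! \<zeta>) + moment_from_after (m ! ?e) = 0\<^sub>m (v \<zeta>) (v \<zeta>)"
      using mom[OF z] unfolding zero moment_map_def elem_before_def .
    finally show ?thesis using gc(1)[OF z] H(1) by simp
  qed
  thus ?thesis using rep unfolding moment_fibre_def zero by auto
qed

section \<open>Points of Proj\<close>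

lemma bow_variety_nonemptyD:
  assumes "bow_variety B v lam \<theta> \<noteq> {}"
  shows "\<forall>\<zeta><length B. v \<zeta> \<ge> 0" "moment_fibre B (\<lambda>\<zeta>. nat (v \<zeta>)) lam \<noteq> {}"
proof -
  show v: "\<forall>\<zeta><length B. v \<zeta> \<ge> 0"
  proof (rule ccontr)
    assume "\<not> (\<forall>\<zeta><length B. v \<zeta> \<ge> 0)"
    hence "\<exists>\<zeta><length B. v \<zeta> < 0" by (auto simp: not_le)
    thus False using assms unfolding bow_variety_def by simp
  qed
  let ?S = "semi_invariants B (\<lambda>\<zeta>. nat (v \<zeta>)) lam \<theta>"
  have "\<not> (\<exists>\<zeta><length B. v \<zeta> < 0)" using v by (auto simp: not_less)
  with assms obtain P where P: "P \<in> Proj ?S" unfolding bow_variety_def by (auto simp only: if_False)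
  show "moment_fibre B (\<lambda>\<zeta>. nat (v \<zeta>)) lam \<noteq> {}"
  proof
    assume "moment_fibre B (\<lambda>\<zeta>. nat (v \<zeta>)) lam = {}"
    hence "f = (\<lambda>_. 0)" if "f \<in> ?S d" for f d
      using that unfolding semi_invariants_def regular_funs_def by auto
    moreover have "(\<lambda>_. 0) \<in> P d" for d using P unfolding Proj_def by auto
    ultimately have "\<forall>d\<ge>1. ?S d \<subseteq> P d" by blast
    thus False using P unfolding Proj_def by auto
  qed
qed

lemma regular_funs_add:
  assumes f: "f \<in> regular_funs X" and g: "g \<in> regular_funs X"
  shows "(\<lambda>m. f m + g m) \<in> regular_funs X"
  unfolding regular_funs_def mem_Collect_eq
proof (intro conjI allI ballI impI)
  show "f m + g m = 0" if "m \<notin> X" for m using f g that unfolding regular_funs_def by simp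
  fix x assume x: "x \<in> X"
  obtain p q where pq: "p \<in> poly_funs" "q \<in> poly_funs" "q x \<noteq> 0" "\<And>m. m \<in> X \<Longrightarrow> q m \<noteq> 0 \<Longrightarrow> f m = p m / q m"
    using f x unfolding regular_funs_def by blast
  obtain r s where rs: "r \<in> poly_funs" "s \<in> poly_funs" "s x \<noteq> 0" "\<And>m. m \<in> X \<Longrightarrow> s m \<noteq> 0 \<Longrightarrow> g m = r m / s m"
    using g x unfolding regular_funs_def by blast
  show "\<exists>p\<in>poly_funs. \<exists>q\<in>poly_funs. q x \<noteq> 0 \<and> (\<forall>m\<in>X. q m \<noteq> 0 \<longrightarrow> f m + g m = p m / q m)"
    by (rule bexI[of _ "\<lambda>m. p m * s m + r m * q m"], rule bexI[of _ "\<lambda>m. q m * s m"])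
      (use pq rs in \<open>auto intro!: poly_add poly_mult simp: field_simps\<close>)
qed

lemma regular_funs_mult:
  assumes f: "f \<in> regular_funs X" and g: "g \<in> regular_funs X"
  shows "(\<lambda>m. f m * g m) \<in> regular_funs X"
  unfolding regular_funs_def mem_Collect_eq
proof (intro conjI allI ballI impI)
  show "f m * g m = 0" if "m \<notin> X" for m using f g that unfolding regular_funs_def by simp
  fix x assume x: "x \<in> X"
  obtain p q where pq: "p \<in> poly_funs" "q \<in> poly_funs" "q x \<noteq> 0" "\<And>m. m \<in> X \<Longrightarrow> q m \<noteq> 0 \<Longrightarrow> f m = p m / q m"
    using f x unfolding regular_funs_def by blast
  obtain r s where rs: "r \<in> poly_funs" "s \<in> poly_funs" "s x \<noteq> 0" "\<And>m. m \<in> X \<Longrightarrow> s m \<noteq> 0 \<Longrightarrow> g m = r m / s m"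
    using g x unfolding regular_funs_def by blast
  show "\<exists>p\<in>poly_funs. \<exists>q\<in>poly_funs. q x \<noteq> 0 \<and> (\<forall>m\<in>X. q m \<noteq> 0 \<longrightarrow> f m * g m = p m / q m)"
    by (rule bexI[of _ "\<lambda>m. p m * r m"], rule bexI[of _ "\<lambda>m. q m * s m"])
      (use pq rs in \<open>auto intro!: poly_mult\<close>)
qed

lemma regular_funs_indicator: "(\<lambda>m. if m \<in> X then c else 0) \<in> regular_funs X"
  unfolding regular_funs_def mem_Collect_eq
proof (intro conjI allI ballI impI)
  fix x assume "x \<in> X"
  show "\<exists>p\<in>poly_funs. \<exists>q\<in>poly_funs. q x \<noteq> 0 \<and> (\<forall>m\<in>X. q m \<noteq> 0 \<longrightarrow> (if m \<in> X then c else 0) = p m / q m)"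
    by (rule bexI[of _ "\<lambda>_. c"], rule bexI[of _ "\<lambda>_. 1"]) (auto intro: poly_const)
qed auto

lemma semi_invariants_zero:
  "(\<lambda>_. 0) \<in> semi_invariants B v lam \<theta> d"
  using regular_funs_indicator[of "moment_fibre B v lam" 0]
  unfolding semi_invariants_def by simp

lemma semi_invariants_add:
  "f \<in> semi_invariants B v lam \<theta> d \<Longrightarrow> g \<in> semi_invariants B v lam \<theta> d \<Longrightarrow>
    (\<lambda>m. f m + g m) \<in> semi_invariants B v lam \<theta> d"
  unfolding semi_invariants_def using regular_funs_add by (auto simp: algebra_simps)

lemma semi_invariants_mult:
  "f \<in> semi_invariants B v lam \<theta> d \<Longrightarrow> g \<in> semi_invariants B v lam \<theta> e \<Longrightarrow>
    (\<lambda>m. f m * g m) \<in> semi_invariants B v lam \<theta> (d + e)"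
  unfolding semi_invariants_def using regular_funs_mult by (auto simp: algebra_simps power_add)

lemma bow_variety_nonemptyI:
  assumes v: "\<forall>\<zeta><length B. v \<zeta> \<ge> 0" and m0: "m0 \<in> moment_fibre B (\<lambda>\<zeta>. nat (v \<zeta>)) (\<lambda>_. 0)"
  shows "bow_variety B v (\<lambda>_. 0) (\<lambda>_. 0) \<noteq> {}"
proof -
  let ?S = "semi_invariants B (\<lambda>\<zeta>. nat (v \<zeta>)) (\<lambda>_. 0) (\<lambda>_. 0)"
  let ?X = "moment_fibre B (\<lambda>\<zeta>. nat (v \<zeta>)) (\<lambda>_. 0)"
  define P where "P d = {f \<in> ?S d. f m0 = 0}" for d
  \<comment> \<open>Gauge invariance of the fibre makes its indicator function an element of degree one.\<close>
  have one: "(\<lambda>m. if m \<in> ?X then 1 else 0) \<in> ?S 1"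
    unfolding semi_invariants_def mem_Collect_eq
    using regular_funs_indicator[of ?X 1] gauge_act_fibre by (auto simp: gauge_char_def)
  have "P \<in> Proj ?S"
    unfolding Proj_def mem_Collect_eq
  proof (intro conjI allI ballI impI)
    show "P d \<subseteq> ?S d" for d unfolding P_def by auto
    show "(\<lambda>_. 0) \<in> P d" for d unfolding P_def using semi_invariants_zero by auto
    show "(\<lambda>m. f m + g m) \<in> P d" if "f \<in> P d" "g \<in> P d" for d f g
      using that semi_invariants_add unfolding P_def by auto
    show "(\<lambda>m. f m * g m) \<in> P (d + e)" if "f \<in> ?S d" "g \<in> P e" for d e f g
      using that semi_invariants_mult unfolding P_def by auto
    show "f \<in> P d \<or> g \<in> P e" if "f \<in> ?S d" "g \<in> ?S e" "(\<lambda>m. f m * g m) \<in> P (d + e)" for d e f g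
      using that unfolding P_def by auto
    show "\<not> (\<forall>d\<ge>1. ?S d \<subseteq> P d)"
    proof
      assume "\<forall>d\<ge>1. ?S d \<subseteq> P d"
      hence "(\<lambda>m. if m \<in> ?X then 1 else 0) \<in> P 1" using one by blast
      thus False using m0 unfolding P_def by simp
    qed
  qed
  moreover have "\<not> (\<exists>\<zeta><length B. v \<zeta> < 0)" using v by (auto simp: not_less)
  ultimately show ?thesis unfolding bow_variety_def by auto
qed

theorem mainTheorem2:
  fixes B :: bow and v v' :: "nat \<Rightarrow> int"
  assumes "B \<noteq> []"
    and "\<exists>(lam :: nat \<Rightarrow> complex) (\<theta> :: nat \<Rightarrow> int). bow_variety B v lam \<theta> \<noteq> {}"
    and "susy_increments B v v'"
  shows "\<exists>(lam :: nat \<Rightarrow> complex) (\<theta> :: nat \<Rightarrow> int). bow_variety B v' lam \<theta> \<noteq> {}"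
proof -
  obtain lam \<theta> where ne: "bow_variety B v lam \<theta> \<noteq> {}" using assms(2) by blast
  note v = bow_variety_nonemptyD(1)[OF ne]
  obtain m where "m \<in> moment_fibre B (\<lambda>\<zeta>. nat (v \<zeta>)) lam" using bow_variety_nonemptyD(2)[OF ne] by blast
  from susy_increments_admissible[OF assms(3) v fibre_imp_admissible[OF this]]
  obtain p' where v': "\<forall>\<zeta><length B. v' \<zeta> \<ge> 0" and p': "admissible B (\<lambda>\<zeta>. nat (v' \<zeta>)) p'" by blast
  obtain m' where "m' \<in> moment_fibre B (\<lambda>\<zeta>. nat (v' \<zeta>)) (\<lambda>_. 0)" using admissible_imp_fibre[OF p'] by blast
  from bow_variety_nonemptyI[OF v' this] show ?thesis by blast
qed

end
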